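(* Let $\kappa>1$. There exists a constant $c>0$ depending only on $\kappa$ such that the following holds. Let $m\ge n$, $m\ge k\ge r\ge 1$, $n\ge l\ge r$ be integers with $k\wedge l\ge 2r$, let $d>0$, $\sigma>0$, and let $\mathcal F=\mathcal F(m,n,k,l,r,d,\kappa)$ be the class of matrices defined in the context. Suppose one observes $\mathbf X=\mathbf M+\mathbf Z$ where $\mathbf M\in\mathcal F$ and $\mathbf Z\in\mathbb R^{m\times n}$ has i.i.d. $N(0,\sigma^2)$ entries. Then for every $q\in[1,2]$, $$\inf_{\widehat{\mathbf M}}\ \sup_{\mathbf M\in\mathcal F}\ \mathbb E\,\|\widehat{\mathbf M}-\mathbf M\|_{\mathrm s_q}^2\ \ge\ c\,\sigma^2\left[\left(r^{\frac2q-1}\frac{d^2}{\sigma^2}\right)\wedge \Psi_q(m,n,k,l,r)\right],$$ where the infimum is over all estimators (measurable functions of $\mathbf X$ with values in $\mathbb R^{m\times n}$) and $$\Psi_q(m,n,k,l,r)=r^{\frac2q}(k+l)+r^{\frac2q-1}\left(k\log\frac{\mathrm e\,m}{k}+l\log\frac{\mathrm e\,n}{l}\right).$$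
   Context: $a\wedge b=\min(a,b)$. For $\mathbf A\in\mathbb R^{m\times n}$ with singular values $\sigma_1(\mathbf A)\ge\dots\ge\sigma_{m\wedge n}(\mathbf A)\ge0$, the Schatten-$q$ norm is $\|\mathbf A\|_{\mathrm s_q}=(\sum_i\sigma_i(\mathbf A)^q)^{1/q}$. $\mathrm{supp}(\mathbf A)$ denotes the set of indices of nonzero rows of $\mathbf A$. A matrix is called orthonormal if its columns are orthonormal vectors. $\mathcal F(m,n,k,l,r,d,\kappa)$ is the set of all $\mathbf M\in\mathbb R^{m\times n}$ of rank $r$ whose singular value decomposition $\mathbf M=\mathbf U\mathbf D\mathbf V'$ ($\mathbf U$ being $m\times r$ orthonormal, $\mathbf V$ being $n\times r$ orthonormal, $\mathbf D=\mathrm{diag}(d_1,\dots,d_r)$) satisfies $|\mathrm{supp}(\mathbf U)|\le k$, $|\mathrm{supp}(\mathbf V)|\le l$ and $d\le d_r\le\cdots\le d_1\le\kappa d$. *)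

theory Defs
  imports
    "HOL-Probability.Probability"
    "HOL-Computational_Algebra.Computational_Algebra"
    "Jordan_Normal_Form.Char_Poly"
    "Jordan_Normal_Form.DL_Rank"
begin

text \<open>
  Since the dimensions are quantified inside the theorem, matrices are values of the
  carrier-based type \<^typ>\<open>real mat\<close> of \<^theory>\<open>Jordan_Normal_Form.Matrix\<close>; indices start at 0.
\<close>

text \<open>
  The square roots of the eigenvalues of \<open>A\<^sup>T A\<close>, counted with multiplicity, in
  nonincreasing order. If there are more columns than rows, the surplus eigenvalues cut off by
  \<^const>\<open>take\<close> are zero.
\<close>

definition singular_values :: "real mat \<Rightarrow> real list" where
  "singular_values A =
     take (min (dim_row A) (dim_col A))
       (rev (sorted_list_of_multiset
         (image_mset sqrt (proots (char_poly (transpose_mat A * A))))))"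

definition schatten_norm :: "real \<Rightarrow> real mat \<Rightarrow> real" where
  "schatten_norm q A = (\<Sum>s\<leftarrow>singular_values A. s powr q) powr (1 / q)"

definition supp_rows :: "real mat \<Rightarrow> nat set" where
  "supp_rows A = {i. i < dim_row A \<and> Matrix.row A i \<noteq> 0\<^sub>v (dim_col A)}"

definition orthonormal_cols :: "real mat \<Rightarrow> bool" where
  "orthonormal_cols A \<longleftrightarrow> transpose_mat A * A = 1\<^sub>m (dim_col A)"

text \<open>
  The factor \<open>U\<close> of a decomposition is not unique, but as the \<open>\<delta> i\<close> are positive its row support
  is that of \<open>M\<close>, and likewise for \<open>V\<close> and the transpose of \<open>M\<close>. So the
  existential quantifier does not depend on the chosen decomposition.
\<close>

definition sparse_svd_class ::
    "nat \<Rightarrow> nat \<Rightarrow> nat \<Rightarrow> nat \<Rightarrow> nat \<Rightarrow> real \<Rightarrow> real \<Rightarrow> real mat set" where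
  "sparse_svd_class m n k l r d \<kappa> =
     {M \<in> carrier_mat m n. vec_space.rank m M = r \<and>
        (\<exists>U V \<delta>. U \<in> carrier_mat m r \<and> orthonormal_cols U \<and>
           V \<in> carrier_mat n r \<and> orthonormal_cols V \<and>
           M = U * mat_diag r \<delta> * transpose_mat V \<and>
           card (supp_rows U) \<le> k \<and> card (supp_rows V) \<le> l \<and>
           (\<forall>i j. i \<le> j \<and> j < r \<longrightarrow> \<delta> j \<le> \<delta> i) \<and>
           (\<forall>i<r. d \<le> \<delta> i \<and> \<delta> i \<le> \<kappa> * d))}"

text \<open>The Borel \<open>\<sigma>\<close>-algebra on the real \<open>m \<times> n\<close> matrices, generated by the entries.\<close>

definition borel_mat :: "nat \<Rightarrow> nat \<Rightarrow> real mat measure" where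
  "borel_mat m n =
     vimage_algebra (carrier_mat m n) (\<lambda>A. \<lambda>ij\<in>{..<m} \<times> {..<n}. A $$ ij)
       (\<Pi>\<^sub>M ij\<in>{..<m} \<times> {..<n}. borel)"

text \<open>The law of an \<open>m \<times> n\<close> matrix with independent entries of law \<open>N(0, \<sigma>\<^sup>2)\<close>.\<close>

definition gaussian_mat :: "nat \<Rightarrow> nat \<Rightarrow> real \<Rightarrow> real mat measure" where
  "gaussian_mat m n \<sigma> =
     distr (\<Pi>\<^sub>M ij\<in>{..<m} \<times> {..<n}. density lborel (normal_density 0 \<sigma>))
       (borel_mat m n) (Matrix.mat m n)"

text \<open>
  \<^const>\<open>distr\<close> is meaningful only for a measurable map, and only then is this a
  probability measure.
\<close>

lemma measurable_mat [measurable]: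
  "Matrix.mat m n \<in> (\<Pi>\<^sub>M ij\<in>{..<m} \<times> {..<n}. borel) \<rightarrow>\<^sub>M borel_mat m n"
  unfolding borel_mat_def
proof (rule measurable_vimage_algebra2)
  show "Matrix.mat m n \<in> space (\<Pi>\<^sub>M ij\<in>{..<m} \<times> {..<n}. borel) \<rightarrow> carrier_mat m n"
    by auto
  have "(\<lambda>z. \<lambda>ij\<in>{..<m} \<times> {..<n}. z ij) \<in>
    (\<Pi>\<^sub>M ij\<in>{..<m} \<times> {..<n}. borel) \<rightarrow>\<^sub>M (\<Pi>\<^sub>M ij\<in>{..<m} \<times> {..<n}. borel :: real measure)"
    by measurable
  moreover have "(\<lambda>ij\<in>{..<m} \<times> {..<n}. Matrix.mat m n z $$ ij) = (\<lambda>ij\<in>{..<m} \<times> {..<n}. z ij)"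
    for z :: "nat \<times> nat \<Rightarrow> real"
    by (auto simp: restrict_def fun_eq_iff)
  ultimately show "(\<lambda>z. \<lambda>ij\<in>{..<m} \<times> {..<n}. Matrix.mat m n z $$ ij) \<in>
    (\<Pi>\<^sub>M ij\<in>{..<m} \<times> {..<n}. borel) \<rightarrow>\<^sub>M (\<Pi>\<^sub>M ij\<in>{..<m} \<times> {..<n}. borel :: real measure)"
    by simp
qed

lemma prob_space_gaussian_mat:
  assumes "\<sigma> > 0"
  shows "prob_space (gaussian_mat m n \<sigma>)"
proof -
  interpret N: prob_space "density lborel (normal_density 0 \<sigma>)"
    by (rule prob_space_normal_density[OF assms])
  have "prob_space (\<Pi>\<^sub>M ij\<in>{..<m} \<times> {..<n}. density lborel (normal_density 0 \<sigma>))"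
    by (intro prob_space_PiM N.prob_space_axioms)
  moreover have "sets (\<Pi>\<^sub>M ij\<in>{..<m} \<times> {..<n}. density lborel (normal_density 0 \<sigma>)) =
      sets (\<Pi>\<^sub>M ij\<in>{..<m} \<times> {..<n}. borel)"
    by (intro sets_PiM_cong) auto
  then have "Matrix.mat m n \<in>
      (\<Pi>\<^sub>M ij\<in>{..<m} \<times> {..<n}. density lborel (normal_density 0 \<sigma>)) \<rightarrow>\<^sub>M borel_mat m n"
    using measurable_mat measurable_cong_sets by blast
  ultimately show ?thesis
    unfolding gaussian_mat_def by (rule prob_space.prob_space_distr)
qed

text \<open>The risk of an estimator may be infinite, so it is taken in \<^typ>\<open>ennreal\<close>.\<close>

definition risk ::
    "nat \<Rightarrow> nat \<Rightarrow> real \<Rightarrow> real \<Rightarrow> (real mat \<Rightarrow> real mat) \<Rightarrow> real mat \<Rightarrow> ennreal" where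
  "risk m n \<sigma> q est M =
     (\<integral>\<^sup>+ Z. ennreal ((schatten_norm q (est (M + Z) - M))\<^sup>2) \<partial>gaussian_mat m n \<sigma>)"

definition minimax_risk ::
    "nat \<Rightarrow> nat \<Rightarrow> real \<Rightarrow> real \<Rightarrow> real mat set \<Rightarrow> ennreal" where
  "minimax_risk m n \<sigma> q F =
     (INF est \<in> borel_mat m n \<rightarrow>\<^sub>M borel_mat m n. SUP M \<in> F. risk m n \<sigma> q est M)"

definition Psi :: "real \<Rightarrow> nat \<Rightarrow> nat \<Rightarrow> nat \<Rightarrow> nat \<Rightarrow> nat \<Rightarrow> real" where
  "Psi q m n k l r =
     real r powr (2 / q) * real (k + l) +
     real r powr (2 / q - 1) *
       (real k * ln (exp 1 * real m / real k) + real l * ln (exp 1 * real n / real l))"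

end

theory Submission
  imports Defs "HOL-Combinatorics.Permutations"
begin

text \<open>
  Write \<open>X = r powr (2 / q - 1)\<close>. The bound is proved for each of the four terms of \<open>\<Psi>\<close>
  separately, that is, with \<open>X min (d\<^sup>2, \<sigma>\<^sup>2 T)\<close> for \<open>T = r k\<close>, \<open>r l\<close>, \<open>k log (e m / k)\<close>
  and \<open>l log (e n / l)\<close>. The matrices used have the form \<open>[d I; B]\<close>, padded with zero columns. For
  \<open>T = r k\<close> the block \<open>B\<close> is a sign matrix, multiplied by a scalar and chosen among those whose
  Gram matrix has a small Frobenius norm. For \<open>T = k log (e m / k)\<close> it is a sparse matrix in which
  every column has one nonzero entry in each of its row blocks. The other two cases follow by
  transposition.

  The members of such a family are indexed by words, and two words of large Hamming distance give
  matrices whose difference is large in nuclear norm. This is witnessed by a pairing with a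
  partial isometry of rank at most \<open>r\<close>, and Hoelder's inequality turns the pairing into a lower
  bound for every Schatten norm. A second moment bound for Gaussian likelihood ratios replaces
  Fano's inequality: a word cannot be recovered up to small Hamming distance when the radius of the
  family, measured in units of \<open>\<sigma>\<^sup>2\<close>, is a small multiple of the logarithm of its size.
\<close>

section \<open>The spectral theorem for real symmetric matrices\<close>

text \<open>The separation must be in nuclear norm. A difference of rank one has the same Schatten
  norm for every \<open>q\<close>, so Frobenius separation alone would lose the factor
  \<open>r powr (2 / q - 1)\<close>. The differences have to spread their Frobenius norm over about
  \<open>r\<close> singular values of similar size. Then the nuclear norm is about
  \<open>sqrt r\<close> times the Frobenius norm, and Hoelder's inequality, which costs
  \<open>r powr (1 / q - 1)\<close>, leaves that factor after squaring. This is why Gram matrices of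
  sign matrices are controlled and why sparse blocks of different columns occupy disjoint rows.

  The term \<open>d\<^sup>2\<close> in the minimum is the budget of the class: the Gram matrix of
  \<open>[d I; B]\<close> is \<open>d\<^sup>2 I + B\<^sup>T B\<close>, so all singular values are at
  least \<open>d\<close>, and at most \<open>\<kappa> d\<close> once the squared Frobenius norm of
  \<open>B\<close> is at most \<open>(\<kappa>\<^sup>2 - 1) d\<^sup>2\<close>.

  Separation is always certified by a linear functional. Such functionals are measurable and pass to
  the estimation error by linearity, so an estimator yields tests without any metric
  projection.\<close>

definition ip :: "nat \<Rightarrow> (nat \<Rightarrow> real) \<Rightarrow> (nat \<Rightarrow> real) \<Rightarrow> real" where
  "ip n x y = (\<Sum>a<n. x a * y a)"

text \<open>Over the complex numbers an eigenvector \<open>z\<close> exists. The Hermitian form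
  \<open>S\<close> of \<open>G\<close> at \<open>z\<close> equals its own conjugate because
  \<open>G\<close> is real and symmetric, and it is the eigenvalue times a positive number, so the
  eigenvalue is real. Then the real and the imaginary part of \<open>z\<close> both satisfy the
  eigenvector equation, and one of them is nonzero.\<close>

lemma real_eigenvector_exists:
  fixes G :: "nat \<Rightarrow> nat \<Rightarrow> real"
  assumes "n > 0" and sym: "\<And>a b. a < n \<Longrightarrow> b < n \<Longrightarrow> G a b = G b a"
  shows "\<exists>e v. ip n v v = 1 \<and> (\<forall>a<n. (\<Sum>b<n. G a b * v b) = e * v a)"
proof -
  define M where "M = Matrix.mat n n (\<lambda>(a, b). complex_of_real (G a b))"
  have M: "M \<in> carrier_mat n n"
    by (simp add: M_def)
  obtain as where as: "char_poly M = (\<Prod>a\<leftarrow>as. [:- a, 1:])" "length as = n"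
    using char_poly_factorized[OF M] by blast
  then obtain c where "c \<in> set as"
    using \<open>n > 0\<close> by (cases as) auto
  then have "poly (char_poly M) c = 0"
    unfolding as(1) poly_prod_list by (auto simp: prod_list_zero_iff)
  then have "eigenvalue M c"
    using eigenvalue_root_char_poly[OF M] by simp
  then obtain z where z: "z \<in> carrier_vec n" "z \<noteq> 0\<^sub>v n" "M *\<^sub>v z = c \<cdot>\<^sub>v z"
    using M by (auto simp: eigenvalue_def eigenvector_def)
  have eig: "(\<Sum>b<n. complex_of_real (G a b) * z $ b) = c * z $ a" if "a < n" for a
  proof -
    have "(M *\<^sub>v z) $ a = (\<Sum>b<n. complex_of_real (G a b) * z $ b)"
      using that z(1) by (auto simp: M_def scalar_prod_def lessThan_atLeast0 intro!: sum.cong)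
    then show ?thesis
      using z(3) that z(1) by simp
  qed
  define S where "S = (\<Sum>a<n. cnj (z $ a) * (\<Sum>b<n. complex_of_real (G a b) * z $ b))"
  define R where "R = (\<Sum>a<n. (cmod (z $ a))\<^sup>2)"
  obtain k where k: "k < n" "z $ k \<noteq> 0"
    using z(1,2) by (metis carrier_vecD eq_vecI index_zero_vec(1) zero_carrier_vec)
  have "R > 0"
    unfolding R_def by (rule sum_pos2[of _ k]) (use k in auto)
  have "S = (\<Sum>a<n. c * (cnj (z $ a) * z $ a))"
    unfolding S_def
  proof (intro sum.cong refl)
    fix a assume "a \<in> {..<n}"
    then show "cnj (z $ a) * (\<Sum>b<n. complex_of_real (G a b) * z $ b) = c * (cnj (z $ a) * z $ a)"
      by (subst eig) (auto simp: mult_ac)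
  qed
  also have "\<dots> = c * of_real R"
    unfolding R_def of_real_sum sum_distrib_left
    by (intro sum.cong refl) (simp add: complex_norm_square mult.commute del: of_real_power)
  finally have S: "S = c * of_real R" .
  have "cnj S = (\<Sum>a<n. \<Sum>b<n. complex_of_real (G a b) * z $ a * cnj (z $ b))"
    unfolding S_def by (simp add: sum_distrib_left mult_ac)
  also have "\<dots> = (\<Sum>b<n. \<Sum>a<n. complex_of_real (G a b) * z $ a * cnj (z $ b))"
    by (rule sum.swap)
  also have "\<dots> = S"
    unfolding S_def sum_distrib_left by (intro sum.cong) (auto simp: sym mult_ac)
  finally have "Im S = 0"
    by (metis complex_cnj_cancel_iff Im_complex_of_real Reals_cases complex_is_Real_iff Reals_cnj_iff)
  then have "Im c = 0"
    using \<open>R > 0\<close> unfolding S by simp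
  have re: "(\<Sum>b<n. G a b * Re (z $ b)) = Re c * Re (z $ a)" if "a < n" for a
    using arg_cong[OF eig[OF that], of Re] \<open>Im c = 0\<close> by simp
  have im: "(\<Sum>b<n. G a b * Im (z $ b)) = Re c * Im (z $ a)" if "a < n" for a
    using arg_cong[OF eig[OF that], of Im] \<open>Im c = 0\<close> by simp
  obtain x where x: "x k \<noteq> 0" "\<And>a. a < n \<Longrightarrow> (\<Sum>b<n. G a b * x b) = Re c * x a"
  proof (cases "Re (z $ k) = 0")
    case True
    then have "Im (z $ k) \<noteq> 0"
      using k(2) by (auto simp: complex_eq_iff)
    then show ?thesis
      using that[of "\<lambda>a. Im (z $ a)"] im by blast
  next
    case False
    then show ?thesis
      using that[of "\<lambda>a. Re (z $ a)"] re by blast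
  qed
  have pos: "ip n x x > 0"
    unfolding ip_def by (rule sum_pos2[of _ k]) (use k x in \<open>auto simp: zero_less_mult_iff\<close>)
  define v where "v a = x a / sqrt (ip n x x)" for a
  have "ip n v v = ip n x x / (sqrt (ip n x x) * sqrt (ip n x x))"
    unfolding v_def ip_def[of n "\<lambda>a. x a / sqrt (ip n x x)"] times_divide_times_eq sum_divide_distrib[symmetric]
    by (simp add: ip_def)
  then have "ip n v v = 1"
    using pos by simp
  moreover have "(\<Sum>b<n. G a b * v b) = Re c * v a" if "a < n" for a
    using x(2)[OF that] unfolding v_def by (simp flip: sum_divide_distrib)
  ultimately show ?thesis
    by blast
qed

text \<open>The rows of the Householder reflection that exchanges \<open>v\<close> and the first
  unit vector. This matrix is symmetric, so orthonormality of its rows is also orthonormality of its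
  columns, that is, completeness. If \<open>v\<close> is the first unit vector, there is no
  direction to reflect in and the identity matrix serves.\<close>

lemma orthonormal_completion:
  assumes "ip (Suc n) v v = 1"
  shows "\<exists>w. (\<forall>a<Suc n. w 0 a = v a) \<and>
    (\<forall>i<Suc n. \<forall>j<Suc n. ip (Suc n) (w i) (w j) = (if i = j then 1 else 0)) \<and>
    (\<forall>a<Suc n. \<forall>b<Suc n. (\<Sum>i<Suc n. w i a * w i b) = (if a = b then 1 else 0))"
proof (cases "v 0 = 1")
  case True
  have "(\<Sum>a<n. v (Suc a) * v (Suc a)) = 0"
    using assms True unfolding ip_def sum.lessThan_Suc_shift by simp
  then have "v (Suc a) = 0" if "a < n" for a
    using that by (subst (asm) sum_nonneg_eq_0_iff) auto
  then have v: "v a = (if a = 0 then 1 else 0)" if "a < Suc n" for a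
    using that True by (cases a) auto
  define w :: "nat \<Rightarrow> nat \<Rightarrow> real" where "w i a = (if i = a then 1 else 0)" for i a
  have 1: "ip (Suc n) (w i) (w j) = (if i = j then 1 else 0)" if "i < Suc n" "j < Suc n" for i j
    using that by (simp add: ip_def w_def if_distrib[of "\<lambda>x. x * _"] sum.delta cong: if_cong)
  have 2: "(\<Sum>i<Suc n. w i a * w i b) = (if a = b then 1 else 0)" if "a < Suc n" "b < Suc n" for a b
    using that by (simp add: w_def if_distrib[of "\<lambda>x. x * _"] cong: if_cong)
  have 0: "w 0 a = v a" if "a < Suc n" for a
    using v[OF that] by (simp add: w_def)
  show ?thesis
    by (intro exI[of _ w] conjI allI impI 0 1 2)
next
  case False
  define \<delta> :: "nat \<Rightarrow> nat \<Rightarrow> real" where "\<delta> i j = (if i = j then 1 else 0)" for i j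
  define u where "u a = v a - \<delta> a 0" for a
  define s where "s = ip (Suc n) u u"
  have pull: "(\<Sum>a<Suc n. \<delta> i a * f a) = f i" if "i < Suc n" for f i
    using that by (simp add: \<delta>_def if_distrib[of "\<lambda>x. x * _"] sum.delta cong: if_cong)
  have \<delta>_sym: "\<delta> i j = \<delta> j i" for i j
    by (simp add: \<delta>_def)
  have "s = ip (Suc n) v v - 2 * (\<Sum>a<Suc n. \<delta> 0 a * v a) + (\<Sum>a<Suc n. \<delta> 0 a * \<delta> 0 a)"
    unfolding s_def ip_def u_def sum_distrib_left sum_subtractf[symmetric] sum.distrib[symmetric]
    by (intro sum.cong refl) (simp add: \<delta>_sym[of _ 0] algebra_simps)
  also have "\<dots> = 2 - 2 * v 0"
    unfolding pull[OF zero_less_Suc] assms by (simp add: \<delta>_def)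
  finally have s: "s = 2 - 2 * v 0" .
  then have "s \<noteq> 0"
    using False by simp
  define w where "w i a = \<delta> i a - 2 * u i * u a / s" for i a
  have sym: "w i a = w a i" for i a
    by (simp add: w_def \<delta>_sym mult_ac)
  have 1: "ip (Suc n) (w i) (w j) = \<delta> i j" if ij: "i < Suc n" "j < Suc n" for i j
  proof -
    have "ip (Suc n) (w i) (w j) = (\<Sum>a<Suc n. \<delta> i a * \<delta> j a - (2 * u j / s) * (\<delta> i a * u a)
        - (2 * u i / s) * (\<delta> j a * u a) + (4 * u i * u j / s\<^sup>2) * (u a * u a))"
      unfolding ip_def w_def by (intro sum.cong refl) (simp add: algebra_simps power2_eq_square)
    also have "\<dots> = \<delta> j i - (2 * u j / s) * u i - (2 * u i / s) * u j + (4 * u i * u j / s\<^sup>2) * s"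
      unfolding sum.distrib sum_subtractf sum_distrib_left[symmetric] pull[OF ij(1)] pull[OF ij(2)]
      by (simp add: s_def ip_def)
    also have "\<dots> = \<delta> i j"
      using \<open>s \<noteq> 0\<close> by (simp add: \<delta>_sym power2_eq_square)
    finally show ?thesis .
  qed
  have 2: "(\<Sum>i<Suc n. w i a * w i b) = \<delta> a b" if "a < Suc n" "b < Suc n" for a b
    using 1[OF that] unfolding ip_def by (simp add: sym[of _ a] sym[of _ b])
  have 0: "w 0 a = v a" if "a < Suc n" for a
  proof -
    have "u 0 = - s / 2"
      by (simp add: u_def \<delta>_def s)
    then have "w 0 a = \<delta> 0 a + u a"
      using \<open>s \<noteq> 0\<close> by (simp add: w_def)
    then show ?thesis
      by (simp add: u_def \<delta>_sym)
  qed
  show ?thesis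
    by (intro exI[of _ w] conjI allI impI 0 1[unfolded \<delta>_def] 2[unfolded \<delta>_def])
qed

lemma ip_commute: "ip n x y = ip n y x"
  by (simp add: ip_def mult.commute)

text \<open>Completeness stands beside orthonormality so that expansions in the basis and Parseval's
  identity can be read off directly.\<close>

definition eigensystem ::
    "nat \<Rightarrow> (nat \<Rightarrow> nat \<Rightarrow> real) \<Rightarrow> (nat \<Rightarrow> nat \<Rightarrow> real) \<Rightarrow> (nat \<Rightarrow> real) \<Rightarrow> bool" where
  "eigensystem n G v e \<longleftrightarrow>
     (\<forall>i<n. \<forall>j<n. ip n (v i) (v j) = (if i = j then 1 else 0)) \<and>
     (\<forall>a<n. \<forall>b<n. (\<Sum>i<n. v i a * v i b) = (if a = b then 1 else 0)) \<and>
     (\<forall>i<n. \<forall>a<n. (\<Sum>b<n. G a b * v i b) = e i * v i a)"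

lemma eigensystemD:
  assumes "eigensystem n G v e"
  shows "i < n \<Longrightarrow> j < n \<Longrightarrow> ip n (v i) (v j) = (if i = j then 1 else 0)"
    and "a < n \<Longrightarrow> b < n \<Longrightarrow> (\<Sum>i<n. v i a * v i b) = (if a = b then 1 else 0)"
    and "i < n \<Longrightarrow> a < n \<Longrightarrow> (\<Sum>b<n. G a b * v i b) = e i * v i a"
  using assms by (simp_all only: eigensystem_def simp_thms)

text \<open>Deflation: in an orthonormal basis \<open>w\<close> that starts with an eigenvector,
  \<open>H\<close> is the matrix of \<open>G\<close> on the orthogonal complement of that
  eigenvector. An eigenbasis \<open>y\<close> of \<open>H\<close> is carried back to the vectors
  \<open>z\<close>.\<close>

theorem spectral_theorem:
  fixes G :: "nat \<Rightarrow> nat \<Rightarrow> real"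
  assumes "\<And>a b. a < n \<Longrightarrow> b < n \<Longrightarrow> G a b = G b a"
  shows "\<exists>v e. eigensystem n G v e"
  using assms
proof (induction n arbitrary: G)
  case 0
  then show ?case
    by (simp add: eigensystem_def)
next
  case (Suc n G)
  obtain e0 v0 where v0: "ip (Suc n) v0 v0 = 1"
    and eig0: "\<And>a. a < Suc n \<Longrightarrow> (\<Sum>b<Suc n. G a b * v0 b) = e0 * v0 a"
    using real_eigenvector_exists[of "Suc n" G] Suc.prems by auto
  obtain w where w: "(\<forall>a<Suc n. w 0 a = v0 a) \<and>
    (\<forall>i<Suc n. \<forall>j<Suc n. ip (Suc n) (w i) (w j) = (if i = j then 1 else 0)) \<and>
    (\<forall>a<Suc n. \<forall>b<Suc n. (\<Sum>i<Suc n. w i a * w i b) = (if a = b then 1 else 0))"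
    using orthonormal_completion[OF v0] by (elim exE)
  note w0 = w[THEN conjunct1, rule_format]
    and ww = w[THEN conjunct2, THEN conjunct1, rule_format]
    and wc = w[THEN conjunct2, THEN conjunct2, rule_format]
  define H where "H j k = (\<Sum>a<Suc n. \<Sum>b<Suc n. w (Suc j) a * G a b * w (Suc k) b)" for j k
  have Hsym: "H j k = H k j" for j k
  proof -
    have "H j k = (\<Sum>b<Suc n. \<Sum>a<Suc n. w (Suc j) a * G a b * w (Suc k) b)"
      unfolding H_def by (rule sum.swap)
    also have "\<dots> = H k j"
      unfolding H_def by (intro sum.cong) (auto simp: Suc.prems mult_ac)
    finally show ?thesis .
  qed
  obtain y e where "eigensystem n H y e"
    using Suc.IH[of H, OF Hsym] by blast
  note yy = eigensystemD(1)[OF this] and yc = eigensystemD(2)[OF this] and ye = eigensystemD(3)[OF this]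
  define z where "z i a = (\<Sum>j<n. y i j * w (Suc j) a)" for i a
  define v where "v i = (case i of 0 \<Rightarrow> w 0 | Suc i \<Rightarrow> z i)" for i
  define f where "f i = (case i of 0 \<Rightarrow> e0 | Suc i \<Rightarrow> e i)" for i
  have wz: "ip (Suc n) (w k) (z i) = (case k of 0 \<Rightarrow> 0 | Suc k \<Rightarrow> y i k)" if "k < Suc n" "i < n" for k i
  proof -
    have "ip (Suc n) (w k) (z i) = (\<Sum>a<Suc n. \<Sum>j<n. y i j * (w k a * w (Suc j) a))"
      unfolding ip_def z_def sum_distrib_left by (simp add: mult_ac)
    also have "\<dots> = (\<Sum>j<n. y i j * ip (Suc n) (w k) (w (Suc j)))"
      unfolding ip_def sum_distrib_left by (rule sum.swap)
    also have "\<dots> = (\<Sum>j<n. y i j * (if k = Suc j then 1 else 0))"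
      using that by (intro sum.cong) (auto simp: ww)
    also have "\<dots> = (case k of 0 \<Rightarrow> 0 | Suc k \<Rightarrow> y i k)"
      using that by (cases k) (auto simp: if_distrib[of "\<lambda>x. _ * x"] cong: if_cong)
    finally show ?thesis .
  qed
  have zz: "ip (Suc n) (z i) (z j) = (if i = j then 1 else 0)" if "i < n" "j < n" for i j
  proof -
    have "ip (Suc n) (z i) (z j) = (\<Sum>a<Suc n. \<Sum>l<n. y i l * (w (Suc l) a * z j a))"
      unfolding ip_def z_def[of i] sum_distrib_right by (simp add: mult_ac)
    also have "\<dots> = (\<Sum>l<n. y i l * ip (Suc n) (w (Suc l)) (z j))"
      unfolding ip_def sum_distrib_left by (rule sum.swap)
    also have "\<dots> = (\<Sum>l<n. y i l * y j l)"
      using that by (intro sum.cong) (auto simp: wz)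
    finally show ?thesis
      using yy[OF that] by (simp add: ip_def)
  qed
  have zc: "(\<Sum>i<n. z i a * z i b) = (\<Sum>j<n. w (Suc j) a * w (Suc j) b)" for a b
  proof -
    have "(\<Sum>i<n. z i a * z i b) = (\<Sum>i<n. \<Sum>j<n. \<Sum>k<n. (y i j * y i k) * (w (Suc j) a * w (Suc k) b))"
      unfolding z_def sum_product by (simp add: mult_ac)
    also have "\<dots> = (\<Sum>j<n. \<Sum>i<n. \<Sum>k<n. (y i j * y i k) * (w (Suc j) a * w (Suc k) b))"
      by (rule sum.swap)
    also have "\<dots> = (\<Sum>j<n. \<Sum>k<n. \<Sum>i<n. (y i j * y i k) * (w (Suc j) a * w (Suc k) b))"
      by (intro sum.cong refl sum.swap)
    also have "\<dots> = (\<Sum>j<n. \<Sum>k<n. (if j = k then 1 else 0) * (w (Suc j) a * w (Suc k) b))"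
      unfolding sum_distrib_right[symmetric] by (intro sum.cong refl) (simp add: yc)
    also have "\<dots> = (\<Sum>j<n. w (Suc j) a * w (Suc j) b)"
      by (intro sum.cong refl) (simp add: if_distrib[of "\<lambda>x. x * _"] cong: if_cong)
    finally show ?thesis .
  qed
  have ez: "(\<Sum>b<Suc n. G a b * z i b) = e i * z i a" if "a < Suc n" "i < n" for a i
  proof -
    \<comment> \<open>The eigenvector equation is checked on coordinates in the basis
      \<open>w\<close>. The coordinate along \<open>w 0\<close> vanishes because symmetry moves
      \<open>G\<close> over to the eigenvector \<open>v0\<close>, to which \<open>z i\<close> is
      orthogonal.\<close>
    define g where "g a = (\<Sum>b<Suc n. G a b * z i b)" for a
    have wg: "ip (Suc n) (w k) g = (case k of 0 \<Rightarrow> 0 | Suc k \<Rightarrow> e i * y i k)" if "k < Suc n" for k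
    proof (cases k)
      case 0
      have "ip (Suc n) (w k) g = (\<Sum>a<Suc n. \<Sum>b<Suc n. z i b * (G b a * v0 a))"
        unfolding ip_def g_def sum_distrib_left 0
        by (intro sum.cong refl) (simp add: w0 Suc.prems mult_ac)
      also have "\<dots> = (\<Sum>b<Suc n. z i b * (\<Sum>a<Suc n. G b a * v0 a))"
        unfolding sum_distrib_left by (rule sum.swap)
      also have "\<dots> = (\<Sum>b<Suc n. z i b * (e0 * v0 b))"
        by (intro sum.cong refl arg_cong2[of _ _ _ _ "(*)"] eig0) simp
      also have "\<dots> = e0 * ip (Suc n) (w 0) (z i)"
        unfolding ip_def sum_distrib_left by (intro sum.cong) (auto simp: w0)
      finally show ?thesis
        using wz[of 0 i] \<open>i < n\<close> 0 by simp
    next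
      case (Suc k')
      have "ip (Suc n) (w k) g = (\<Sum>a<Suc n. \<Sum>b<Suc n. \<Sum>l<n. w (Suc k') a * G a b * w (Suc l) b * y i l)"
        unfolding ip_def g_def z_def sum_distrib_left Suc by (simp add: mult_ac)
      also have "\<dots> = (\<Sum>a<Suc n. \<Sum>l<n. \<Sum>b<Suc n. w (Suc k') a * G a b * w (Suc l) b * y i l)"
        by (intro sum.cong refl sum.swap)
      also have "\<dots> = (\<Sum>l<n. \<Sum>a<Suc n. \<Sum>b<Suc n. w (Suc k') a * G a b * w (Suc l) b * y i l)"
        by (rule sum.swap)
      also have "\<dots> = (\<Sum>l<n. H k' l * y i l)"
        unfolding H_def sum_distrib_right ..
      also have "\<dots> = e i * y i k'"
        using ye[OF \<open>i < n\<close>, of k'] that Suc by simp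
      finally show ?thesis
        using Suc by simp
    qed
    have "g a = (\<Sum>b<Suc n. (if a = b then 1 else 0) * g b)"
      using that(1) by (simp add: if_distrib[of "\<lambda>x. x * _"] sum.delta cong: if_cong)
    also have "\<dots> = (\<Sum>b<Suc n. (\<Sum>k<Suc n. w k a * w k b) * g b)"
      using that(1) by (intro sum.cong refl) (simp only: wc lessThan_iff)
    also have "\<dots> = (\<Sum>k<Suc n. \<Sum>b<Suc n. w k a * (w k b * g b))"
      unfolding sum_distrib_right mult.assoc by (rule sum.swap)
    also have "\<dots> = (\<Sum>k<Suc n. w k a * ip (Suc n) (w k) g)"
      unfolding ip_def sum_distrib_left ..
    also have "\<dots> = (\<Sum>k<Suc n. w k a * (case k of 0 \<Rightarrow> 0 | Suc k \<Rightarrow> e i * y i k))"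
      by (intro sum.cong refl) (simp only: wg lessThan_iff)
    also have "\<dots> = e i * z i a"
      unfolding sum.lessThan_Suc_shift z_def sum_distrib_left by (simp add: mult_ac)
    finally show ?thesis
      unfolding g_def .
  qed
  have 1: "ip (Suc n) (v i) (v j) = (if i = j then 1 else 0)" if "i < Suc n" "j < Suc n" for i j
    using that wz[of 0] ww[of 0 0] zz ip_commute[of "Suc n" "z _" "w 0"]
    by (auto simp: v_def split: nat.splits)
  have 2: "(\<Sum>i<Suc n. v i a * v i b) = (if a = b then 1 else 0)" if "a < Suc n" "b < Suc n" for a b
  proof -
    have "(\<Sum>i<Suc n. v i a * v i b) = w 0 a * w 0 b + (\<Sum>i<n. z i a * z i b)"
      unfolding sum.lessThan_Suc_shift by (simp add: v_def)
    also have "\<dots> = (\<Sum>i<Suc n. w i a * w i b)"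
      unfolding zc sum.lessThan_Suc_shift ..
    finally show ?thesis
      using wc[OF that] by simp
  qed
  have 3: "(\<Sum>b<Suc n. G a b * v i b) = f i * v i a" if "i < Suc n" "a < Suc n" for i a
  proof (cases i)
    case 0
    have "(\<Sum>b<Suc n. G a b * v i b) = (\<Sum>b<Suc n. G a b * v0 b)"
      unfolding 0 v_def by (intro sum.cong) (auto simp: w0)
    then show ?thesis
      using eig0[OF that(2)] 0 that by (simp add: v_def f_def w0)
  next
    case (Suc i')
    then show ?thesis
      using ez[OF that(2), of i'] that by (simp add: v_def f_def)
  qed
  show ?case
    unfolding eigensystem_def by (intro exI[of _ v] exI[of _ f] conjI allI impI 1 2 3)
qed

text \<open>Links the spectral theorem to \<open>singular_values\<close>, which is defined by the
  roots of a characteristic polynomial: the basis is a similarity to a diagonal matrix.\<close>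

lemma char_poly_of_eigenbasis:
  fixes G :: "nat \<Rightarrow> nat \<Rightarrow> real"
  assumes "eigensystem n G v e"
  shows "char_poly (Matrix.mat n n (\<lambda>(a, b). G a b)) = (\<Prod>i\<leftarrow>[0..<n]. [:- e i, 1:])"
proof -
  note on = eigensystemD(1)[OF assms] and compl = eigensystemD(2)[OF assms]
    and eig = eigensystemD(3)[OF assms]
  define A where "A = Matrix.mat n n (\<lambda>(a, b). G a b)"
  define B where "B = Matrix.mat n n (\<lambda>(a, b). if a = b then e a else 0)"
  define P where "P = Matrix.mat n n (\<lambda>(a, i). v i a)"
  define Q where "Q = Matrix.mat n n (\<lambda>(i, a). v i a)"
  have car: "A \<in> carrier_mat n n" "B \<in> carrier_mat n n" "P \<in> carrier_mat n n" "Q \<in> carrier_mat n n"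
    by (auto simp: A_def B_def P_def Q_def)
  have PQ: "P * Q = 1\<^sub>m n"
    using compl by (intro eq_matI) (auto simp: P_def Q_def scalar_prod_def lessThan_atLeast0)
  have QP: "Q * P = 1\<^sub>m n"
    using on by (intro eq_matI) (auto simp: P_def Q_def scalar_prod_def lessThan_atLeast0 ip_def)
  have "A * P = P * B"
  proof (intro eq_matI)
    fix a i assume "a < dim_row (P * B)" "i < dim_col (P * B)"
    then have ai: "a < n" "i < n"
      by (auto simp: P_def B_def)
    have "(A * P) $$ (a, i) = (\<Sum>b<n. G a b * v i b)"
      using ai by (auto simp: A_def P_def scalar_prod_def lessThan_atLeast0)
    moreover have "(P * B) $$ (a, i) = (\<Sum>b<n. v b a * (if b = i then e b else 0))"
      using ai by (auto simp: B_def P_def scalar_prod_def lessThan_atLeast0)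
    ultimately show "(A * P) $$ (a, i) = (P * B) $$ (a, i)"
      using ai eig by (simp add: if_distrib[of "\<lambda>x. _ * x"] cong: if_cong)
  qed (auto simp: A_def B_def P_def)
  then have "P * B * Q = A * P * Q"
    by simp
  also have "\<dots> = A"
    using car PQ by (simp add: assoc_mult_mat[of A n n P n Q n])
  finally have "similar_mat_wit A B P Q"
    using car PQ QP unfolding similar_mat_wit_def Let_def by auto
  then have "char_poly A = char_poly B"
    by (intro char_poly_similar) (auto simp: similar_mat_def)
  also have "\<dots> = (\<Prod>a\<leftarrow>diag_mat B. [:- a, 1:])"
    by (rule char_poly_upper_triangular[OF car(2)]) (auto simp: B_def upper_triangular_def)
  also have "diag_mat B = map e [0..<n]"
    by (auto simp: diag_mat_def B_def)
  finally show ?thesis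
    by (simp add: A_def o_def)
qed

section \<open>Singular values and duality of Schatten norms\<close>

text \<open>The weighted inequality between arithmetic and geometric mean for
  \<open>s powr q * \<mu> powr (1 - q)\<close> and \<open>\<mu>\<close>, with weights
  \<open>1 / q\<close> and \<open>1 - 1 / q\<close>; in the geometric mean the powers of
  \<open>\<mu>\<close> cancel.\<close>

lemma powr_Young:
  fixes s \<mu> q :: real
  assumes "s \<ge> 0" "\<mu> > 0" "q \<ge> 1"
  shows "s \<le> s powr q * \<mu> powr (1 - q) / q + \<mu> * (1 - 1 / q)"
proof (cases "s = 0")
  case True
  then show ?thesis
    using assms by (simp add: mult_nonneg_nonneg)
next
  case False
  have "(s powr q * \<mu> powr (1 - q)) powr (1 / q) * \<mu> powr (1 - 1 / q) \<le>
      1 / q * (s powr q * \<mu> powr (1 - q)) + (1 - 1 / q) * \<mu>"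
    using assms False by (intro Youngs_inequality_0 mult_pos_pos) (auto simp: field_simps)
  moreover have "(s powr q * \<mu> powr (1 - q)) powr (1 / q) * \<mu> powr (1 - 1 / q) =
      s powr (q * (1 / q)) * (\<mu> powr ((1 - q) * (1 / q)) * \<mu> powr (1 - 1 / q))"
    using assms by (simp add: powr_mult powr_powr)
  moreover have "\<mu> powr ((1 - q) * (1 / q)) * \<mu> powr (1 - 1 / q) = 1"
    using assms by (simp add: powr_add[symmetric] field_simps)
  ultimately show ?thesis
    using assms by (simp add: mult_ac)
qed

text \<open>Hoelder's inequality for weights in \<open>[0, 1]\<close> of total mass at most
  \<open>R\<close>. To avoid the conjugate exponent, which is infinite for \<open>q = 1\<close>,
  Young's inequality is applied to every term with the same \<open>\<mu>\<close> and summed.\<close>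

lemma weighted_sum_le_powr:
  fixes s t :: "nat \<Rightarrow> real"
  assumes s: "\<And>i. i < n \<Longrightarrow> s i \<ge> 0" and t: "\<And>i. i < n \<Longrightarrow> 0 \<le> t i" "\<And>i. i < n \<Longrightarrow> t i \<le> 1"
    and T: "(\<Sum>i<n. t i) \<le> R" and "R > 0" "q \<ge> 1"
  shows "(\<Sum>i<n. s i * t i) \<le> R powr (1 - 1 / q) * (\<Sum>i<n. s i powr q) powr (1 / q)"
proof (cases "(\<Sum>i<n. s i powr q) = 0")
  case True
  then have "s i = 0" if "i < n" for i
    using that by (subst (asm) sum_nonneg_eq_0_iff) auto
  then show ?thesis
    by simp
next
  case False
  define S where "S = (\<Sum>i<n. s i powr q)"
  have "S > 0"
    using False sum_nonneg[of "{..<n}" "\<lambda>i. s i powr q"] unfolding S_def by force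
  \<comment> \<open>The value that \<open>R\<close> equal entries would have if their
    \<open>q\<close>-th powers added up to \<open>S\<close>; it minimizes the summed bound.\<close>
  define \<mu> where "\<mu> = (S / R) powr (1 / q)"
  have "\<mu> > 0"
    using \<open>S > 0\<close> \<open>R > 0\<close> by (simp add: \<mu>_def)
  have "(\<Sum>i<n. s i * t i) \<le> (\<Sum>i<n. s i powr q * (\<mu> powr (1 - q) / q) + \<mu> * (1 - 1 / q) * t i)"
  proof (rule sum_mono)
    fix i assume "i \<in> {..<n}"
    then have i: "i < n" by simp
    have "s i * t i \<le> (s i powr q * \<mu> powr (1 - q) / q + \<mu> * (1 - 1 / q)) * t i"
      using powr_Young[OF s[OF i] \<open>\<mu> > 0\<close> \<open>q \<ge> 1\<close>] t(1)[OF i] by (rule mult_right_mono)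
    also have "\<dots> \<le> s i powr q * (\<mu> powr (1 - q) / q) + \<mu> * (1 - 1 / q) * t i"
      using mult_left_mono[OF t(2)[OF i], of "s i powr q * \<mu> powr (1 - q) / q"] \<open>q \<ge> 1\<close>
      by (simp add: algebra_simps)
    finally show "s i * t i \<le> s i powr q * (\<mu> powr (1 - q) / q) + \<mu> * (1 - 1 / q) * t i" .
  qed
  also have "\<dots> = S * \<mu> powr (1 - q) / q + \<mu> * (1 - 1 / q) * (\<Sum>i<n. t i)"
    by (simp add: sum.distrib S_def sum_distrib_left sum_distrib_right sum_divide_distrib)
  also have "\<dots> \<le> S * \<mu> powr (1 - q) / q + \<mu> * (1 - 1 / q) * R"
    using T \<open>\<mu> > 0\<close> \<open>q \<ge> 1\<close> by (intro add_left_mono mult_left_mono) auto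
  also have "S * \<mu> powr (1 - q) = R powr (1 - 1 / q) * S powr (1 / q)"
  proof -
    have "\<mu> powr (1 - q) = S powr (1 / q - 1) / R powr (1 / q - 1)"
      using \<open>S > 0\<close> \<open>R > 0\<close> \<open>q \<ge> 1\<close> unfolding \<mu>_def powr_powr
      by (subst powr_divide[symmetric]) (auto simp: field_simps)
    moreover have "S * S powr (1 / q - 1) = S powr (1 / q)"
      using \<open>S > 0\<close> by (simp add: powr_mult_base)
    moreover have "1 / R powr (1 / q - 1) = R powr (1 - 1 / q)"
      by (simp add: powr_minus_divide[symmetric])
    ultimately show ?thesis
      by (simp add: mult_ac divide_inverse)
  qed
  also have "\<mu> * (1 - 1 / q) * R = (1 - 1 / q) * (R powr (1 - 1 / q) * S powr (1 / q))"
  proof -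
    have "R * R powr (- (1 / q)) = R powr (1 - 1 / q)"
      using \<open>R > 0\<close> by (simp add: powr_mult_base)
    moreover have "\<mu> * (1 - 1 / q) * R = (1 - 1 / q) * (S powr (1 / q) * (R * R powr (- (1 / q))))"
      using \<open>S > 0\<close> \<open>R > 0\<close> unfolding \<mu>_def by (simp add: powr_divide powr_minus_divide)
    ultimately show ?thesis
      by (simp add: mult_ac)
  qed
  also have "R powr (1 - 1 / q) * S powr (1 / q) / q + (1 - 1 / q) * (R powr (1 - 1 / q) * S powr (1 / q)) =
      R powr (1 - 1 / q) * S powr (1 / q)"
    by (simp add: algebra_simps)
  finally show ?thesis
    unfolding S_def .
qed

text \<open>Lengths below 1 are allowed because left singular vectors of the singular value 0 are
  set to 0, and because the certificates for sparse matrices use columns of unequal length.\<close>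

definition suborthonormal :: "nat \<Rightarrow> nat \<Rightarrow> (nat \<Rightarrow> nat \<Rightarrow> real) \<Rightarrow> bool" where
  "suborthonormal r n p \<longleftrightarrow>
     (\<forall>i<r. \<forall>j<r. i \<noteq> j \<longrightarrow> ip n (p i) (p j) = 0) \<and> (\<forall>i<r. ip n (p i) (p i) \<le> 1)"

text \<open>When some \<open>p j\<close> is shorter than 1, \<open>y\<close> need not be the
  orthogonal projection of \<open>x\<close>, but \<open>ip n y y \<le> ip n x y\<close> still holds,
  and this is what the expansion of the square of \<open>x - y\<close> uses.\<close>

lemma Bessel_inequality:
  assumes "suborthonormal r n p"
  shows "(\<Sum>j<r. (ip n (p j) x)\<^sup>2) \<le> ip n x x"
proof -
  define c where "c j = ip n (p j) x" for j
  define y where "y a = (\<Sum>j<r. c j * p j a)" for a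
  have ipy: "ip n z y = (\<Sum>j<r. c j * ip n (p j) z)" for z
  proof -
    have "ip n z y = (\<Sum>a<n. \<Sum>j<r. c j * (p j a * z a))"
      unfolding ip_def y_def sum_distrib_left by (simp add: mult_ac)
    also have "\<dots> = (\<Sum>j<r. c j * ip n (p j) z)"
      unfolding ip_def sum_distrib_left by (rule sum.swap)
    finally show ?thesis .
  qed
  have xy: "ip n x y = (\<Sum>j<r. (c j)\<^sup>2)"
    unfolding ipy by (simp add: c_def power2_eq_square)
  have "ip n (p j) y = c j * ip n (p j) (p j)" if "j < r" for j
  proof -
    have "ip n (p j) y = (\<Sum>i<r. if i = j then c j * ip n (p j) (p j) else 0)"
      unfolding ipy using assms that by (intro sum.cong) (auto simp: suborthonormal_def)
    then show ?thesis
      using that by simp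
  qed
  then have "ip n y y = (\<Sum>j<r. (c j)\<^sup>2 * ip n (p j) (p j))"
    unfolding ipy by (intro sum.cong) (auto simp: power2_eq_square)
  also have "\<dots> \<le> (\<Sum>j<r. (c j)\<^sup>2)"
    using assms by (intro sum_mono mult_left_le) (auto simp: suborthonormal_def)
  finally have yy: "ip n y y \<le> (\<Sum>j<r. (c j)\<^sup>2)" .
  have "0 \<le> ip n (\<lambda>a. x a - y a) (\<lambda>a. x a - y a)"
    unfolding ip_def by (intro sum_nonneg) auto
  also have "\<dots> = ip n x x - 2 * ip n x y + ip n y y"
    unfolding ip_def sum_distrib_left sum_subtractf[symmetric] sum.distrib[symmetric]
    by (intro sum.cong) (auto simp: algebra_simps)
  finally show ?thesis
    using xy yy by (simp add: c_def)
qed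

text \<open>The sum in \<open>schatten_norm\<close> depends only on the multiset of roots, so the
  sorting in \<open>singular_values\<close> does not matter, and \<open>n \<le> m\<close> makes
  \<open>take\<close> keep all of them.\<close>

lemma schatten_norm_eigenvalues:
  assumes A: "A \<in> carrier_mat m n" and "n \<le> m"
    and es: "eigensystem n (\<lambda>a b. \<Sum>c<m. A $$ (c, a) * A $$ (c, b)) v e"
  shows "schatten_norm q A = (\<Sum>i<n. sqrt (e i) powr q) powr (1 / q)"
proof -
  have "transpose_mat A * A = Matrix.mat n n (\<lambda>(a, b). \<Sum>c<m. A $$ (c, a) * A $$ (c, b))"
    using A by (intro eq_matI) (auto simp: scalar_prod_def lessThan_atLeast0)
  then have "char_poly (transpose_mat A * A) = (\<Prod>i\<leftarrow>[0..<n]. [:- e i, 1:])"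
    using char_poly_of_eigenbasis[OF es] by simp
  moreover have "proots (\<Prod>i\<leftarrow>xs. [:- e i, 1:]) = mset (map e xs)" for xs
    by (induction xs) (simp_all add: proots_mult prod_list_zero_iff image_iff del: mult_pCons_left)
  ultimately have "proots (char_poly (transpose_mat A * A)) = mset (map e [0..<n])"
    by simp
  then have *: "mset (sorted_list_of_multiset (image_mset sqrt (proots (char_poly (transpose_mat A * A)))))
      = mset (map (\<lambda>i. sqrt (e i)) [0..<n])"
    by (simp add: image_mset.compositionality o_def)
  from mset_eq_length[OF this]
  have "length (sorted_list_of_multiset (image_mset sqrt (proots (char_poly (transpose_mat A * A))))) = n"
    by simp
  then have "mset (singular_values A) = mset (map (\<lambda>i. sqrt (e i)) [0..<n])"
    using A \<open>n \<le> m\<close> * unfolding singular_values_def by simp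
  then have "image_mset (\<lambda>s. s powr q) (mset (singular_values A)) =
      image_mset (\<lambda>s. s powr q) (mset (map (\<lambda>i. sqrt (e i)) [0..<n]))"
    by (rule arg_cong)
  then have "mset (map (\<lambda>s. s powr q) (singular_values A)) = mset (map (\<lambda>i. sqrt (e i) powr q) [0..<n])"
    by (simp add: image_mset.compositionality o_def)
  from arg_cong[OF this, of sum_mset]
  have "(\<Sum>s\<leftarrow>singular_values A. s powr q) = (\<Sum>i\<leftarrow>[0..<n]. sqrt (e i) powr q)"
    by (simp only: sum_mset_sum_list)
  then show ?thesis
    unfolding schatten_norm_def by (simp add: interv_sum_list_conv_sum_set_nat lessThan_atLeast0)
qed

text \<open>
  A singular value decomposition in which the left singular vectors of the singular value \<open>0\<close>
  are set to \<open>0\<close>.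
\<close>

definition svd_system ::
    "nat \<Rightarrow> nat \<Rightarrow> (nat \<Rightarrow> nat \<Rightarrow> real) \<Rightarrow> (nat \<Rightarrow> nat \<Rightarrow> real) \<Rightarrow> (nat \<Rightarrow> real) \<Rightarrow> (nat \<Rightarrow> nat \<Rightarrow> real) \<Rightarrow> bool" where
  "svd_system m n E u s v \<longleftrightarrow>
     suborthonormal n m u \<and> suborthonormal n n v \<and>
     eigensystem n (\<lambda>a b. \<Sum>c<m. E c a * E c b) v (\<lambda>i. (s i)\<^sup>2) \<and>
     (\<forall>i<n. s i \<ge> 0) \<and> (\<forall>i<n. s i \<noteq> 0 \<longrightarrow> ip m (u i) (u i) = 1) \<and>
     (\<forall>i<n. \<forall>c<m. (\<Sum>b<n. E c b * v i b) = s i * u i c)"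

text \<open>The images \<open>w i\<close> under \<open>E\<close> of an eigenbasis of the Gram matrix
  are orthogonal, with the eigenvalues as squared lengths; normalizing them gives the left singular
  vectors.\<close>

lemma svd_exists: "\<exists>u s v. svd_system m n E u s v"
proof -
  define G where "G a b = (\<Sum>c<m. E c a * E c b)" for a b
  have "G a b = G b a" for a b
    by (simp add: G_def mult.commute)
  then obtain v e where es: "eigensystem n G v e"
    using spectral_theorem[of n G] by blast
  note on = eigensystemD(1)[OF es] and eig = eigensystemD(3)[OF es]
  define w where "w i c = (\<Sum>b<n. E c b * v i b)" for i c
  have ww: "ip m (w i) (w j) = (if i = j then e i else 0)" if "i < n" "j < n" for i j
  proof -
    have "ip m (w i) (w j) = (\<Sum>c<m. \<Sum>a<n. \<Sum>b<n. (E c a * v i a) * (E c b * v j b))"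
      unfolding ip_def w_def sum_product ..
    also have "\<dots> = (\<Sum>a<n. \<Sum>c<m. \<Sum>b<n. (E c a * v i a) * (E c b * v j b))"
      by (rule sum.swap)
    also have "\<dots> = (\<Sum>a<n. \<Sum>b<n. \<Sum>c<m. (E c a * v i a) * (E c b * v j b))"
      by (intro sum.cong refl sum.swap)
    also have "\<dots> = (\<Sum>a<n. v i a * (\<Sum>b<n. G a b * v j b))"
      unfolding G_def sum_distrib_left sum_distrib_right by (simp add: mult_ac)
    also have "\<dots> = (\<Sum>a<n. v i a * (e j * v j a))"
      by (intro sum.cong refl arg_cong2[of _ _ _ _ "(*)"] eig) (use that in auto)
    also have "\<dots> = e j * ip n (v i) (v j)"
      unfolding ip_def sum_distrib_left by (simp add: mult_ac)
    finally show ?thesis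
      using on[OF that] by simp
  qed
  have e: "e i \<ge> 0" if "i < n" for i
  proof -
    have "ip m (w i) (w i) \<ge> 0"
      unfolding ip_def by (intro sum_nonneg) auto
    then show ?thesis
      using ww[OF that that] by simp
  qed
  define s where "s i = sqrt (e i)" for i
  \<comment> \<open>Division by 0 gives 0, which produces the zero vectors at vanishing singular
    values.\<close>
  define u where "u i c = w i c / s i" for i c
  have uu: "ip m (u i) (u j) = ip m (w i) (w j) / (s i * s j)" for i j
    unfolding ip_def u_def by (simp add: sum_divide_distrib)
  have uu1: "ip m (u i) (u i) = (if s i = 0 then 0 else 1)" if "i < n" for i
    using that e[OF that] by (simp add: uu ww s_def)
  have "svd_system m n E u s v"
    unfolding svd_system_def
  proof (intro conjI allI impI)
    show "suborthonormal n m u"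
      unfolding suborthonormal_def using uu1 by (auto simp: uu ww)
    show "suborthonormal n n v"
      unfolding suborthonormal_def using on by auto
    show "eigensystem n (\<lambda>a b. \<Sum>c<m. E c a * E c b) v (\<lambda>i. (s i)\<^sup>2)"
      using es e unfolding eigensystem_def G_def s_def by simp
    show "(\<Sum>b<n. E c b * v i b) = s i * u i c" if "i < n" "c < m" for i c
    proof (cases "s i = 0")
      case True
      then have "ip m (w i) (w i) = 0"
        using e[OF that(1)] ww[OF that(1) that(1)] by (simp add: s_def)
      then have "w i c = 0"
        unfolding ip_def using that(2) by (subst (asm) sum_nonneg_eq_0_iff) auto
      then show ?thesis
        using True by (simp add: w_def)
    next
      case False
      then show ?thesis
        by (simp add: u_def w_def)
    qed
  qed (use e uu1 in \<open>auto simp: s_def\<close>)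
  then show ?thesis
    by blast
qed

lemma svd_system_expansion:
  assumes svd: "svd_system m n E u s v" and "a < m" "b < n"
  shows "E a b = (\<Sum>i<n. s i * u i a * v i b)"
proof -
  have es: "eigensystem n (\<lambda>a b. \<Sum>c<m. E c a * E c b) v (\<lambda>i. (s i)\<^sup>2)"
    and Ev: "\<And>i c. i < n \<Longrightarrow> c < m \<Longrightarrow> (\<Sum>b<n. E c b * v i b) = s i * u i c"
    using svd unfolding svd_system_def by simp_all
  have "E a b = (\<Sum>d<n. E a d * (if d = b then 1 else 0))"
    using assms by (simp add: if_distrib[of "\<lambda>x. _ * x"] cong: if_cong)
  also have "\<dots> = (\<Sum>d<n. E a d * (\<Sum>i<n. v i d * v i b))"
    using assms by (intro sum.cong) (auto simp: eigensystemD(2)[OF es])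
  also have "\<dots> = (\<Sum>i<n. \<Sum>d<n. E a d * v i d * v i b)"
    unfolding sum_distrib_left mult.assoc by (rule sum.swap)
  also have "\<dots> = (\<Sum>i<n. s i * u i a * v i b)"
    unfolding sum_distrib_right[symmetric] using assms by (intro sum.cong) (auto simp: Ev)
  finally show ?thesis .
qed

text \<open>Expanding \<open>E\<close> by its singular value decomposition turns the pairing into a
  weighted sum of singular values. By the inequality between arithmetic and geometric mean the
  weights may be replaced by \<open>t i\<close>, the average of a left and a right sum of squared
  coefficients. Bessel's inequality bounds each \<open>t i\<close> by 1 and, with the roles of the
  two systems exchanged, their total by \<open>r\<close>, so that
  \<open>weighted_sum_le_powr\<close> applies.\<close>

lemma schatten_norm_dual:
  assumes E: "E \<in> carrier_mat m n" and "n \<le> m" and "1 \<le> q" and "r > 0"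
    and x: "suborthonormal r m x" and y: "suborthonormal r n y"
  shows "(\<Sum>j<r. \<Sum>a<m. \<Sum>b<n. x j a * E $$ (a, b) * y j b) \<le>
    real r powr (1 - 1 / q) * schatten_norm q E"
proof -
  obtain u s v where svd: "svd_system m n (\<lambda>a b. E $$ (a, b)) u s v"
    using svd_exists by blast
  then have u: "suborthonormal n m u" and v: "suborthonormal n n v"
    and es: "eigensystem n (\<lambda>a b. \<Sum>c<m. E $$ (c, a) * E $$ (c, b)) v (\<lambda>i. (s i)\<^sup>2)"
    and s: "\<And>i. i < n \<Longrightarrow> s i \<ge> 0"
    unfolding svd_system_def by simp_all
  have norm: "schatten_norm q E = (\<Sum>i<n. s i powr q) powr (1 / q)"
    using schatten_norm_eigenvalues[OF E \<open>n \<le> m\<close> es, of q] by (simp add: s cong: sum.cong_simp)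
  define t where "t i = ((\<Sum>j<r. (ip m (x j) (u i))\<^sup>2) + (\<Sum>j<r. (ip n (y j) (v i))\<^sup>2)) / 2" for i
  note E_eq = svd_system_expansion[OF svd]
  have "(\<Sum>j<r. \<Sum>a<m. \<Sum>b<n. x j a * E $$ (a, b) * y j b) =
      (\<Sum>j<r. \<Sum>i<n. s i * (ip m (x j) (u i) * ip n (y j) (v i)))"
  proof (rule sum.cong[OF refl])
    fix j
    have "(\<Sum>a<m. \<Sum>b<n. x j a * E $$ (a, b) * y j b) =
        (\<Sum>a<m. \<Sum>b<n. \<Sum>i<n. s i * ((x j a * u i a) * (y j b * v i b)))"
    proof (intro sum.cong refl)
      fix a b assume "a \<in> {..<m}" "b \<in> {..<n}"
      then have "x j a * E $$ (a, b) * y j b = x j a * (\<Sum>i<n. s i * u i a * v i b) * y j b"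
        by (simp add: E_eq)
      also have "\<dots> = (\<Sum>i<n. s i * ((x j a * u i a) * (y j b * v i b)))"
        unfolding sum_distrib_left sum_distrib_right by (intro sum.cong refl) (simp add: mult_ac)
      finally show "x j a * E $$ (a, b) * y j b = (\<Sum>i<n. s i * ((x j a * u i a) * (y j b * v i b)))" .
    qed
    also have "\<dots> = (\<Sum>a<m. \<Sum>i<n. \<Sum>b<n. s i * ((x j a * u i a) * (y j b * v i b)))"
      by (intro sum.cong refl sum.swap)
    also have "\<dots> = (\<Sum>i<n. \<Sum>a<m. \<Sum>b<n. s i * ((x j a * u i a) * (y j b * v i b)))"
      by (rule sum.swap)
    also have "\<dots> = (\<Sum>i<n. s i * (ip m (x j) (u i) * ip n (y j) (v i)))"
      by (intro sum.cong refl, unfold ip_def sum_product, simp only: sum_distrib_left)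
    finally show "(\<Sum>a<m. \<Sum>b<n. x j a * E $$ (a, b) * y j b) =
        (\<Sum>i<n. s i * (ip m (x j) (u i) * ip n (y j) (v i)))" .
  qed
  also have "\<dots> \<le> (\<Sum>j<r. \<Sum>i<n. s i * (((ip m (x j) (u i))\<^sup>2 + (ip n (y j) (v i))\<^sup>2) / 2))"
  proof (intro sum_mono mult_left_mono)
    show "ip m (x j) (u i) * ip n (y j) (v i) \<le> ((ip m (x j) (u i))\<^sup>2 + (ip n (y j) (v i))\<^sup>2) / 2" for i j
      using sum_squares_bound[of "ip m (x j) (u i)" "ip n (y j) (v i)"] by simp
  qed (use s in auto)
  also have "\<dots> = (\<Sum>i<n. \<Sum>j<r. s i * (((ip m (x j) (u i))\<^sup>2 + (ip n (y j) (v i))\<^sup>2) / 2))"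
    by (rule sum.swap)
  also have "\<dots> = (\<Sum>i<n. s i * t i)"
    unfolding t_def sum.distrib[symmetric] sum_divide_distrib sum_distrib_left ..
  also have "\<dots> \<le> real r powr (1 - 1 / q) * (\<Sum>i<n. s i powr q) powr (1 / q)"
  proof (rule weighted_sum_le_powr)
    show "0 \<le> t i" for i
      unfolding t_def by (intro divide_nonneg_pos add_nonneg_nonneg sum_nonneg) auto
    show "t i \<le> 1" if "i < n" for i
    proof -
      have "(\<Sum>j<r. (ip m (x j) (u i))\<^sup>2) \<le> 1" "(\<Sum>j<r. (ip n (y j) (v i))\<^sup>2) \<le> 1"
        using Bessel_inequality[OF x, of "u i"] Bessel_inequality[OF y, of "v i"] u v that
        by (auto simp: suborthonormal_def intro: order_trans)
      then show ?thesis
        by (simp add: t_def)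
    qed
    have dual: "(\<Sum>j<r. \<Sum>i<n. (ip N (z j) (w i))\<^sup>2) \<le> (\<Sum>j<r. 1)"
      if "suborthonormal r N z" "suborthonormal n N w" for N z w
    proof (rule sum_mono)
      fix j assume j: "j \<in> {..<r}"
      have "(\<Sum>i<n. (ip N (z j) (w i))\<^sup>2) = (\<Sum>i<n. (ip N (w i) (z j))\<^sup>2)"
        by (simp only: ip_commute)
      also have "\<dots> \<le> ip N (z j) (z j)"
        by (rule Bessel_inequality[OF that(2)])
      also have "\<dots> \<le> 1"
        using that(1) j by (simp add: suborthonormal_def)
      finally show "(\<Sum>i<n. (ip N (z j) (w i))\<^sup>2) \<le> 1" .
    qed
    have "(\<Sum>i<n. t i) = ((\<Sum>i<n. \<Sum>j<r. (ip m (x j) (u i))\<^sup>2) + (\<Sum>i<n. \<Sum>j<r. (ip n (y j) (v i))\<^sup>2)) / 2"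
      unfolding t_def sum.distrib[symmetric] sum_divide_distrib ..
    then show "(\<Sum>i<n. t i) \<le> real r"
      using dual[OF x u] dual[OF y v] sum.swap[of "\<lambda>i j. (ip m (x j) (u i))\<^sup>2" "{..<r}" "{..<n}"]
        sum.swap[of "\<lambda>i j. (ip n (y j) (v i))\<^sup>2" "{..<r}" "{..<n}"] by simp
  qed (use assms s in auto)
  finally show ?thesis
    by (simp add: norm)
qed

section \<open>Membership in the class\<close>

lemma orthonormal_colsD:
  assumes "orthonormal_cols U" "U \<in> carrier_mat m r"
  shows "transpose_mat U * U = 1\<^sub>m r"
  using assms by (simp add: orthonormal_cols_def)

lemma rank_of_orthonormal_cols:
  fixes U :: "real mat"
  assumes U: "U \<in> carrier_mat m r" and orth: "orthonormal_cols U"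
  shows "vec_space.rank m U = r"
proof -
  interpret vec_space "TYPE(real)" m .
  note UU = orthonormal_colsD[OF orth U]
  have dist: "distinct (cols U)"
    unfolding distinct_conv_nth
  proof (intro allI impI notI)
    fix i j assume ij: "i < length (cols U)" "j < length (cols U)" "i \<noteq> j" and eq: "cols U ! i = cols U ! j"
    then have "i < r" "j < r"
      using U by auto
    then have "(transpose_mat U * U) $$ (i, j) = (transpose_mat U * U) $$ (i, i)"
      using U ij eq by simp
    then show False
      using \<open>i < r\<close> \<open>j < r\<close> \<open>i \<noteq> j\<close> unfolding UU by simp
  qed
  have "lin_indpt (set (cols U))"
  proof
    assume "lin_dep (set (cols U))"
    then obtain v where v: "v \<in> carrier_vec r" "v \<noteq> 0\<^sub>v r" "U *\<^sub>v v = 0\<^sub>v m"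
      using lin_depE[OF U _ dist] by blast
    have "v = (transpose_mat U * U) *\<^sub>v v"
      unfolding UU using v(1) by simp
    also have "\<dots> = transpose_mat U *\<^sub>v (U *\<^sub>v v)"
      using U v(1) by (intro assoc_mult_mat_vec) auto
    also have "\<dots> = 0\<^sub>v r"
      unfolding v(3) using U by auto
    finally show False
      using v(2) by simp
  qed
  then show ?thesis
    using lin_indpt_full_rank[OF U dist] by simp
qed

text \<open>\<open>M\<close> and \<open>U\<close> have the same column space: \<open>M\<close> is
  \<open>U\<close> times a matrix, and multiplying \<open>M\<close> by \<open>V * D'\<close>
  recovers \<open>U\<close>.\<close>

lemma rank_of_svd:
  fixes U V :: "real mat"
  assumes U: "U \<in> carrier_mat m r" and oU: "orthonormal_cols U"
    and V: "V \<in> carrier_mat n r" and oV: "orthonormal_cols V"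
    and \<delta>: "\<And>i. i < r \<Longrightarrow> \<delta> i \<noteq> 0"
  shows "vec_space.rank m (U * mat_diag r \<delta> * transpose_mat V) = r"
proof -
  interpret vec_space "TYPE(real)" m .
  define D where "D = mat_diag r \<delta>"
  define D' where "D' = mat_diag r (\<lambda>i. 1 / \<delta> i)"
  define M where "M = U * D * transpose_mat V"
  have D: "D \<in> carrier_mat r r" and D': "D' \<in> carrier_mat r r"
    by (auto simp: D_def D'_def)
  have M: "M \<in> carrier_mat m n"
    using U V D by (simp add: M_def)
  have DD': "D * D' = 1\<^sub>m r"
    unfolding D_def D'_def mat_diag_mult_left[OF mat_diag_dim]
    by (intro eq_matI) (auto simp: mat_diag_def \<delta>)
  have "M * (V * D') = (U * D * transpose_mat V * V) * D'"
    unfolding M_def using U V D D' by (intro assoc_mult_mat[symmetric]) auto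
  also have "U * D * transpose_mat V * V = U * D * (transpose_mat V * V)"
    using U V D by (intro assoc_mult_mat) auto
  also have "\<dots> = U * D"
    unfolding orthonormal_colsD[OF oV V] using U D by simp
  also have "U * D * D' = U * (D * D')"
    using U D D' by (intro assoc_mult_mat) auto
  also have "\<dots> = U"
    unfolding DD' using U by simp
  finally have MU: "M * (V * D') = U" .
  have "col_space M = col_space U"
  proof (intro equalityI subsetI)
    fix y assume "y \<in> col_space M"
    then obtain x where x: "x \<in> carrier_vec n" "M *\<^sub>v x = y"
      unfolding col_space_eq[OF M] using M by auto
    have "M = U * (D * transpose_mat V)"
      unfolding M_def using U V D by (intro assoc_mult_mat) auto
    moreover have "U * (D * transpose_mat V) *\<^sub>v x = U *\<^sub>v ((D * transpose_mat V) *\<^sub>v x)"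
      using x U V D by (intro assoc_mult_mat_vec) auto
    ultimately have "y = U *\<^sub>v ((D * transpose_mat V) *\<^sub>v x)"
      using x by simp
    then show "y \<in> col_space U"
      unfolding col_space_eq[OF U] using U V D x by (auto intro!: bexI[of _ "(D * transpose_mat V) *\<^sub>v x"])
  next
    fix y assume "y \<in> col_space U"
    then obtain x where x: "x \<in> carrier_vec r" "U *\<^sub>v x = y"
      unfolding col_space_eq[OF U] using U by auto
    have "y = (M * (V * D')) *\<^sub>v x"
      using x MU by simp
    also have "\<dots> = M *\<^sub>v ((V * D') *\<^sub>v x)"
      using M V D' x by (intro assoc_mult_mat_vec) auto
    finally have y: "y = M *\<^sub>v ((V * D') *\<^sub>v x)" .
    then show "y \<in> col_space M"
      unfolding col_space_eq[OF M] using M V D' x by (auto intro!: bexI[of _ "(V * D') *\<^sub>v x"])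
  qed
  then have "rank M = rank U"
    unfolding rank_def col_space_def by simp
  then show ?thesis
    using rank_of_orthonormal_cols[OF U oU] by (simp add: M_def D_def)
qed

lemma sparse_svd_classI:
  assumes U: "U \<in> carrier_mat m r" "orthonormal_cols U" and V: "V \<in> carrier_mat n r" "orthonormal_cols V"
    and "card (supp_rows U) \<le> k" "card (supp_rows V) \<le> l"
    and "\<And>i j. i \<le> j \<Longrightarrow> j < r \<Longrightarrow> \<delta> j \<le> \<delta> i"
    and \<delta>: "\<And>i. i < r \<Longrightarrow> d \<le> \<delta> i \<and> \<delta> i \<le> \<kappa> * d" and "d > 0"
  shows "U * mat_diag r \<delta> * transpose_mat V \<in> sparse_svd_class m n k l r d \<kappa>"
proof -
  have "vec_space.rank m (U * mat_diag r \<delta> * transpose_mat V) = r"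
    using \<delta> \<open>d > 0\<close> by (intro rank_of_svd[OF U V]) force
  then show ?thesis
    unfolding sparse_svd_class_def mem_Collect_eq using assms
    by (intro conjI exI[of _ U] exI[of _ V] exI[of _ \<delta>]) auto
qed

lemma sparse_svd_class_transpose:
  assumes M: "M \<in> sparse_svd_class m n k l r d \<kappa>" and "d > 0"
  shows "transpose_mat M \<in> sparse_svd_class n m l k r d \<kappa>"
proof -
  obtain U V \<delta> where U: "U \<in> carrier_mat m r" "orthonormal_cols U"
    and V: "V \<in> carrier_mat n r" "orthonormal_cols V"
    and M_eq: "M = U * mat_diag r \<delta> * transpose_mat V"
    and *: "card (supp_rows U) \<le> k" "card (supp_rows V) \<le> l"
      "\<And>i j. i \<le> j \<Longrightarrow> j < r \<Longrightarrow> \<delta> j \<le> \<delta> i" "\<And>i. i < r \<Longrightarrow> d \<le> \<delta> i \<and> \<delta> i \<le> \<kappa> * d"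
    using M unfolding sparse_svd_class_def by blast
  have D: "transpose_mat (mat_diag r \<delta>) = mat_diag r \<delta>"
    by (intro eq_matI) (auto simp: mat_diag_def)
  have "transpose_mat M = transpose_mat (transpose_mat V) * transpose_mat (U * mat_diag r \<delta>)"
    unfolding M_eq using U V by (intro transpose_mult[of _ m r _ n]) auto
  also have "transpose_mat (U * mat_diag r \<delta>) = mat_diag r \<delta> * transpose_mat U"
    using U D by (subst transpose_mult[of _ m r _ r]) auto
  also have "transpose_mat (transpose_mat V) * (mat_diag r \<delta> * transpose_mat U) =
      V * mat_diag r \<delta> * transpose_mat U"
    using U V by (simp add: assoc_mult_mat[of V n r "mat_diag r \<delta>" r "transpose_mat U" m])
  finally have "transpose_mat M = V * mat_diag r \<delta> * transpose_mat U" .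
  then show ?thesis
    using sparse_svd_classI[OF V U *(2) *(1) *(3) *(4) \<open>d > 0\<close>] by simp
qed

text \<open>\<open>svd_exists\<close> delivers the singular values in no particular order, whereas
  the class asks for a nonincreasing diagonal.\<close>

lemma decreasing_rearrangement:
  fixes s :: "nat \<Rightarrow> real"
  obtains \<pi> where "bij_betw \<pi> {..<r} {..<r}" "\<And>i j. i \<le> j \<Longrightarrow> j < r \<Longrightarrow> s (\<pi> j) \<le> s (\<pi> i)"
proof -
  define xs where "xs = map s [0..<r]"
  have "mset (rev (sort xs)) = mset xs"
    by simp
  then obtain p where p: "p permutes {..<length xs}" "permute_list p xs = rev (sort xs)"
    by (rule mset_eq_permutation)
  have nth: "rev (sort xs) ! i = s (p i)" if "i < r" for i
    using that p permutes_in_image[OF p(1), of i]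
    by (subst p(2)[symmetric], subst permute_list_nth[OF p(1)]) (auto simp: xs_def)
  show ?thesis
  proof (rule that)
    show "bij_betw p {..<r} {..<r}"
      using permutes_imp_bij[OF p(1)] by (simp add: xs_def)
    show "s (p j) \<le> s (p i)" if "i \<le> j" "j < r" for i j
    proof -
      have "rev (sort xs) ! j \<le> rev (sort xs) ! i"
        using sorted_rev_nth_mono[of "rev (sort xs)" i j] that by (simp add: xs_def)
      then show ?thesis
        using that nth by simp
    qed
  qed
qed

text \<open>Testing the two bounds on the right singular vectors confines the singular values of
  \<open>L\<close> to \<open>[d, \<kappa> * d]\<close>. They are therefore positive, so the left
  vectors are orthonormal, and a zero row of \<open>L\<close> forces a zero row of \<open>U\<close>.
  The right vectors are padded with zeros and live on the first \<open>r\<close> columns.\<close>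

lemma tall_matrix_in_class:
  fixes L :: "nat \<Rightarrow> nat \<Rightarrow> real"
  assumes lower: "\<And>x. d\<^sup>2 * ip r x x \<le> ip m (\<lambda>a. \<Sum>j<r. L a j * x j) (\<lambda>a. \<Sum>j<r. L a j * x j)"
    and upper: "\<And>x. ip m (\<lambda>a. \<Sum>j<r. L a j * x j) (\<lambda>a. \<Sum>j<r. L a j * x j) \<le> (\<kappa> * d)\<^sup>2 * ip r x x"
    and "d > 0" "\<kappa> > 0" "r \<le> n" "r \<le> l" and k: "card {a. a < m \<and> (\<exists>j<r. L a j \<noteq> 0)} \<le> k"
  shows "Matrix.mat m n (\<lambda>(a, b). if b < r then L a b else 0) \<in> sparse_svd_class m n k l r d \<kappa>"
proof -
  obtain u s v where svd: "svd_system m r L u s v"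
    using svd_exists by blast
  then have u: "suborthonormal r m u"
    and es: "eigensystem r (\<lambda>a b. \<Sum>c<m. L c a * L c b) v (\<lambda>i. (s i)\<^sup>2)"
    and s0: "\<And>i. i < r \<Longrightarrow> s i \<ge> 0"
    and u1: "\<And>i. i < r \<Longrightarrow> s i \<noteq> 0 \<Longrightarrow> ip m (u i) (u i) = 1"
    and Lv: "\<And>i c. i < r \<Longrightarrow> c < m \<Longrightarrow> (\<Sum>b<r. L c b * v i b) = s i * u i c"
    unfolding svd_system_def by simp_all
  note on = eigensystemD(1)[OF es]
  have s: "d \<le> s i \<and> s i \<le> \<kappa> * d" if i: "i < r" for i
  proof -
    have "ip m (\<lambda>a. \<Sum>j<r. L a j * v i j) (\<lambda>a. \<Sum>j<r. L a j * v i j) = (s i)\<^sup>2 * ip m (u i) (u i)"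
    proof -
      have "ip m (\<lambda>a. \<Sum>j<r. L a j * v i j) (\<lambda>a. \<Sum>j<r. L a j * v i j) =
          ip m (\<lambda>a. s i * u i a) (\<lambda>a. s i * u i a)"
        unfolding ip_def using i by (intro sum.cong) (auto simp: Lv)
      then show ?thesis
        by (simp add: ip_def sum_distrib_left power2_eq_square mult_ac)
    qed
    then have *: "d\<^sup>2 \<le> (s i)\<^sup>2 * ip m (u i) (u i)" "(s i)\<^sup>2 * ip m (u i) (u i) \<le> (\<kappa> * d)\<^sup>2"
      using lower[of "v i"] upper[of "v i"] on[OF i i] by auto
    then have "s i \<noteq> 0"
      using \<open>d > 0\<close> by auto
    then have "d\<^sup>2 \<le> (s i)\<^sup>2" "(s i)\<^sup>2 \<le> (\<kappa> * d)\<^sup>2"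
      using * u1[OF i] by auto
    then show ?thesis
      using s0[OF i] \<open>d > 0\<close> \<open>\<kappa> > 0\<close> by (auto intro: power2_le_imp_le)
  qed
  have uu: "ip m (u i) (u j) = (if i = j then 1 else 0)" if "i < r" "j < r" for i j
    using that u u1[of i] s[of i] \<open>d > 0\<close> by (auto simp: suborthonormal_def)
  obtain \<pi> where \<pi>: "bij_betw \<pi> {..<r} {..<r}" and dec: "\<And>i j. i \<le> j \<Longrightarrow> j < r \<Longrightarrow> s (\<pi> j) \<le> s (\<pi> i)"
    using decreasing_rearrangement[of r s] by blast
  have \<pi>r: "\<pi> i < r" if "i < r" for i
    using bij_betwE[OF \<pi>] that by auto
  have inj: "\<pi> i = \<pi> j \<longleftrightarrow> i = j" if "i < r" "j < r" for i j
    using bij_betw_imp_inj_on[OF \<pi>] that by (auto dest: inj_onD)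
  define U where "U = Matrix.mat m r (\<lambda>(a, i). u (\<pi> i) a)"
  define V where "V = Matrix.mat n r (\<lambda>(b, i). if b < r then v (\<pi> i) b else 0)"
  have U: "U \<in> carrier_mat m r" and V: "V \<in> carrier_mat n r"
    by (auto simp: U_def V_def)
  have oU: "orthonormal_cols U"
    unfolding orthonormal_cols_def
  proof (rule eq_matI)
    fix i j assume "i < dim_row (1\<^sub>m (dim_col U) :: real mat)" "j < dim_col (1\<^sub>m (dim_col U) :: real mat)"
    then have ij: "i < r" "j < r"
      by (auto simp: U_def)
    have "(transpose_mat U * U) $$ (i, j) = ip m (u (\<pi> i)) (u (\<pi> j))"
      using ij by (auto simp: U_def scalar_prod_def ip_def lessThan_atLeast0)
    also have "\<dots> = (if i = j then 1 else 0)"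
      using uu \<pi>r inj ij by simp
    finally show "(transpose_mat U * U) $$ (i, j) = 1\<^sub>m (dim_col U) $$ (i, j)"
      using ij by (simp add: U_def)
  qed (auto simp: U_def)
  have oV: "orthonormal_cols V"
    unfolding orthonormal_cols_def
  proof (rule eq_matI)
    fix i j assume "i < dim_row (1\<^sub>m (dim_col V) :: real mat)" "j < dim_col (1\<^sub>m (dim_col V) :: real mat)"
    then have ij: "i < r" "j < r"
      by (auto simp: V_def)
    have "(transpose_mat V * V) $$ (i, j) = (\<Sum>b<n. if b < r then v (\<pi> i) b * v (\<pi> j) b else 0)"
      using ij by (auto simp: V_def scalar_prod_def lessThan_atLeast0 intro!: sum.cong)
    also have "\<dots> = ip r (v (\<pi> i)) (v (\<pi> j))"
      unfolding ip_def using \<open>r \<le> n\<close> by (intro sum.mono_neutral_cong_right) auto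
    also have "\<dots> = (if i = j then 1 else 0)"
      using on \<pi>r inj ij by simp
    finally show "(transpose_mat V * V) $$ (i, j) = 1\<^sub>m (dim_col V) $$ (i, j)"
      using ij by (simp add: V_def)
  qed (auto simp: V_def)
  have "supp_rows U \<subseteq> {a. a < m \<and> (\<exists>j<r. L a j \<noteq> 0)}"
  proof
    fix a assume "a \<in> supp_rows U"
    then have a: "a < m" and "Matrix.row U a \<noteq> 0\<^sub>v r"
      by (auto simp: supp_rows_def U_def)
    then obtain i where i: "i < r" "u (\<pi> i) a \<noteq> 0"
      by (auto simp: U_def vec_eq_iff)
    have "\<exists>j<r. L a j \<noteq> 0"
    proof (rule ccontr)
      assume "\<not> (\<exists>j<r. L a j \<noteq> 0)"
      then have "s (\<pi> i) * u (\<pi> i) a = 0"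
        by (subst Lv[symmetric]) (use \<pi>r i a in auto)
      then show False
        using i s[OF \<pi>r[OF i(1)]] \<open>d > 0\<close> by auto
    qed
    then show "a \<in> {a. a < m \<and> (\<exists>j<r. L a j \<noteq> 0)}"
      using a by blast
  qed
  then have suppU: "card (supp_rows U) \<le> k"
    by (intro order_trans[OF card_mono k]) auto
  have "supp_rows V \<subseteq> {..<r}"
  proof
    fix b assume b: "b \<in> supp_rows V"
    show "b \<in> {..<r}"
    proof (rule ccontr)
      assume "b \<notin> {..<r}"
      then have "Matrix.row V b = 0\<^sub>v (dim_col V)"
        using b by (intro eq_vecI) (auto simp: supp_rows_def V_def)
      then show False
        using b by (simp add: supp_rows_def)
    qed
  qed
  then have suppV: "card (supp_rows V) \<le> l"
    using \<open>r \<le> l\<close> by (metis card_lessThan card_mono finite_lessThan order_trans)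
  have "Matrix.mat m n (\<lambda>(a, b). if b < r then L a b else 0) =
      U * mat_diag r (\<lambda>i. s (\<pi> i)) * transpose_mat V"
  proof (rule eq_matI)
    fix a b assume "a < dim_row (U * mat_diag r (\<lambda>i. s (\<pi> i)) * transpose_mat V)"
      "b < dim_col (U * mat_diag r (\<lambda>i. s (\<pi> i)) * transpose_mat V)"
    then have ab: "a < m" "b < n"
      by (auto simp: U_def V_def)
    have "(U * mat_diag r (\<lambda>i. s (\<pi> i)) * transpose_mat V) $$ (a, b) =
        (\<Sum>i<r. s (\<pi> i) * u (\<pi> i) a * (if b < r then v (\<pi> i) b else 0))"
      using ab by (subst mat_diag_mult_right[OF U])
        (auto simp: U_def V_def scalar_prod_def lessThan_atLeast0 intro!: sum.cong)
    also have "\<dots> = (\<Sum>i<r. s i * u i a * (if b < r then v i b else 0))"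
      by (rule sum.reindex_bij_betw[OF \<pi>, of "\<lambda>i. s i * u i a * (if b < r then v i b else 0)"])
    also have "\<dots> = (if b < r then L a b else 0)"
      using svd_system_expansion[OF svd \<open>a < m\<close>, of b] by simp
    finally show "Matrix.mat m n (\<lambda>(a, b). if b < r then L a b else 0) $$ (a, b) =
        (U * mat_diag r (\<lambda>i. s (\<pi> i)) * transpose_mat V) $$ (a, b)"
      using ab by simp
  qed (auto simp: U_def V_def)
  then show ?thesis
    using sparse_svd_classI[OF U oU V oV suppU suppV, of "\<lambda>i. s (\<pi> i)"] dec s \<pi>r \<open>d > 0\<close> by simp
qed

section \<open>Testing many Gaussian hypotheses\<close>

lemma normal_density_shift:
  assumes "\<sigma> > 0"
  shows "normal_density 0 \<sigma> x * exp (\<theta> * x / \<sigma>\<^sup>2 - \<theta>\<^sup>2 / (2 * \<sigma>\<^sup>2)) = normal_density \<theta> \<sigma> x"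
  using assms unfolding normal_density_def
  by (simp add: exp_add[symmetric] field_simps power2_eq_square)

text \<open>Completing the square. The constant factor in front of the density with mean
  \<open>2 * \<theta>\<close> is the second moment of the likelihood ratio.\<close>

lemma normal_density_shift_square:
  assumes "\<sigma> > 0"
  shows "normal_density 0 \<sigma> x * (exp (\<theta> * x / \<sigma>\<^sup>2 - \<theta>\<^sup>2 / (2 * \<sigma>\<^sup>2)))\<^sup>2 =
    exp (\<theta>\<^sup>2 / \<sigma>\<^sup>2) * normal_density (2 * \<theta>) \<sigma> x"
proof -
  have "- x\<^sup>2 / (2 * \<sigma>\<^sup>2) + 2 * (\<theta> * x / \<sigma>\<^sup>2 - \<theta>\<^sup>2 / (2 * \<sigma>\<^sup>2)) =
      \<theta>\<^sup>2 / \<sigma>\<^sup>2 + - (x - 2 * \<theta>)\<^sup>2 / (2 * \<sigma>\<^sup>2)"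
    using assms by (simp add: field_simps power2_eq_square)
  then have "exp (- x\<^sup>2 / (2 * \<sigma>\<^sup>2)) * exp (2 * (\<theta> * x / \<sigma>\<^sup>2 - \<theta>\<^sup>2 / (2 * \<sigma>\<^sup>2))) =
      exp (\<theta>\<^sup>2 / \<sigma>\<^sup>2) * exp (- (x - 2 * \<theta>)\<^sup>2 / (2 * \<sigma>\<^sup>2))"
    unfolding exp_add[symmetric] by simp
  then show ?thesis
    unfolding normal_density_def exp_double[symmetric] by simp
qed

definition gaussian_vec :: "'i set \<Rightarrow> real \<Rightarrow> ('i \<Rightarrow> real) measure" where
  "gaussian_vec I \<sigma> = (\<Pi>\<^sub>M i\<in>I. density lborel (normal_density 0 \<sigma>))"

text \<open>The density of the centred law translated by \<open>\<theta>\<close> with respect to the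
  centred law.\<close>

definition likelihood :: "'i set \<Rightarrow> real \<Rightarrow> ('i \<Rightarrow> real) \<Rightarrow> ('i \<Rightarrow> real) \<Rightarrow> real" where
  "likelihood I \<sigma> \<theta> z = (\<Prod>i\<in>I. exp (\<theta> i * z i / \<sigma>\<^sup>2 - (\<theta> i)\<^sup>2 / (2 * \<sigma>\<^sup>2)))"

lemma sets_gaussian_vec [measurable_cong]: "sets (gaussian_vec I \<sigma>) = sets (\<Pi>\<^sub>M i\<in>I. borel)"
  unfolding gaussian_vec_def by (intro sets_PiM_cong) auto

lemma prob_space_gaussian_vec:
  assumes "\<sigma> > 0"
  shows "prob_space (gaussian_vec I \<sigma>)"
  unfolding gaussian_vec_def by (intro prob_space_PiM prob_space_normal_density assms)

lemma likelihood_nonneg: "likelihood I \<sigma> \<theta> z \<ge> 0"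
  by (auto simp: likelihood_def intro: prod_nonneg)

lemma likelihood_measurable [measurable]:
  "likelihood I \<sigma> \<theta> \<in> borel_measurable (\<Pi>\<^sub>M i\<in>I. borel)"
  unfolding likelihood_def by measurable

text \<open>Both measures are the product of the one-dimensional laws \<open>N i\<close>. This is
  checked on boxes, where the likelihood and the indicator factorize.\<close>

lemma distr_gaussian_vec_shift:
  assumes "\<sigma> > 0" "finite I"
  shows "distr (gaussian_vec I \<sigma>) (\<Pi>\<^sub>M i\<in>I. borel) (\<lambda>z. \<lambda>i\<in>I. \<theta> i + z i) =
    density (gaussian_vec I \<sigma>) (likelihood I \<sigma> \<theta>)"
proof -
  define N where "N i = density lborel (\<lambda>x. ennreal (normal_density (\<theta> i) \<sigma> x))" for i
  let ?N0 = "density lborel (\<lambda>x. ennreal (normal_density 0 \<sigma> x))"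
  define l where "l i x = exp (\<theta> i * x / \<sigma>\<^sup>2 - (\<theta> i)\<^sup>2 / (2 * \<sigma>\<^sup>2))" for i x
  have [measurable]: "l i \<in> borel_measurable borel" for i
    unfolding l_def by measurable
  interpret N0: prob_space ?N0
    by (rule prob_space_normal_density[OF \<open>\<sigma> > 0\<close>])
  interpret P0: product_prob_space "\<lambda>_. ?N0" I
    by unfold_locales
  have "prob_space (N i)" for i
    unfolding N_def by (rule prob_space_normal_density[OF \<open>\<sigma> > 0\<close>])
  then interpret P: product_prob_space N I
    by (intro product_prob_spaceI)
  have sets_N: "sets (PiM I N) = sets (\<Pi>\<^sub>M i\<in>I. borel)"
    by (intro sets_PiM_cong) (auto simp: N_def)
  have dens: "density ?N0 (l i) = N i" for i
    unfolding N_def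
    by (subst density_density_eq) (auto simp: normal_density_shift[OF \<open>\<sigma> > 0\<close>] l_def ennreal_mult[symmetric])
  have dist: "distr ?N0 borel (\<lambda>x. \<theta> i + x) = N i" for i
  proof -
    have "distributed ?N0 lborel (\<lambda>x. x) (normal_density 0 \<sigma>)"
      unfolding distributed_def by (auto intro!: measure_eqI simp: emeasure_distr)
    from N0.normal_density_affine[OF this \<open>\<sigma> > 0\<close>, of 1 "\<theta> i"]
    have "distributed ?N0 lborel (\<lambda>x. \<theta> i + x) (normal_density (\<theta> i) \<sigma>)"
      using \<open>\<sigma> > 0\<close> by simp
    then have "distr ?N0 lborel (\<lambda>x. \<theta> i + x) = N i"
      unfolding distributed_def N_def by simp
    then show ?thesis
      by (metis distr_cong sets_lborel)
  qed
  have "density (gaussian_vec I \<sigma>) (likelihood I \<sigma> \<theta>) = PiM I N"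
  proof (rule P.PiM_eqI[OF \<open>finite I\<close>])
    show "sets (density (gaussian_vec I \<sigma>) (likelihood I \<sigma> \<theta>)) = sets (PiM I N)"
      by (simp add: sets_gaussian_vec sets_N)
    fix A assume "\<And>i. i \<in> I \<Longrightarrow> A i \<in> sets (N i)"
    then have A: "\<And>i. i \<in> I \<Longrightarrow> A i \<in> sets borel"
      by (simp add: N_def)
    then have "Pi\<^sub>E I A \<in> sets (gaussian_vec I \<sigma>)"
      unfolding sets_gaussian_vec by (intro sets_PiM_I_finite \<open>finite I\<close>) auto
    then have "emeasure (density (gaussian_vec I \<sigma>) (likelihood I \<sigma> \<theta>)) (Pi\<^sub>E I A) =
        (\<integral>\<^sup>+z. ennreal (likelihood I \<sigma> \<theta> z) * indicator (Pi\<^sub>E I A) z \<partial>gaussian_vec I \<sigma>)"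
      by (subst emeasure_density) auto
    also have "\<dots> = (\<integral>\<^sup>+z. (\<Prod>i\<in>I. ennreal (l i (z i)) * indicator (A i) (z i)) \<partial>gaussian_vec I \<sigma>)"
    proof (rule nn_integral_cong)
      fix z assume "z \<in> space (gaussian_vec I \<sigma>)"
      then have "z \<in> extensional I"
        by (auto simp: gaussian_vec_def space_PiM PiE_def)
      then have "(indicator (Pi\<^sub>E I A) z :: ennreal) = (\<Prod>i\<in>I. indicator (A i) (z i))"
        using \<open>finite I\<close> by (auto simp: indicator_def PiE_iff prod_zero_iff)
      then show "ennreal (likelihood I \<sigma> \<theta> z) * indicator (Pi\<^sub>E I A) z =
          (\<Prod>i\<in>I. ennreal (l i (z i)) * indicator (A i) (z i))"
        by (simp add: likelihood_def l_def prod_ennreal prod.distrib)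
    qed
    also have "\<dots> = (\<Prod>i\<in>I. \<integral>\<^sup>+x. ennreal (l i x) * indicator (A i) x \<partial>?N0)"
      unfolding gaussian_vec_def
    proof (rule P0.product_nn_integral_prod[OF \<open>finite I\<close>])
      fix i assume "i \<in> I"
      then have [measurable]: "A i \<in> sets borel"
        by (rule A)
      show "(\<lambda>x. ennreal (l i x) * indicator (A i) x) \<in> borel_measurable ?N0"
        by measurable
    qed
    also have "\<dots> = (\<Prod>i\<in>I. emeasure (N i) (A i))"
      using A by (intro prod.cong refl) (subst dens[symmetric], subst emeasure_density, auto)
    finally show "emeasure (density (gaussian_vec I \<sigma>) (likelihood I \<sigma> \<theta>)) (Pi\<^sub>E I A) =
        (\<Prod>i\<in>I. emeasure (N i) (A i))" .
  qed
  moreover have "distr (gaussian_vec I \<sigma>) (\<Pi>\<^sub>M i\<in>I. borel) (\<lambda>z. \<lambda>i\<in>I. \<theta> i + z i) = PiM I N"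
  proof (rule P.PiM_eqI[OF \<open>finite I\<close>])
    show "sets (distr (gaussian_vec I \<sigma>) (\<Pi>\<^sub>M i\<in>I. borel) (\<lambda>z. \<lambda>i\<in>I. \<theta> i + z i)) = sets (PiM I N)"
      by (simp add: sets_N)
    fix A assume "\<And>i. i \<in> I \<Longrightarrow> A i \<in> sets (N i)"
    then have A[measurable]: "\<And>i. i \<in> I \<Longrightarrow> A i \<in> sets borel"
      by (simp add: N_def)
    have AA: "Pi\<^sub>E I A \<in> sets (\<Pi>\<^sub>M i\<in>I. (borel :: real measure))"
      by (intro sets_PiM_I_finite \<open>finite I\<close> A)
    have "emeasure (distr (gaussian_vec I \<sigma>) (\<Pi>\<^sub>M i\<in>I. borel) (\<lambda>z. \<lambda>i\<in>I. \<theta> i + z i)) (Pi\<^sub>E I A) =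
        emeasure (gaussian_vec I \<sigma>) ((\<lambda>z. \<lambda>i\<in>I. \<theta> i + z i) -` Pi\<^sub>E I A \<inter> space (gaussian_vec I \<sigma>))"
      by (intro emeasure_distr AA) measurable
    also have "(\<lambda>z. \<lambda>i\<in>I. \<theta> i + z i) -` Pi\<^sub>E I A \<inter> space (gaussian_vec I \<sigma>) =
        Pi\<^sub>E I (\<lambda>i. (\<lambda>x. \<theta> i + x) -` A i)"
      by (auto simp: gaussian_vec_def space_PiM PiE_iff)
    also have "emeasure (gaussian_vec I \<sigma>) \<dots> = (\<Prod>i\<in>I. emeasure ?N0 ((\<lambda>x. \<theta> i + x) -` A i))"
      unfolding gaussian_vec_def
    proof (rule P0.emeasure_PiM[OF \<open>finite I\<close>])
      fix i assume "i \<in> I"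
      then have "(\<lambda>x. \<theta> i + x) -` A i \<inter> space borel \<in> sets borel"
        by (intro measurable_sets[OF _ A]) measurable
      then show "(\<lambda>x. \<theta> i + x) -` A i \<in> sets ?N0"
        by simp
    qed
    also have "\<dots> = (\<Prod>i\<in>I. emeasure (N i) (A i))"
      by (intro prod.cong refl) (subst dist[symmetric], subst emeasure_distr, auto)
    finally show "emeasure (distr (gaussian_vec I \<sigma>) (\<Pi>\<^sub>M i\<in>I. borel) (\<lambda>z. \<lambda>i\<in>I. \<theta> i + z i)) (Pi\<^sub>E I A) =
        (\<Prod>i\<in>I. emeasure (N i) (A i))" .
  qed
  ultimately show ?thesis
    by simp
qed

lemma nn_integral_gaussian_vec_shift:
  assumes "\<sigma> > 0" "finite I" and [measurable]: "f \<in> borel_measurable (\<Pi>\<^sub>M i\<in>I. borel)"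
  shows "(\<integral>\<^sup>+z. f (\<lambda>i\<in>I. \<theta> i + z i) \<partial>gaussian_vec I \<sigma>) =
    (\<integral>\<^sup>+z. ennreal (likelihood I \<sigma> \<theta> z) * f z \<partial>gaussian_vec I \<sigma>)"
proof -
  have "(\<integral>\<^sup>+z. f (\<lambda>i\<in>I. \<theta> i + z i) \<partial>gaussian_vec I \<sigma>) =
      (\<integral>\<^sup>+z. f z \<partial>distr (gaussian_vec I \<sigma>) (\<Pi>\<^sub>M i\<in>I. borel) (\<lambda>z. \<lambda>i\<in>I. \<theta> i + z i))"
    by (subst nn_integral_distr) measurable
  also have "\<dots> = (\<integral>\<^sup>+z. ennreal (likelihood I \<sigma> \<theta> z) * f z \<partial>gaussian_vec I \<sigma>)"
    unfolding distr_gaussian_vec_shift[OF assms(1,2)] by (subst nn_integral_density) measurable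
  finally show ?thesis .
qed

lemma nn_integral_likelihood:
  assumes "\<sigma> > 0" "finite I"
  shows "(\<integral>\<^sup>+z. ennreal (likelihood I \<sigma> \<theta> z) \<partial>gaussian_vec I \<sigma>) = 1"
  using nn_integral_gaussian_vec_shift[OF assms, of "\<lambda>_. 1" \<theta>]
    prob_space.emeasure_space_1[OF prob_space_gaussian_vec[OF assms(1), of I]] by simp

lemma nn_integral_likelihood_square:
  assumes "\<sigma> > 0" "finite I"
  shows "(\<integral>\<^sup>+z. ennreal ((likelihood I \<sigma> \<theta> z)\<^sup>2) \<partial>gaussian_vec I \<sigma>) =
    ennreal (exp ((\<Sum>i\<in>I. (\<theta> i)\<^sup>2) / \<sigma>\<^sup>2))"
proof -
  let ?N0 = "density lborel (\<lambda>x. ennreal (normal_density 0 \<sigma> x))"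
  define l where "l i x = exp (\<theta> i * x / \<sigma>\<^sup>2 - (\<theta> i)\<^sup>2 / (2 * \<sigma>\<^sup>2))" for i x
  have [measurable]: "l i \<in> borel_measurable borel" for i
    unfolding l_def by measurable
  interpret N0: prob_space ?N0
    by (rule prob_space_normal_density[OF \<open>\<sigma> > 0\<close>])
  interpret P0: product_prob_space "\<lambda>_. ?N0" I
    by unfold_locales
  have "(\<integral>\<^sup>+z. ennreal ((likelihood I \<sigma> \<theta> z)\<^sup>2) \<partial>gaussian_vec I \<sigma>) =
      (\<integral>\<^sup>+z. (\<Prod>i\<in>I. ennreal ((l i (z i))\<^sup>2)) \<partial>gaussian_vec I \<sigma>)"
    by (simp add: likelihood_def l_def prod_ennreal prod_power_distrib)
  also have "\<dots> = (\<Prod>i\<in>I. \<integral>\<^sup>+x. ennreal ((l i x)\<^sup>2) \<partial>?N0)"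
    unfolding gaussian_vec_def by (intro P0.product_nn_integral_prod[OF \<open>finite I\<close>]) measurable
  also have "\<dots> = (\<Prod>i\<in>I. ennreal (exp ((\<theta> i)\<^sup>2 / \<sigma>\<^sup>2)))"
  proof (intro prod.cong refl)
    fix i
    interpret N: prob_space "density lborel (\<lambda>x. ennreal (normal_density (2 * \<theta> i) \<sigma> x))"
      by (rule prob_space_normal_density[OF \<open>\<sigma> > 0\<close>])
    have "(\<integral>\<^sup>+x. ennreal ((l i x)\<^sup>2) \<partial>?N0) =
        (\<integral>\<^sup>+x. ennreal (exp ((\<theta> i)\<^sup>2 / \<sigma>\<^sup>2)) * ennreal (normal_density (2 * \<theta> i) \<sigma> x) \<partial>lborel)"
      by (subst nn_integral_density)
        (auto simp: l_def ennreal_mult[symmetric] normal_density_shift_square[OF \<open>\<sigma> > 0\<close>])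
    also have "\<dots> = ennreal (exp ((\<theta> i)\<^sup>2 / \<sigma>\<^sup>2)) * (\<integral>\<^sup>+x. ennreal (normal_density (2 * \<theta> i) \<sigma> x) \<partial>lborel)"
      by (intro nn_integral_cmult) measurable
    also have "(\<integral>\<^sup>+x. ennreal (normal_density (2 * \<theta> i) \<sigma> x) \<partial>lborel) = 1"
      using N.emeasure_space_1 by (simp add: emeasure_density)
    finally show "(\<integral>\<^sup>+x. ennreal ((l i x)\<^sup>2) \<partial>?N0) = ennreal (exp ((\<theta> i)\<^sup>2 / \<sigma>\<^sup>2))"
      by simp
  qed
  also have "\<dots> = ennreal (exp ((\<Sum>i\<in>I. (\<theta> i)\<^sup>2) / \<sigma>\<^sup>2))"
    using \<open>finite I\<close> by (simp add: prod_ennreal exp_sum[symmetric] sum_divide_distrib)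
  finally show ?thesis .
qed

text \<open>
  A substitute for Fano's inequality. Writing \<open>\<rho> = K / N\<close>, the bound
  \<open>L 1\<^sub>A \<le> (1 + 1 / (8 \<rho>)) 1\<^sub>A + 2 \<rho> (L - 1)\<^sup>2\<close> turns the second moments of the likelihoods into
  an upper bound for the average probability of the events \<open>A t\<close> under the laws with density \<open>L t\<close>.
\<close>

lemma multiple_testing:
  fixes L :: "'t \<Rightarrow> 'a \<Rightarrow> real"
  assumes P: "prob_space P" and T: "finite T" "T \<noteq> {}"
    and L_meas [measurable]: "\<And>t. t \<in> T \<Longrightarrow> L t \<in> borel_measurable P"
    and L_nonneg: "\<And>t x. L t x \<ge> 0"
    and L1: "\<And>t. t \<in> T \<Longrightarrow> (\<integral>\<^sup>+x. ennreal (L t x) \<partial>P) = 1"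
    and L2: "\<And>t. t \<in> T \<Longrightarrow> (\<integral>\<^sup>+x. ennreal ((L t x)\<^sup>2) \<partial>P) \<le> ennreal w"
    and A [measurable]: "\<And>t. t \<in> T \<Longrightarrow> A t \<in> sets P"
    and overlap: "\<And>x. x \<in> space P \<Longrightarrow> card {t \<in> T. x \<in> A t} \<le> K"
    and "w \<ge> 0" "K > 0" "2 * K \<le> card T" and w: "16 * real K * (w - 1) \<le> card T"
  shows "\<exists>t\<in>T. (\<integral>\<^sup>+x. ennreal (L t x) * indicator (space P - A t) x \<partial>P) \<ge> ennreal (1 / 5)"
proof (rule ccontr)
  interpret prob_space P by (rule P)
  assume "\<not> ?thesis"
  then have small: "(\<integral>\<^sup>+x. ennreal (L t x) * indicator (space P - A t) x \<partial>P) < ennreal (1 / 5)" if "t \<in> T" for t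
    using that by (auto simp: not_le)
  define a where "a t = (\<integral>\<^sup>+x. ennreal (L t x) * indicator (A t) x \<partial>P)" for t
  have split: "a t + (\<integral>\<^sup>+x. ennreal (L t x) * indicator (space P - A t) x \<partial>P) = 1" if "t \<in> T" for t
  proof -
    have "a t + (\<integral>\<^sup>+x. ennreal (L t x) * indicator (space P - A t) x \<partial>P) =
        (\<integral>\<^sup>+x. ennreal (L t x) * indicator (A t) x + ennreal (L t x) * indicator (space P - A t) x \<partial>P)"
      unfolding a_def using that by (subst nn_integral_add) auto
    also have "\<dots> = (\<integral>\<^sup>+x. ennreal (L t x) \<partial>P)"
      by (intro nn_integral_cong) (auto simp: indicator_def)
    finally show ?thesis
      using L1[OF that] by simp
  qed
  have big: "a t \<ge> ennreal (4 / 5)" if "t \<in> T" for t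
  proof (rule ccontr)
    assume "\<not> ?thesis"
    then have "a t < ennreal (4 / 5)"
      by simp
    then have "a t + (\<integral>\<^sup>+x. ennreal (L t x) * indicator (space P - A t) x \<partial>P) < ennreal (4 / 5) + ennreal (1 / 5)"
      using small[OF that] by (intro add_strict_mono)
    also have "\<dots> = 1"
      by (simp flip: ennreal_plus)
    finally show False
      using split[OF that] by simp
  qed
  define N where "N = real (card T)"
  have "N > 0"
    using T by (simp add: N_def card_gt_0_iff)
  \<comment> \<open>Balances the error terms: \<open>c * K\<close> exceeds \<open>K\<close> by
    \<open>N / 8\<close>, and the hypothesis on \<open>w\<close> bounds the variance term by
    \<open>N / 8\<close> as well.\<close>
  define \<mu> where "\<mu> = 4 * real K / N"
  have "\<mu> > 0"
    using \<open>N > 0\<close> \<open>K > 0\<close> by (simp add: \<mu>_def)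
  define c where "c = 1 + 1 / (2 * \<mu>)"
  \<comment> \<open>\<open>\<mu> * L t x\<close> is added on both sides to absorb the negative term
    of the expanded square, since the integrals to come take nonnegative values only.\<close>
  have pointwise: "L t x * indicator (A t) x + \<mu> * L t x \<le> c * indicator (A t) x + \<mu> / 2 * ((L t x)\<^sup>2 + 1)" for t x
  proof -
    have "L t x - 1 \<le> 1 / (2 * \<mu>) + \<mu> / 2 * (L t x - 1)\<^sup>2"
    proof -
      have "0 \<le> (1 - \<mu> * (L t x - 1))\<^sup>2 / (2 * \<mu>)"
        using \<open>\<mu> > 0\<close> by simp
      also have "\<dots> = 1 / (2 * \<mu>) + \<mu> / 2 * (L t x - 1)\<^sup>2 - (L t x - 1)"
        using \<open>\<mu> > 0\<close> by (simp add: field_simps power2_eq_square)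
      finally show ?thesis
        by simp
    qed
    moreover have "0 \<le> \<mu> / 2 * (L t x - 1)\<^sup>2"
      using \<open>\<mu> > 0\<close> by simp
    ultimately show ?thesis
      by (auto simp: indicator_def c_def power2_eq_square algebra_simps)
  qed
  have integrated: "a t + ennreal \<mu> \<le> ennreal c * emeasure P (A t) + ennreal (\<mu> / 2 * (w + 1))" if t: "t \<in> T" for t
  proof -
    have "a t + ennreal \<mu> = (\<integral>\<^sup>+x. ennreal (L t x * indicator (A t) x + \<mu> * L t x) \<partial>P)"
    proof -
      have "(\<integral>\<^sup>+x. ennreal (L t x * indicator (A t) x + \<mu> * L t x) \<partial>P) =
          (\<integral>\<^sup>+x. ennreal (L t x) * indicator (A t) x + ennreal \<mu> * ennreal (L t x) \<partial>P)"
        using L_nonneg \<open>\<mu> > 0\<close>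
        by (intro nn_integral_cong) (auto simp: indicator_def ennreal_mult[symmetric] simp flip: ennreal_plus)
      also have "\<dots> = a t + ennreal \<mu> * (\<integral>\<^sup>+x. ennreal (L t x) \<partial>P)"
        unfolding a_def using t by (subst nn_integral_add) (auto simp: nn_integral_cmult)
      finally show ?thesis
        using L1[OF t] by simp
    qed
    also have "\<dots> \<le> (\<integral>\<^sup>+x. ennreal (c * indicator (A t) x + \<mu> / 2 * ((L t x)\<^sup>2 + 1)) \<partial>P)"
      by (intro nn_integral_mono ennreal_leI pointwise)
    also have "\<dots> = (\<integral>\<^sup>+x. ennreal c * indicator (A t) x + ennreal (\<mu> / 2) * (ennreal ((L t x)\<^sup>2) + 1) \<partial>P)"
      using \<open>\<mu> > 0\<close> unfolding c_def
      by (intro nn_integral_cong)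
        (auto simp: indicator_def ennreal_mult[symmetric] ennreal_1[symmetric] simp del: ennreal_1 simp flip: ennreal_plus)
    also have "\<dots> = ennreal c * emeasure P (A t) + ennreal (\<mu> / 2) * ((\<integral>\<^sup>+x. ennreal ((L t x)\<^sup>2) \<partial>P) + 1)"
      using t by (subst nn_integral_add)
        (auto simp: nn_integral_cmult nn_integral_add emeasure_space_1)
    also have "\<dots> \<le> ennreal c * emeasure P (A t) + ennreal (\<mu> / 2) * (ennreal w + 1)"
      by (intro add_mono mult_left_mono L2[OF t] order_refl) auto
    also have "ennreal (\<mu> / 2) * (ennreal w + 1) = ennreal (\<mu> / 2 * (w + 1))"
      using \<open>w \<ge> 0\<close> \<open>\<mu> > 0\<close> by (simp add: ennreal_mult[symmetric] ennreal_1[symmetric] del: ennreal_1 flip: ennreal_plus)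
    finally show ?thesis .
  qed
  have measure_sum: "(\<Sum>t\<in>T. emeasure P (A t)) \<le> ennreal (real K)"
  proof -
    have "(\<Sum>t\<in>T. emeasure P (A t)) = (\<integral>\<^sup>+x. (\<Sum>t\<in>T. indicator (A t) x) \<partial>P)"
      by (subst nn_integral_sum) (auto intro!: sum.cong simp: nn_integral_indicator)
    also have "\<dots> \<le> (\<integral>\<^sup>+x. ennreal (real K) \<partial>P)"
    proof (rule nn_integral_mono)
      fix x assume x: "x \<in> space P"
      have "(\<Sum>t\<in>T. indicator (A t) x :: ennreal) = of_nat (card {t \<in> T. x \<in> A t})"
        using T(1) by (simp add: indicator_def sum.If_cases Int_def)
      also have "\<dots> \<le> of_nat K"
        using overlap[OF x] by (simp add: of_nat_le_iff)
      finally show "(\<Sum>t\<in>T. indicator (A t) x) \<le> ennreal (real K)"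
        by (simp add: ennreal_of_nat_eq_real_of_nat)
    qed
    finally show ?thesis
      by (simp add: emeasure_space_1)
  qed
  have "ennreal (4 / 5 * N + \<mu> * N) = (\<Sum>t\<in>T. ennreal (4 / 5) + ennreal \<mu>)"
    using \<open>\<mu> > 0\<close> unfolding N_def
    by (simp add: ennreal_of_nat_eq_real_of_nat ennreal_mult[symmetric] algebra_simps flip: ennreal_plus)
  also have "\<dots> \<le> (\<Sum>t\<in>T. a t + ennreal \<mu>)"
    by (intro sum_mono add_mono big) auto
  also have "\<dots> \<le> (\<Sum>t\<in>T. ennreal c * emeasure P (A t) + ennreal (\<mu> / 2 * (w + 1)))"
    by (intro sum_mono integrated)
  also have "\<dots> = ennreal c * (\<Sum>t\<in>T. emeasure P (A t)) + ennreal (N * (\<mu> / 2 * (w + 1)))"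
  proof -
    have "of_nat (card T) * ennreal (\<mu> / 2 * (w + 1)) = ennreal (N * (\<mu> / 2 * (w + 1)))"
      using \<open>\<mu> > 0\<close> \<open>w \<ge> 0\<close>
      by (subst ennreal_mult) (auto simp: N_def ennreal_of_nat_eq_real_of_nat)
    then show ?thesis
      by (simp only: sum.distrib sum_distrib_left[symmetric] sum_constant)
  qed
  also have "\<dots> \<le> ennreal c * ennreal (real K) + ennreal (N * (\<mu> / 2 * (w + 1)))"
    by (intro add_mono mult_left_mono measure_sum order_refl) auto
  also have "\<dots> = ennreal (c * real K + N * (\<mu> / 2 * (w + 1)))"
    using \<open>\<mu> > 0\<close> \<open>w \<ge> 0\<close> \<open>N > 0\<close> unfolding c_def
    by (simp add: ennreal_mult[symmetric] flip: ennreal_plus)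
  finally have "4 / 5 * N + \<mu> * N \<le> c * real K + N * (\<mu> / 2 * (w + 1))"
    using \<open>\<mu> > 0\<close> \<open>w \<ge> 0\<close> \<open>N > 0\<close> unfolding c_def by (subst (asm) ennreal_le_iff) auto
  then have main: "4 / 5 * N \<le> c * real K + N * (\<mu> / 2 * (w - 1))"
  proof -
    have "N * (\<mu> / 2 * (w + 1)) = N * (\<mu> / 2 * (w - 1)) + \<mu> * N"
      by (simp add: field_simps)
    then show ?thesis
      using \<open>4 / 5 * N + \<mu> * N \<le> c * real K + N * (\<mu> / 2 * (w + 1))\<close> by linarith
  qed
  have "c * real K = real K + N / 8"
    using \<open>K > 0\<close> \<open>N > 0\<close> by (simp add: c_def \<mu>_def field_simps)
  moreover have "N * (\<mu> / 2 * (w - 1)) = 2 * real K * (w - 1)"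
    using \<open>N > 0\<close> by (simp add: \<mu>_def)
  \<comment> \<open>The average success probability is at most 1/2 + 1/8 + 1/8, which is below
    4/5.\<close>
  ultimately have "4 / 5 * N \<le> real K + N / 8 + N / 8"
    using main w unfolding N_def by linarith
  moreover have "2 * real K \<le> N"
    using \<open>2 * K \<le> card T\<close> unfolding N_def by linarith
  ultimately show False
    using \<open>N > 0\<close> by linarith
qed

section \<open>From tests to the risk of estimators\<close>

definition dual_pairing ::
    "nat \<Rightarrow> nat \<Rightarrow> nat \<Rightarrow> (nat \<Rightarrow> nat \<Rightarrow> real) \<Rightarrow> (nat \<Rightarrow> nat \<Rightarrow> real) \<Rightarrow> (nat \<times> nat \<Rightarrow> real) \<Rightarrow> real" where
  "dual_pairing m n r x y D = (\<Sum>j<r. \<Sum>a<m. \<Sum>b<n. x j a * D (a, b) * y j b)"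

text \<open>A certificate by duality that the nuclear norm of \<open>D\<close> is at least
  \<open>\<gamma>\<close>. The witness matters as much as the bound: it is reused as a linear
  functional on the estimates.\<close>

definition nuclear_ge :: "nat \<Rightarrow> nat \<Rightarrow> nat \<Rightarrow> real \<Rightarrow> (nat \<times> nat \<Rightarrow> real) \<Rightarrow> bool" where
  "nuclear_ge m n r \<gamma> D \<longleftrightarrow>
     (\<exists>x y. suborthonormal r m x \<and> suborthonormal r n y \<and> \<gamma> \<le> dual_pairing m n r x y D)"

lemma dual_pairing_diff:
  "dual_pairing m n r x y (\<lambda>i. D i - D' i) = dual_pairing m n r x y D - dual_pairing m n r x y D'"
  unfolding dual_pairing_def by (simp add: algebra_simps sum_subtractf)

lemma dual_pairing_cong:
  "(\<And>a b. a < m \<Longrightarrow> b < n \<Longrightarrow> D (a, b) = D' (a, b)) \<Longrightarrow> dual_pairing m n r x y D = dual_pairing m n r x y D'"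
  unfolding dual_pairing_def by (intro sum.cong refl) auto

lemma abs_dual_pairing_le_schatten_norm:
  assumes E: "E \<in> carrier_mat m n" and "n \<le> m" "1 \<le> q" "r > 0"
    and x: "suborthonormal r m x" and y: "suborthonormal r n y"
  shows "\<bar>dual_pairing m n r x y (\<lambda>i. E $$ i)\<bar> \<le> real r powr (1 - 1 / q) * schatten_norm q E"
proof -
  have "suborthonormal r m (\<lambda>j a. - x j a)"
    using x by (simp add: suborthonormal_def ip_def)
  from schatten_norm_dual[OF assms(1-4) this y] schatten_norm_dual[OF assms]
  show ?thesis
    unfolding dual_pairing_def by (simp add: sum_negf abs_le_iff)
qed

lemma space_borel_mat: "space (borel_mat m n) = carrier_mat m n"
  by (simp add: borel_mat_def)

lemma measurable_mat_entry [measurable]: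
  assumes "a < m" "b < n"
  shows "(\<lambda>A. A $$ (a, b)) \<in> borel_measurable (borel_mat m n)"
proof -
  have "(\<lambda>A. \<lambda>ij\<in>{..<m} \<times> {..<n}. A $$ ij) \<in> borel_mat m n \<rightarrow>\<^sub>M (\<Pi>\<^sub>M ij\<in>{..<m} \<times> {..<n}. (borel :: real measure))"
    unfolding borel_mat_def by (rule measurable_vimage_algebra1) (auto simp: space_PiM)
  then have "(\<lambda>A. (\<lambda>ij\<in>{..<m} \<times> {..<n}. A $$ ij) (a, b)) \<in> borel_mat m n \<rightarrow>\<^sub>M (borel :: real measure)"
    by (rule measurable_compose[OF _ measurable_component_singleton]) (use assms in auto)
  then show ?thesis
    using assms by simp
qed

lemma measurable_mat_add:
  assumes M: "M \<in> carrier_mat m n"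
  shows "(\<lambda>Z. M + Z) \<in> borel_mat m n \<rightarrow>\<^sub>M borel_mat m n"
proof -
  have "(\<lambda>Z. \<lambda>ij\<in>{..<m} \<times> {..<n}. (M + Z) $$ ij) \<in> borel_mat m n \<rightarrow>\<^sub>M (\<Pi>\<^sub>M ij\<in>{..<m} \<times> {..<n}. (borel :: real measure))"
  proof (rule measurable_restrict)
    fix ij assume "ij \<in> {..<m} \<times> {..<n}"
    then obtain a b where ij: "ij = (a, b)" "a < m" "b < n"
      by auto
    have "(\<lambda>Z. M $$ ij + Z $$ (a, b)) \<in> borel_mat m n \<rightarrow>\<^sub>M borel"
      using measurable_mat_entry[OF ij(2,3)] by measurable
    then show "(\<lambda>Z. (M + Z) $$ ij) \<in> borel_mat m n \<rightarrow>\<^sub>M borel"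
      by (rule measurable_cong[THEN iffD1, rotated]) (use ij in \<open>auto simp: space_borel_mat\<close>)
  qed
  then show ?thesis
    by (subst (2) borel_mat_def, intro measurable_vimage_algebra2)
      (use M in \<open>auto simp: space_borel_mat\<close>)
qed

lemma measurable_dual_pairing_mat [measurable]:
  "(\<lambda>A. dual_pairing m n r x y (\<lambda>i. A $$ i)) \<in> borel_measurable (borel_mat m n)"
  unfolding dual_pairing_def
  by (intro borel_measurable_sum borel_measurable_times borel_measurable_const measurable_mat_entry) auto

text \<open>An estimator yields tests: \<open>good t X\<close> asks that the estimate agree with
  \<open>\<theta> t\<close> up to \<open>\<gamma> / 2\<close> on the certificates of all separated
  pairs. Two separated hypotheses cannot both be good for one observation, so at most
  \<open>K\<close> are good at once, and by \<open>multiple_testing\<close> some hypothesis fails to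
  be good with probability at least 1/5. On failure some pairing with the error is at least
  \<open>\<gamma> / 2\<close> in absolute value, and Hoelder's inequality turns this into a Schatten
  norm.\<close>

lemma minimax_risk_lower_bound:
  fixes \<theta> :: "'t \<Rightarrow> nat \<times> nat \<Rightarrow> real"
  assumes "n \<le> m" "1 \<le> q" "r > 0" "\<sigma> > 0" "\<gamma> \<ge> 0"
    and T: "finite T" "T \<noteq> {}"
    and F: "\<And>t. t \<in> T \<Longrightarrow> Matrix.mat m n (\<theta> t) \<in> F"
    and radius: "\<And>t. t \<in> T \<Longrightarrow> exp ((\<Sum>ij\<in>{..<m} \<times> {..<n}. (\<theta> t ij - \<theta>0 ij)\<^sup>2) / \<sigma>\<^sup>2) \<le> w"
    and sep: "\<And>t. t \<in> T \<Longrightarrow> card {t' \<in> T. \<not> nuclear_ge m n r \<gamma> (\<lambda>i. \<theta> t i - \<theta> t' i)} \<le> K"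
    and "K > 0" "2 * K \<le> card T" "16 * real K * (w - 1) \<le> card T"
  shows "minimax_risk m n \<sigma> q F \<ge> ennreal (\<gamma>\<^sup>2 * real r powr (2 / q - 2) / 20)"
  unfolding minimax_risk_def
proof (rule INF_greatest)
  fix est assume est: "est \<in> borel_mat m n \<rightarrow>\<^sub>M borel_mat m n"
  define I where "I = {..<m} \<times> {..<n}"
  have "finite I"
    by (simp add: I_def)
  define P where "P = gaussian_vec I \<sigma>"
  have P: "prob_space P"
    unfolding P_def by (rule prob_space_gaussian_vec[OF \<open>\<sigma> > 0\<close>])
  have [measurable_cong]: "sets P = sets (\<Pi>\<^sub>M i\<in>I. borel)"
    unfolding P_def by (rule sets_gaussian_vec)
  define \<Delta> where "\<Delta> t i = \<theta> t i - \<theta>0 i" for t i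
  define sp where "sp t t' \<longleftrightarrow> nuclear_ge m n r \<gamma> (\<lambda>i. \<theta> t i - \<theta> t' i)" for t t'
  define cert where "cert t t' x y \<longleftrightarrow> suborthonormal r m x \<and> suborthonormal r n y \<and>
      \<gamma> \<le> dual_pairing m n r x y (\<lambda>i. \<theta> t i - \<theta> t' i)" for t t' x y
  have "\<forall>t t'. sp t t' \<longrightarrow> (\<exists>x y. cert t t' x y)"
    unfolding sp_def nuclear_ge_def cert_def by blast
  then obtain x y where cert: "\<And>t t'. sp t t' \<Longrightarrow> cert t t' (x t t') (y t t')"
    by metis
  have xy: "suborthonormal r m (x t t') \<and> suborthonormal r n (y t t') \<and>
      \<gamma> \<le> dual_pairing m n r (x t t') (y t t') (\<lambda>i. \<theta> t i - \<theta> t' i)" if "sp t t'" for t t'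
    using cert[OF that] by (simp add: cert_def)
  define S where "S = {(u, u') \<in> T \<times> T. sp u u'}"
  have "finite S"
    unfolding S_def using T(1) by (auto intro: finite_subset[of _ "T \<times> T"])
  define dp where "dp u A = dual_pairing m n r (x (fst u) (snd u)) (y (fst u) (snd u)) A" for u A
  \<comment> \<open>\<open>S\<close> is finite and every pairing is a measurable function of the
    observation, so \<open>good t\<close> is an event; comparing Schatten distances would call for
    the measurability of \<open>schatten_norm\<close>.\<close>
  define good where "good t X \<longleftrightarrow> (\<forall>u\<in>S. \<bar>dp u (\<lambda>i. est X $$ i) - dp u (\<theta> t)\<bar> < \<gamma> / 2)" for t X
  have good_meas: "Measurable.pred (borel_mat m n) (good t)" for t
  proof -
    have [measurable]: "(\<lambda>X. dp u (\<lambda>i. est X $$ i)) \<in> borel_measurable (borel_mat m n)" for u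
      unfolding dp_def by (rule measurable_compose[OF est measurable_dual_pairing_mat])
    have [simp]: "countable S"
      using \<open>finite S\<close> by (rule countable_finite)
    show ?thesis
      unfolding good_def by measurable
  qed
  \<comment> \<open>The observation in terms of noise around the common centre
    \<open>\<theta>0\<close>, so that only the differences \<open>\<Delta> t\<close> enter the
    likelihoods.\<close>
  define base where "base z = Matrix.mat m n (\<lambda>i. \<theta>0 i + z i)" for z
  have base_meas [measurable]: "base \<in> (\<Pi>\<^sub>M i\<in>I. borel) \<rightarrow>\<^sub>M borel_mat m n"
  proof -
    have "(\<lambda>z. Matrix.mat m n (\<lambda>i\<in>I. \<theta>0 i + z i)) \<in> (\<Pi>\<^sub>M i\<in>I. borel) \<rightarrow>\<^sub>M borel_mat m n"
      unfolding I_def by (rule measurable_compose[OF _ measurable_mat]) measurable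
    also have "(\<lambda>z. Matrix.mat m n (\<lambda>i\<in>I. \<theta>0 i + z i)) = base"
      unfolding base_def I_def by (intro ext eq_matI) auto
    finally show ?thesis .
  qed
  define A where "A t = {z \<in> space P. good t (base z)}" for t
  have space_P: "space P = space (\<Pi>\<^sub>M i\<in>I. (borel :: real measure))"
    by (rule sets_eq_imp_space_eq) (simp add: \<open>sets P = _\<close>)
  have A_meas: "A t \<in> sets P" for t
  proof -
    have "Measurable.pred (\<Pi>\<^sub>M i\<in>I. borel) (\<lambda>z. good t (base z))"
      by (rule measurable_compose[OF base_meas good_meas])
    then show ?thesis
      unfolding A_def by measurable
  qed
  have "\<exists>t\<in>T. (\<integral>\<^sup>+z. ennreal (likelihood I \<sigma> (\<Delta> t) z) * indicator (space P - A t) z \<partial>P) \<ge> ennreal (1 / 5)"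
  proof (rule multiple_testing[OF P T, where w = w and K = K])
    show "likelihood I \<sigma> (\<Delta> t) \<in> borel_measurable P" for t
      by measurable
    show "(\<integral>\<^sup>+z. ennreal (likelihood I \<sigma> (\<Delta> t) z) \<partial>P) = 1" for t
      unfolding P_def by (rule nn_integral_likelihood[OF \<open>\<sigma> > 0\<close> \<open>finite I\<close>])
    show "(\<integral>\<^sup>+z. ennreal ((likelihood I \<sigma> (\<Delta> t) z)\<^sup>2) \<partial>P) \<le> ennreal w" if "t \<in> T" for t
      unfolding P_def nn_integral_likelihood_square[OF \<open>\<sigma> > 0\<close> \<open>finite I\<close>]
      using radius[OF that] by (intro ennreal_leI) (simp add: \<Delta>_def I_def)
    show "card {t \<in> T. z \<in> A t} \<le> K" if "z \<in> space P" for z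
    proof (cases "{t \<in> T. z \<in> A t} = {}")
      case True
      show ?thesis
        unfolding True by simp
    next
      case False
      then obtain t where t: "t \<in> T" "z \<in> A t"
        by blast
      have "{t \<in> T. z \<in> A t} \<subseteq> {t' \<in> T. \<not> sp t t'}"
      proof safe
        fix t' assume t': "t' \<in> T" "z \<in> A t'" "sp t t'"
        then have S: "(t, t') \<in> S"
          using t by (simp add: S_def)
        have "\<gamma> \<le> dp (t, t') (\<theta> t) - dp (t, t') (\<theta> t')"
          using xy[OF t'(3)] by (simp add: dp_def dual_pairing_diff)
        moreover have "\<bar>dp (t, t') (\<lambda>i. est (base z) $$ i) - dp (t, t') (\<theta> t)\<bar> < \<gamma> / 2"
          "\<bar>dp (t, t') (\<lambda>i. est (base z) $$ i) - dp (t, t') (\<theta> t')\<bar> < \<gamma> / 2"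
          using t t' S unfolding A_def good_def by auto
        ultimately show False
          by linarith
      qed
      then have "card {t \<in> T. z \<in> A t} \<le> card {t' \<in> T. \<not> sp t t'}"
        using T(1) by (intro card_mono) auto
      also have "\<dots> \<le> K"
        using sep[OF t(1)] by (simp add: sp_def)
      finally show ?thesis .
    qed
    show "w \<ge> 0"
      using T(2) radius by (meson all_not_in_conv exp_ge_zero order_trans)
  qed (rule A_meas likelihood_nonneg \<open>K > 0\<close> \<open>2 * K \<le> card T\<close> \<open>16 * real K * (w - 1) \<le> card T\<close>)+
  then obtain t where t: "t \<in> T"
    and le: "ennreal (1 / 5) \<le> (\<integral>\<^sup>+z. ennreal (likelihood I \<sigma> (\<Delta> t) z) * indicator (space P - A t) z \<partial>P)"
    by blast
  define M where "M = Matrix.mat m n (\<theta> t)"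
  have M: "M \<in> carrier_mat m n"
    by (simp add: M_def)
  \<comment> \<open>The square of \<open>\<gamma> / 2\<close> after Hoelder's inequality; together
    with the failure probability 1/5 it gives the constant 1/20.\<close>
  define c where "c = (\<gamma> / 2)\<^sup>2 * real r powr (2 / q - 2)"
  have "c \<ge> 0"
    by (simp add: c_def)
  define B where "B = {Z \<in> carrier_mat m n. \<not> good t (M + Z)}"
  have "Measurable.pred (borel_mat m n) (\<lambda>Z. good t (M + Z))"
    by (rule measurable_compose[OF measurable_mat_add[OF M] good_meas])
  then have B_meas [measurable]: "B \<in> sets (borel_mat m n)"
    unfolding B_def space_borel_mat[symmetric] by measurable
  have "ennreal (c * (1 / 5)) = ennreal c * ennreal (1 / 5)"
    using \<open>c \<ge> 0\<close> by (intro ennreal_mult) auto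
  also have "\<dots> \<le> ennreal c * (\<integral>\<^sup>+z. ennreal (likelihood I \<sigma> (\<Delta> t) z) * indicator (space P - A t) z \<partial>P)"
    by (intro mult_left_mono le) auto
  \<comment> \<open>Change of measure from the reference law back to hypothesis \<open>t\<close>:
    weighting by the likelihood is shifting the noise by \<open>\<Delta> t\<close>.\<close>
  also have "(\<integral>\<^sup>+z. ennreal (likelihood I \<sigma> (\<Delta> t) z) * indicator (space P - A t) z \<partial>P) =
      (\<integral>\<^sup>+z. indicator (space P - A t) (\<lambda>i\<in>I. \<Delta> t i + z i) \<partial>P)"
    unfolding P_def
    by (rule nn_integral_gaussian_vec_shift[symmetric, OF \<open>\<sigma> > 0\<close> \<open>finite I\<close>])
      (use A_meas[of t] in \<open>auto simp: P_def sets_gaussian_vec intro!: borel_measurable_indicator\<close>)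
  also have "\<dots> = (\<integral>\<^sup>+z. indicator B (Matrix.mat m n z) \<partial>P)"
  proof (rule nn_integral_cong)
    fix z assume z: "z \<in> space P"
    have "base (\<lambda>i\<in>I. \<Delta> t i + z i) = M + Matrix.mat m n z"
      unfolding base_def M_def by (intro eq_matI) (auto simp: I_def \<Delta>_def)
    moreover have "(\<lambda>i\<in>I. \<Delta> t i + z i) \<in> space P"
      by (auto simp: space_P space_PiM)
    ultimately show "(indicator (space P - A t) (\<lambda>i\<in>I. \<Delta> t i + z i) :: ennreal) = indicator B (Matrix.mat m n z)"
      by (auto simp: indicator_def A_def B_def)
  qed
  also have "\<dots> = (\<integral>\<^sup>+Z. indicator B Z \<partial>gaussian_mat m n \<sigma>)"
  proof -
    have "gaussian_mat m n \<sigma> = distr P (borel_mat m n) (Matrix.mat m n)"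
      by (simp add: gaussian_mat_def P_def gaussian_vec_def I_def)
    moreover have "Matrix.mat m n \<in> P \<rightarrow>\<^sub>M borel_mat m n"
      using measurable_mat[of m n] measurable_cong_sets[OF \<open>sets P = _\<close> refl] unfolding I_def by blast
    ultimately show ?thesis
      by (simp only:) (subst nn_integral_distr, auto)
  qed
  also have "ennreal c * \<dots> = (\<integral>\<^sup>+Z. ennreal c * indicator B Z \<partial>gaussian_mat m n \<sigma>)"
    by (rule nn_integral_cmult[symmetric]) (simp add: gaussian_mat_def)
  also have "\<dots> \<le> risk m n \<sigma> q est M"
    unfolding risk_def
  proof (rule nn_integral_mono)
    fix Z assume "Z \<in> space (gaussian_mat m n \<sigma>)"
    then have Z: "Z \<in> carrier_mat m n"
      by (simp add: gaussian_mat_def space_borel_mat)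
    show "ennreal c * indicator B Z \<le> ennreal ((schatten_norm q (est (M + Z) - M))\<^sup>2)"
    proof (cases "Z \<in> B")
      case True
      have estMZ: "est (M + Z) \<in> carrier_mat m n"
        using measurable_space[OF est, of "M + Z"] M Z by (simp add: space_borel_mat)
      define E where "E = est (M + Z) - M"
      have E: "E \<in> carrier_mat m n"
        unfolding E_def using M by (rule minus_carrier_mat)
      obtain u where u: "u \<in> S" "\<not> \<bar>dp u (\<lambda>i. est (M + Z) $$ i) - dp u (\<theta> t)\<bar> < \<gamma> / 2"
        using True unfolding B_def good_def by blast
      have "dp u (\<lambda>i. E $$ i) = dp u (\<lambda>i. est (M + Z) $$ i - \<theta> t i)"
        unfolding dp_def using estMZ M by (intro dual_pairing_cong) (auto simp: E_def M_def)
      also have "\<dots> = dp u (\<lambda>i. est (M + Z) $$ i) - dp u (\<theta> t)"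
        unfolding dp_def by (rule dual_pairing_diff)
      finally have "\<gamma> / 2 \<le> \<bar>dp u (\<lambda>i. E $$ i)\<bar>"
        using u(2) by simp
      also have "\<dots> \<le> real r powr (1 - 1 / q) * schatten_norm q E"
        unfolding dp_def using u(1) xy[of "fst u" "snd u"]
        by (intro abs_dual_pairing_le_schatten_norm[OF E assms(1-3)]) (auto simp: S_def)
      finally have "\<gamma> / 2 * real r powr (1 / q - 1) \<le> schatten_norm q E"
        using \<open>r > 0\<close> by (simp add: powr_diff field_simps)
      moreover have "c = (\<gamma> / 2 * real r powr (1 / q - 1))\<^sup>2"
        unfolding c_def power_mult_distrib using \<open>r > 0\<close>
        by (simp add: powr_power[symmetric] power2_eq_square powr_add[symmetric])
      ultimately have "c \<le> (schatten_norm q E)\<^sup>2"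
        using \<open>\<gamma> \<ge> 0\<close> by (simp add: power_mono)
      then show ?thesis
        using True unfolding E_def by (simp add: ennreal_leI)
    qed auto
  qed
  also have "\<dots> \<le> (SUP M\<in>F. risk m n \<sigma> q est M)"
    using F[OF t] unfolding M_def by (rule SUP_upper)
  finally show "ennreal (\<gamma>\<^sup>2 * real r powr (2 / q - 2) / 20) \<le> (SUP M\<in>F. risk m n \<sigma> q est M)"
    by (simp add: c_def power_divide)
qed

section \<open>Packings indexed by words\<close>

definition words :: "'j set \<Rightarrow> nat \<Rightarrow> ('j \<Rightarrow> nat) set" where
  "words J h = (J \<rightarrow>\<^sub>E {..<h})"

definition hamming :: "'j set \<Rightarrow> ('j \<Rightarrow> nat) \<Rightarrow> ('j \<Rightarrow> nat) \<Rightarrow> nat" where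
  "hamming J t t' = card {i \<in> J. t i \<noteq> t' i}"

lemma finite_words: "finite J \<Longrightarrow> finite (words J h)"
  unfolding words_def by (intro finite_PiE) auto

lemma card_words: "finite J \<Longrightarrow> card (words J h) = h ^ card J"
  unfolding words_def by (simp add: card_PiE)

text \<open>The cost per letter in the Chernoff bound for Hamming balls. The 16th power of the claim
  is \<open>16 * h * (17 / 16) ^ 16 \<le> h ^ 8\<close>; here \<open>(17 / 16) ^ 16\<close> is below
  3, and 48 is below \<open>2 ^ 7\<close>.\<close>

lemma hamming_ball_base:
  fixes h :: nat
  assumes "h \<ge> 2"
  shows "(16 * real h) powr (1 / 16) * (17 / 16) \<le> real h powr (1 / 2)"
proof -
  have "2 ^ 7 \<le> real h ^ 7"
    using assms by (intro power_mono) auto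
  then have "real h * 48 \<le> real h * real h ^ 7"
    by (intro mult_left_mono) auto
  have "((16 * real h) powr (1 / 16) * (17 / 16)) ^ 16 = 16 * real h * (17 / 16) ^ 16"
    unfolding power_mult_distrib using assms by (simp add: powr_power)
  also have "\<dots> \<le> 16 * real h * 3"
    by (intro mult_left_mono) (auto simp: power_divide)
  also have "\<dots> \<le> real h ^ 8"
    using \<open>real h * 48 \<le> real h * real h ^ 7\<close> by (simp add: power_Suc[symmetric] del: power_Suc)
  also have "real h ^ 8 = (real h powr (1 / 2)) ^ 16"
    using assms by (simp add: powr_power powr_numeral)
  finally show ?thesis
    by (rule power_le_imp_le_base[where n = 15, simplified]) auto
qed

text \<open>
  Chernoff's method: the indicator of the ball is at most \<open>x powr (hamming J t t' - card J / 16)\<close>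
  with \<open>x = 1 / (16 h)\<close>, whose sum over all words factorizes.
\<close>

lemma card_hamming_ball:
  assumes J: "finite J" and h: "h \<ge> 2" and t: "t \<in> words J h"
  shows "real (card {t' \<in> words J h. 16 * hamming J t t' \<le> card J}) \<le> real h powr (card J / 2)"
proof -
  define n where "n = card J"
  define x where "x = 1 / (16 * real h)"
  have x: "x > 0"
    using h by (simp add: x_def)
  have fin: "finite (words J h)"
    using J by (rule finite_words)
  have prod: "(\<Prod>i\<in>J. if t' i = t i then 1 else x) = x ^ hamming J t t'" for t'
  proof -
    have "J \<inter> - {i. t' i = t i} = {i \<in> J. t i \<noteq> t' i}"
      by auto
    then show ?thesis
      using J by (simp add: prod.If_cases hamming_def)
  qed
  have "real (card {t' \<in> words J h. 16 * hamming J t t' \<le> n}) =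
      (\<Sum>t'\<in>{t' \<in> words J h. 16 * hamming J t t' \<le> n}. 1)"
    by simp
  also have "\<dots> \<le> (\<Sum>t'\<in>{t' \<in> words J h. 16 * hamming J t t' \<le> n}. x powr (- n / 16) * x ^ hamming J t t')"
  proof (rule sum_mono)
    fix t' assume "t' \<in> {t' \<in> words J h. 16 * hamming J t t' \<le> n}"
    then have *: "real (hamming J t t') - n / 16 \<le> 0"
      by auto
    have "x \<le> 1"
      using h by (simp add: x_def)
    have "1 = x powr 0"
      using x by simp
    also have "\<dots> \<le> x powr (real (hamming J t t') - n / 16)"
      using * x \<open>x \<le> 1\<close> by (intro powr_mono') auto
    also have "\<dots> = x powr (- n / 16) * x ^ hamming J t t'"
      unfolding powr_realpow[OF x, symmetric] powr_add[symmetric] by (rule arg_cong) simp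
    finally show "1 \<le> x powr (- n / 16) * x ^ hamming J t t'" .
  qed
  also have "\<dots> \<le> (\<Sum>t'\<in>words J h. x powr (- n / 16) * x ^ hamming J t t')"
    using fin x by (intro sum_mono2) auto
  also have "\<dots> = x powr (- n / 16) * (\<Sum>t'\<in>words J h. \<Prod>i\<in>J. if t' i = t i then 1 else x)"
    by (simp add: prod sum_distrib_left)
  also have "(\<Sum>t'\<in>words J h. \<Prod>i\<in>J. if t' i = t i then 1 else x) = (\<Prod>i\<in>J. \<Sum>a<h. if a = t i then 1 else x)"
    unfolding words_def using J by (subst prod_sum_PiE) auto
  also have "\<dots> \<le> (\<Prod>i\<in>J. 17 / 16)"
  proof (rule prod_mono)
    fix i assume "i \<in> J"
    then have ti: "t i < h"
      using t by (auto simp: words_def)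
    have "(\<Sum>a<h. if a = t i then 1 else x) \<le> (\<Sum>a<h. (if a = t i then 1 else 0) + x)"
      using x by (intro sum_mono) auto
    also have "\<dots> = 1 + real h * x"
      using ti by (simp add: sum.distrib)
    also have "\<dots> = 17 / 16"
      using h by (simp add: x_def)
    finally show "0 \<le> (\<Sum>a<h. if a = t i then 1 else x) \<and> (\<Sum>a<h. if a = t i then 1 else x) \<le> 17 / 16"
      using x by (auto intro: sum_nonneg)
  qed
  also have "x powr (- n / 16) * (\<Prod>i\<in>J. 17 / 16) = ((16 * real h) powr (1 / 16) * (17 / 16)) ^ n"
  proof -
    have "x powr (- n / 16) = (16 * real h) powr (n / 16)"
      using h unfolding x_def by (simp add: powr_divide powr_minus)
    also have "\<dots> = ((16 * real h) powr (1 / 16)) ^ n"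
      using h by (simp add: powr_power)
    finally show ?thesis
      unfolding power_mult_distrib by (simp add: n_def)
  qed
  also have "\<dots> \<le> (real h powr (1 / 2)) ^ n"
    using hamming_ball_base[OF h] by (intro power_mono) auto
  also have "\<dots> = real h powr (n / 2)"
    using h by (simp add: powr_power)
  finally show ?thesis
    using x by (simp add: n_def mult_left_mono)
qed

text \<open>Extracts a bound on \<open>w - 1\<close> from one on \<open>w ^ 10\<close>. Bernoulli's
  inequality for the exponent 10 has slope 10/16 and is too weak for large \<open>y\<close>; for the
  exponent 5, followed by squaring, it gains quadratic growth.\<close>

lemma power_ten_ge:
  fixes y :: real
  assumes "y \<ge> 0"
  shows "y \<le> (1 + y / 16) ^ 10"
proof -
  have "1 + 5 * (y / 16) \<le> (1 + y / 16) ^ 5"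
    using Bernoulli_inequality[of "y / 16" 5] assms by simp
  then have "(1 + 5 * (y / 16))\<^sup>2 \<le> ((1 + y / 16) ^ 5)\<^sup>2"
    using assms by (intro power_mono) auto
  moreover have "(1 + 5 * (y / 16))\<^sup>2 = y + ((1 - 3 * (y / 16))\<^sup>2 + 16 * (y / 16)\<^sup>2)"
    by (simp add: power2_eq_square field_simps)
  moreover have "0 \<le> (1 - 3 * (y / 16))\<^sup>2 + 16 * (y / 16)\<^sup>2"
    by simp
  moreover have "((1 + y / 16) ^ 5)\<^sup>2 = (1 + y / 16) ^ 10"
    by (simp add: power_mult[symmetric])
  ultimately show ?thesis
    by linarith
qed

text \<open>\<open>H\<close> is the square root of the number of all words. A Hamming ball of radius
  \<open>card J / 16\<close> contains at most \<open>H\<close> words, while \<open>G\<close> has at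
  least \<open>3 / 4 * H\<^sup>2\<close>, so a ball holds a fraction of \<open>G\<close> of order
  \<open>1 / H\<close>. The exponential is \<open>H powr (1 / 20)\<close>, small enough for the
  second moment condition of \<open>multiple_testing\<close> even when \<open>H\<close> is close to
  1.\<close>

lemma hamming_overlap:
  assumes J: "finite J" "J \<noteq> {}" and h: "h \<ge> 2" and G: "G \<subseteq> words J h"
    and large: "3 * h ^ card J \<le> 4 * card G"
  shows "\<exists>K>0. (\<forall>t\<in>G. card {t' \<in> G. 16 * hamming J t t' \<le> card J} \<le> K) \<and>
    2 * K \<le> card G \<and> 16 * real K * (exp (real (card J) * ln (real h) / 40) - 1) \<le> card G"
proof -
  define n where "n = card J"
  have n: "n \<ge> 1"
    using J by (simp add: n_def Suc_leI card_gt_0_iff)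
  have fin: "finite (words J h)"
    using J by (intro finite_words)
  define H where "H = real h powr (n / 2)"
  have HH: "H * H = real h ^ n"
    using h by (simp add: H_def powr_add[symmetric] powr_realpow)
  have H1: "H \<ge> 1"
    using h by (simp add: H_def ge_one_powr_ge_zero)
  have big: "3 / 4 * (H * H) \<le> card G"
  proof -
    have "real (3 * h ^ n) \<le> real (4 * card G)"
      using large unfolding n_def of_nat_le_iff .
    then show ?thesis
      by (simp add: HH)
  qed
  \<comment> \<open>For fewer than 16 letters the ball is a single point. Rounding \<open>H\<close>
    down there could break \<open>2 * K \<le> card G\<close>: two binary letters give
    \<open>H = 2\<close>, while \<open>card G\<close> may be 3.\<close>
  define K where "K = (if n < 16 then 1 else nat \<lfloor>H\<rfloor>)"
  have K: "K > 0" "real K \<le> H"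
    using H1 by (auto simp: K_def le_floor_iff)
  have count: "card {t' \<in> G. 16 * hamming J t t' \<le> n} \<le> K" if t: "t \<in> G" for t
  proof (cases "n < 16")
    case True
    have "{t' \<in> G. 16 * hamming J t t' \<le> n} \<subseteq> {t}"
    proof safe
      fix t' assume t': "t' \<in> G" "16 * hamming J t t' \<le> n"
      then have "hamming J t t' = 0"
        using True by simp
      then have eq: "\<And>i. i \<in> J \<Longrightarrow> t i = t' i"
        using J(1) by (auto simp: hamming_def)
      have "t \<in> words J h" "t' \<in> words J h"
        using t t' G by auto
      then show "t' = t"
        unfolding words_def by (rule PiE_ext[symmetric]) (simp add: eq)
    qed
    then show ?thesis
      using card_mono[of "{t}"] True by (fastforce simp: K_def)
  next
    case False
    have "card {t' \<in> G. 16 * hamming J t t' \<le> n} \<le> card {t' \<in> words J h. 16 * hamming J t t' \<le> n}"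
      using fin G by (intro card_mono) auto
    then have "real (card {t' \<in> G. 16 * hamming J t t' \<le> n}) \<le> H"
      using card_hamming_ball[OF J(1) h, of t] t G unfolding H_def n_def by (auto intro: order_trans)
    then show ?thesis
      using False by (simp add: K_def le_nat_floor)
  qed
  have two: "2 * K \<le> card G"
  proof (cases "n < 16")
    case True
    have "(2::real) ^ 1 \<le> 2 ^ n"
      using n by (intro power_increasing) auto
    also have "\<dots> \<le> real h ^ n"
      using h by (intro power_mono) auto
    finally have "3 / 2 \<le> real (card G)"
      using big HH by simp
    then show ?thesis
      using True by (simp add: K_def)
  next
    case False
    have "(2::real) powr 8 \<le> 2 powr (n / 2)"
      using False by (intro powr_mono) auto
    also have "\<dots> \<le> H"
      unfolding H_def using h by (intro powr_mono2) auto
    finally have "256 \<le> H"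
      by simp
    then have "256 * H \<le> H * H"
      using H1 by (intro mult_right_mono) auto
    then have "2 * real K \<le> card G"
      using big K(2) H1 by linarith
    then show ?thesis
      by linarith
  qed
  define y where "y = card G / real K"
  have y: "y \<ge> 2" "y \<ge> 3 / 4 * H"
  proof -
    have "2 * real K \<le> card G"
      using two by linarith
    then show "y \<ge> 2"
      using K(1) by (simp add: y_def field_simps)
    have "3 / 4 * H * real K \<le> 3 / 4 * H * H"
      using K(2) H1 by (intro mult_left_mono) auto
    then show "y \<ge> 3 / 4 * H"
      using big K(1) by (simp add: y_def field_simps)
  qed
  \<comment> \<open>The bound \<open>3 / 4 * H\<close> suffices from \<open>H = 16 / 9\<close> on,
    and the bound 2 below that.\<close>
  have "sqrt H \<le> y"
  proof (cases "H \<ge> 16 / 9")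
    case True
    have "sqrt (16 / 9) \<le> sqrt H"
      using True by (rule real_sqrt_le_mono)
    then have "4 / 3 \<le> sqrt H"
      by (simp add: real_sqrt_divide)
    then have "4 / 3 * sqrt H \<le> sqrt H * sqrt H"
      using H1 by (intro mult_right_mono) auto
    then show ?thesis
      using y(2) H1 by simp
  next
    case False
    then have "sqrt H \<le> sqrt 4"
      by (intro real_sqrt_le_mono) auto
    then show ?thesis
      using y(1) by simp
  qed
  \<comment> \<open>This identity explains the constant 40: it makes the exponent match that of
    \<open>power_ten_ge\<close>.\<close>
  have "exp (n * ln (real h) / 40) ^ 10 = sqrt H"
  proof -
    have "sqrt H = real h powr (n / 4)"
      using h unfolding H_def by (simp add: powr_half_sqrt[symmetric] powr_powr)
    also have "\<dots> = exp (10 * (n * ln (real h) / 40))"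
      using h by (simp add: powr_def)
    also have "\<dots> = exp (n * ln (real h) / 40) ^ 10"
      using exp_of_nat_mult[of 10 "n * ln (real h) / 40"] by simp
    finally show ?thesis
      by simp
  qed
  also have "sqrt H \<le> (1 + y / 16) ^ 10"
    by (rule order_trans[OF \<open>sqrt H \<le> y\<close> power_ten_ge]) (use y(1) in simp)
  finally have *: "exp (n * ln (real h) / 40) ^ 10 \<le> (1 + y / 16) ^ 10" .
  have "exp (n * ln (real h) / 40) \<le> 1 + y / 16"
    by (rule power_mono_iff[THEN iffD1, OF _ _ _ *]) (use y(1) in simp_all)
  then have "16 * real K * (exp (n * ln (real h) / 40) - 1) \<le> 16 * real K * (y / 16)"
    by (intro mult_left_mono) auto
  also have "\<dots> = card G"
    using K(1) by (simp add: y_def)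
  finally show ?thesis
    using K(1) count two unfolding n_def by blast
qed

text \<open>Asking for three quarters of all words leaves room to discard the sign matrices with a
  large Gram matrix; the radius is measured from a centre that need not belong to the
  family.\<close>

definition packing ::
    "nat \<Rightarrow> nat \<Rightarrow> nat \<Rightarrow> real mat set \<Rightarrow> real \<Rightarrow> real \<Rightarrow> 'j set \<Rightarrow> nat \<Rightarrow> ('j \<Rightarrow> nat) set \<Rightarrow>
      (('j \<Rightarrow> nat) \<Rightarrow> nat \<times> nat \<Rightarrow> real) \<Rightarrow> bool" where
  "packing m n r F \<gamma> \<rho> J h G \<theta> \<longleftrightarrow>
     finite J \<and> J \<noteq> {} \<and> h \<ge> 2 \<and> G \<subseteq> words J h \<and> 3 * h ^ card J \<le> 4 * card G \<and>
     (\<forall>t\<in>G. Matrix.mat m n (\<theta> t) \<in> F) \<and>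
     (\<exists>\<theta>0. \<forall>t\<in>G. (\<Sum>ij\<in>{..<m} \<times> {..<n}. (\<theta> t ij - \<theta>0 ij)\<^sup>2) \<le> \<rho>) \<and>
     (\<forall>t\<in>G. \<forall>t'\<in>G. card J < 16 * hamming J t t' \<longrightarrow> nuclear_ge m n r \<gamma> (\<lambda>i. \<theta> t i - \<theta> t' i))"

lemma minimax_risk_packing:
  assumes "n \<le> m" "1 \<le> q" "r > 0" "\<sigma> > 0" "\<gamma> \<ge> 0"
    and packing: "packing m n r F \<gamma> \<rho> J h G \<theta>" and \<rho>: "\<rho> \<le> \<sigma>\<^sup>2 * (real (card J) * ln (real h) / 40)"
  shows "minimax_risk m n \<sigma> q F \<ge> ennreal (\<gamma>\<^sup>2 * real r powr (2 / q - 2) / 20)"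
proof -
  have J: "finite J" "J \<noteq> {}" and h: "h \<ge> 2" and G: "G \<subseteq> words J h" and large: "3 * h ^ card J \<le> 4 * card G"
    and F: "\<And>t. t \<in> G \<Longrightarrow> Matrix.mat m n (\<theta> t) \<in> F"
    and sep: "\<And>t t'. t \<in> G \<Longrightarrow> t' \<in> G \<Longrightarrow> card J < 16 * hamming J t t' \<Longrightarrow> nuclear_ge m n r \<gamma> (\<lambda>i. \<theta> t i - \<theta> t' i)"
    using packing unfolding packing_def by simp_all
  obtain \<theta>0 where \<theta>0: "\<And>t. t \<in> G \<Longrightarrow> (\<Sum>ij\<in>{..<m} \<times> {..<n}. (\<theta> t ij - \<theta>0 ij)\<^sup>2) \<le> \<rho>"
    using packing unfolding packing_def by blast
  obtain K where K: "K > 0" "\<And>t. t \<in> G \<Longrightarrow> card {t' \<in> G. 16 * hamming J t t' \<le> card J} \<le> K"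
    "2 * K \<le> card G" "16 * real K * (exp (real (card J) * ln (real h) / 40) - 1) \<le> card G"
    using hamming_overlap[OF J h G large] by blast
  have fin: "finite G"
    using G finite_words[OF J(1)] by (rule finite_subset)
  show ?thesis
  proof (rule minimax_risk_lower_bound[OF assms(1-5) fin, where \<theta> = \<theta> and ?\<theta>0.0 = \<theta>0
        and w = "exp (real (card J) * ln (real h) / 40)" and K = K])
    show "G \<noteq> {}"
      using large h by auto
    show "exp ((\<Sum>ij\<in>{..<m} \<times> {..<n}. (\<theta> t ij - \<theta>0 ij)\<^sup>2) / \<sigma>\<^sup>2) \<le> exp (real (card J) * ln (real h) / 40)"
      if "t \<in> G" for t
      using \<theta>0[OF that] \<rho> \<open>\<sigma> > 0\<close> by (simp add: divide_le_eq mult.commute order_trans)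
    show "card {t' \<in> G. \<not> nuclear_ge m n r \<gamma> (\<lambda>i. \<theta> t i - \<theta> t' i)} \<le> K" if t: "t \<in> G" for t
    proof -
      have "card {t' \<in> G. \<not> nuclear_ge m n r \<gamma> (\<lambda>i. \<theta> t i - \<theta> t' i)} \<le>
          card {t' \<in> G. 16 * hamming J t t' \<le> card J}"
        using fin sep[OF t] by (intro card_mono) (auto simp: not_le[symmetric])
      then show ?thesis
        using K(2)[OF t] by simp
    qed
  qed (use F K in auto)
qed

lemma dual_pairing_swap:
  "dual_pairing n m r y x (\<lambda>(b, a). D (a, b)) = dual_pairing m n r x y D"
  unfolding dual_pairing_def by (rule sum.cong[OF refl], subst sum.swap) (simp add: mult_ac)

lemma packing_transpose:
  assumes "packing n m r (sparse_svd_class n m l k r d \<kappa>) \<gamma> \<rho> J h G \<theta>" and "d > 0"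
  shows "packing m n r (sparse_svd_class m n k l r d \<kappa>) \<gamma> \<rho> J h G (\<lambda>t (a, b). \<theta> t (b, a))"
proof -
  have "Matrix.mat m n (\<lambda>(a, b). \<theta> t (b, a)) \<in> sparse_svd_class m n k l r d \<kappa>" if "t \<in> G" for t
  proof -
    have "Matrix.mat n m (\<theta> t) \<in> sparse_svd_class n m l k r d \<kappa>"
      using assms(1) that unfolding packing_def by blast
    from sparse_svd_class_transpose[OF this \<open>d > 0\<close>]
    show ?thesis
      by (rule back_subst[of "\<lambda>M. M \<in> _"]) (intro eq_matI, auto)
  qed
  moreover obtain \<theta>0 where \<theta>0: "\<And>t. t \<in> G \<Longrightarrow> (\<Sum>ij\<in>{..<n} \<times> {..<m}. (\<theta> t ij - \<theta>0 ij)\<^sup>2) \<le> \<rho>"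
    using assms(1) unfolding packing_def by blast
  have "(\<Sum>ij\<in>{..<m} \<times> {..<n}. ((case ij of (a, b) \<Rightarrow> \<theta> t (b, a)) - (case ij of (a, b) \<Rightarrow> \<theta>0 (b, a)))\<^sup>2) =
      (\<Sum>ij\<in>{..<n} \<times> {..<m}. (\<theta> t ij - \<theta>0 ij)\<^sup>2)" for t
    by (rule sum.reindex_bij_witness[of _ prod.swap prod.swap]) auto
  then have "\<exists>\<theta>0. \<forall>t\<in>G. (\<Sum>ij\<in>{..<m} \<times> {..<n}. ((case ij of (a, b) \<Rightarrow> \<theta> t (b, a)) - \<theta>0 ij)\<^sup>2) \<le> \<rho>"
    using \<theta>0 by (intro exI[of _ "\<lambda>(a, b). \<theta>0 (b, a)"]) simp
  moreover have "nuclear_ge m n r \<gamma> (\<lambda>i. (case i of (a, b) \<Rightarrow> \<theta> t (b, a)) - (case i of (a, b) \<Rightarrow> \<theta> t' (b, a)))"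
    if nuc: "nuclear_ge n m r \<gamma> (\<lambda>i. \<theta> t i - \<theta> t' i)" for t t'
  proof -
    obtain x y where xy: "suborthonormal r n x" "suborthonormal r m y"
      "\<gamma> \<le> dual_pairing n m r x y (\<lambda>i. \<theta> t i - \<theta> t' i)"
      using nuc unfolding nuclear_ge_def by blast
    have "dual_pairing m n r y x (\<lambda>i. (case i of (a, b) \<Rightarrow> \<theta> t (b, a)) - (case i of (a, b) \<Rightarrow> \<theta> t' (b, a))) =
        dual_pairing m n r y x (\<lambda>(a, b). \<theta> t (b, a) - \<theta> t' (b, a))"
      by (rule dual_pairing_cong) simp
    also have "\<dots> = dual_pairing n m r x y (\<lambda>i. \<theta> t i - \<theta> t' i)"
      by (rule dual_pairing_swap)
    finally show ?thesis
      unfolding nuclear_ge_def using xy by (intro exI[of _ y] exI[of _ x]) simp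
  qed
  ultimately show ?thesis
    using assms(1) unfolding packing_def by auto
qed

section \<open>Sign matrices\<close>

definition stacked :: "real \<Rightarrow> nat \<Rightarrow> (nat \<Rightarrow> nat \<Rightarrow> real) \<Rightarrow> nat \<times> nat \<Rightarrow> real" where
  "stacked d r B = (\<lambda>(a, b). if b < r then if a < r then if a = b then d else 0 else B a b else 0)"

lemma sum_lessThan_split:
  fixes f :: "nat \<Rightarrow> real"
  assumes "r \<le> m"
  shows "(\<Sum>a<m. f a) = (\<Sum>a<r. f a) + (\<Sum>a=r..<m. f a)"
  using assms by (simp add: lessThan_atLeast0 sum.atLeastLessThan_concat)

text \<open>The quadratic form of the Gram matrix is \<open>d\<^sup>2 * ip r x x\<close> plus that
  of the lower block, and the Cauchy-Schwarz inequality in each row bounds the latter by the squared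
  Frobenius norm of \<open>B\<close>.\<close>

lemma stacked_in_class:
  assumes "d > 0" "\<kappa> > 0" "r \<le> n" "r \<le> l" "r \<le> m" "r \<le> k"
    and frob: "(\<Sum>a=r..<m. \<Sum>b<r. (B a b)\<^sup>2) \<le> (\<kappa>\<^sup>2 - 1) * d\<^sup>2"
    and supp: "card {a \<in> {r..<m}. \<exists>b<r. B a b \<noteq> 0} \<le> k - r"
  shows "Matrix.mat m n (stacked d r B) \<in> sparse_svd_class m n k l r d \<kappa>"
proof -
  define L where "L a b = (if a < r then if a = b then d else 0 else B a b)" for a b
  define Y where "Y x = (\<lambda>a. \<Sum>j<r. L a j * x j)" for x
  have norm: "ip m (Y x) (Y x) = d\<^sup>2 * ip r x x + (\<Sum>a=r..<m. (\<Sum>j<r. B a j * x j)\<^sup>2)" for x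
  proof -
    have "(\<Sum>a<r. Y x a * Y x a) = (\<Sum>a<r. (d * x a) * (d * x a))"
    proof (intro sum.cong refl)
      fix a assume "a \<in> {..<r}"
      then have "Y x a = d * x a"
        by (simp add: Y_def L_def if_distrib[of "\<lambda>z. z * _"] cong: if_cong)
      then show "Y x a * Y x a = (d * x a) * (d * x a)"
        by simp
    qed
    moreover have "(\<Sum>a=r..<m. Y x a * Y x a) = (\<Sum>a=r..<m. (\<Sum>j<r. B a j * x j)\<^sup>2)"
      by (intro sum.cong) (auto simp: Y_def L_def power2_eq_square)
    ultimately show ?thesis
      unfolding ip_def sum_lessThan_split[OF \<open>r \<le> m\<close>]
      by (simp add: sum_distrib_left power2_eq_square mult_ac)
  qed
  have low: "d\<^sup>2 * ip r x x \<le> ip m (Y x) (Y x)" for x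
    unfolding norm by (simp add: sum_nonneg)
  have up: "ip m (Y x) (Y x) \<le> (\<kappa> * d)\<^sup>2 * ip r x x" for x
  proof -
    have x0: "ip r x x \<ge> 0"
      unfolding ip_def by (intro sum_nonneg) auto
    have "(\<Sum>a=r..<m. (\<Sum>j<r. B a j * x j)\<^sup>2) \<le> (\<Sum>a=r..<m. (\<Sum>j<r. (B a j)\<^sup>2) * ip r x x)"
      unfolding ip_def power2_eq_square[of "x _", symmetric] by (intro sum_mono Cauchy_Schwarz_ineq_sum)
    also have "\<dots> = (\<Sum>a=r..<m. \<Sum>j<r. (B a j)\<^sup>2) * ip r x x"
      by (simp add: sum_distrib_right)
    also have "\<dots> \<le> (\<kappa>\<^sup>2 - 1) * d\<^sup>2 * ip r x x"
      by (rule mult_right_mono[OF frob x0])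
    finally show ?thesis
      unfolding norm by (simp add: algebra_simps power_mult_distrib)
  qed
  have "{a. a < m \<and> (\<exists>j<r. L a j \<noteq> 0)} \<subseteq> {..<r} \<union> {a \<in> {r..<m}. \<exists>b<r. B a b \<noteq> 0}"
    by (auto simp: L_def)
  then have "card {a. a < m \<and> (\<exists>j<r. L a j \<noteq> 0)} \<le> card ({..<r} \<union> {a \<in> {r..<m}. \<exists>b<r. B a b \<noteq> 0})"
    by (intro card_mono) auto
  also have "\<dots> \<le> card {..<r} + card {a \<in> {r..<m}. \<exists>b<r. B a b \<noteq> 0}"
    by (rule card_Un_le)
  also have "\<dots> \<le> k"
    using supp \<open>r \<le> k\<close> by simp
  finally have "card {a. a < m \<and> (\<exists>j<r. L a j \<noteq> 0)} \<le> k" .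
  from tall_matrix_in_class[OF low[unfolded Y_def] up[unfolded Y_def] assms(1-4) this]
  show ?thesis
    by (rule back_subst[of "\<lambda>M. M \<in> _"]) (intro eq_matI, auto simp: L_def stacked_def)
qed

lemma stacked_radius:
  assumes "r \<le> n"
  shows "(\<Sum>ij\<in>{..<m} \<times> {..<n}. (stacked d r B ij - stacked d r (\<lambda>_ _. 0) ij)\<^sup>2) =
    (\<Sum>a=r..<m. \<Sum>b<r. (B a b)\<^sup>2)"
proof -
  have "(\<Sum>ij\<in>{..<m} \<times> {..<n}. (stacked d r B ij - stacked d r (\<lambda>_ _. 0) ij)\<^sup>2) =
      (\<Sum>a<m. \<Sum>b<n. (stacked d r B (a, b) - stacked d r (\<lambda>_ _. 0) (a, b))\<^sup>2)"
    unfolding sum.cartesian_product by (simp add: case_prod_beta)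
  also have "\<dots> = (\<Sum>a<m. \<Sum>b<r. if r \<le> a then (B a b)\<^sup>2 else 0)"
    using assms by (intro sum.cong refl sum.mono_neutral_cong_right) (auto simp: stacked_def)
  also have "\<dots> = (\<Sum>a=r..<m. \<Sum>b<r. (B a b)\<^sup>2)"
    by (intro sum.mono_neutral_cong_right) auto
  finally show ?thesis .
qed

lemma sum_shifted_rows:
  fixes f :: "nat \<Rightarrow> real"
  assumes "r + p \<le> m" "\<And>a. a \<ge> r + p \<Longrightarrow> f a = 0"
  shows "(\<Sum>a=r..<m. f a) = (\<Sum>i<p. f (r + i))"
proof -
  have "(\<Sum>a=r..<m. f a) = (\<Sum>a=r..<r + p. f a)"
    using assms by (intro sum.mono_neutral_right) auto
  also have "\<dots> = (\<Sum>i<p. f (r + i))"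
    using sum.shift_bounds_nat_ivl[of f 0 r p] by (simp add: lessThan_atLeast0 add.commute)
  finally show ?thesis .
qed

section \<open>Nuclear norms from second and fourth moments of singular values\<close>

lemma eigensystem_Parseval:
  assumes "eigensystem n G v e"
  shows "(\<Sum>j<n. (\<Sum>b<n. f b * v j b)\<^sup>2) = (\<Sum>b<n. (f b)\<^sup>2)"
proof -
  have "(\<Sum>j<n. (\<Sum>b<n. f b * v j b)\<^sup>2) = (\<Sum>j<n. \<Sum>b<n. \<Sum>c<n. f b * f c * (v j b * v j c))"
    unfolding power2_eq_square sum_product by (simp add: mult_ac)
  also have "\<dots> = (\<Sum>b<n. \<Sum>j<n. \<Sum>c<n. f b * f c * (v j b * v j c))"
    by (rule sum.swap)
  also have "\<dots> = (\<Sum>b<n. \<Sum>c<n. \<Sum>j<n. f b * f c * (v j b * v j c))"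
    by (intro sum.cong refl sum.swap)
  also have "\<dots> = (\<Sum>b<n. \<Sum>c<n. f b * f c * (if b = c then 1 else 0))"
    unfolding sum_distrib_left[symmetric]
    by (intro sum.cong refl) (simp add: eigensystemD(2)[OF assms])
  also have "\<dots> = (\<Sum>b<n. (f b)\<^sup>2)"
    by (intro sum.cong refl) (simp add: if_distrib[of "\<lambda>x. _ * x"] power2_eq_square cong: if_cong)
  finally show ?thesis .
qed

text \<open>
  With singular values \<open>s\<close>, this is the sum of the pointwise bounds
  \<open>s \<ge> 2 (\<alpha> s\<^sup>2 - \<alpha>\<^sup>3 s\<^sup>4)\<close>.
\<close>

lemma nuclear_ge_moments:
  fixes D :: "nat \<times> nat \<Rightarrow> real"
  assumes "r \<le> n" "\<alpha> > 0" and zero: "\<And>a b. b \<ge> r \<Longrightarrow> D (a, b) = 0"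
  shows "nuclear_ge m n r (2 * (\<alpha> * (\<Sum>a<m. \<Sum>b<r. (D (a, b))\<^sup>2) -
    \<alpha> ^ 3 * (\<Sum>b<r. \<Sum>c<r. (\<Sum>a<m. D (a, b) * D (a, c))\<^sup>2))) D"
proof -
  obtain u s v where svd: "svd_system m r (\<lambda>a b. D (a, b)) u s v"
    using svd_exists by blast
  then have u: "suborthonormal r m u" and v: "suborthonormal r r v"
    and es: "eigensystem r (\<lambda>a b. \<Sum>c<m. D (c, a) * D (c, b)) v (\<lambda>i. (s i)\<^sup>2)"
    and s0: "\<And>i. i < r \<Longrightarrow> s i \<ge> 0"
    and u1: "\<And>i. i < r \<Longrightarrow> s i \<noteq> 0 \<Longrightarrow> ip m (u i) (u i) = 1"
    and Dv: "\<And>i c. i < r \<Longrightarrow> c < m \<Longrightarrow> (\<Sum>b<r. D (c, b) * v i b) = s i * u i c"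
    unfolding svd_system_def by simp_all
  note on = eigensystemD(1)[OF es] and eig = eigensystemD(3)[OF es]
  have suu: "(s j)\<^sup>2 * ip m (u j) (u j) = (s j)\<^sup>2" "s j * ip m (u j) (u j) = s j" if "j < r" for j
    using u1[OF that] by (cases "s j = 0"; simp)+
  have F2: "(\<Sum>a<m. \<Sum>b<r. (D (a, b))\<^sup>2) = (\<Sum>j<r. (s j)\<^sup>2)"
  proof -
    have "(\<Sum>a<m. \<Sum>b<r. (D (a, b))\<^sup>2) = (\<Sum>a<m. \<Sum>j<r. (\<Sum>b<r. D (a, b) * v j b)\<^sup>2)"
      unfolding eigensystem_Parseval[OF es] ..
    also have "\<dots> = (\<Sum>j<r. \<Sum>a<m. (\<Sum>b<r. D (a, b) * v j b)\<^sup>2)"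
      by (rule sum.swap)
    also have "\<dots> = (\<Sum>j<r. \<Sum>a<m. (s j)\<^sup>2 * (u j a * u j a))"
      by (intro sum.cong refl) (simp add: Dv power2_eq_square)
    also have "\<dots> = (\<Sum>j<r. (s j)\<^sup>2)"
      by (intro sum.cong refl, subst sum_distrib_left[symmetric], subst ip_def[symmetric]) (simp add: suu)
    finally show ?thesis .
  qed
  have F4: "(\<Sum>b<r. \<Sum>c<r. (\<Sum>a<m. D (a, b) * D (a, c))\<^sup>2) = (\<Sum>j<r. (s j) ^ 4)"
  proof -
    have "(\<Sum>b<r. \<Sum>c<r. (\<Sum>a<m. D (a, b) * D (a, c))\<^sup>2) =
        (\<Sum>b<r. \<Sum>j<r. (\<Sum>c<r. (\<Sum>a<m. D (a, b) * D (a, c)) * v j c)\<^sup>2)"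
      unfolding eigensystem_Parseval[OF es] ..
    also have "\<dots> = (\<Sum>b<r. \<Sum>j<r. ((s j)\<^sup>2 * v j b)\<^sup>2)"
      by (intro sum.cong refl arg_cong[of _ _ "\<lambda>x. x\<^sup>2"] eig) auto
    also have "\<dots> = (\<Sum>j<r. \<Sum>b<r. (s j) ^ 4 * (v j b * v j b))"
      by (subst sum.swap) (simp add: power_mult_distrib power2_eq_square power4_eq_xxxx mult_ac)
    also have "\<dots> = (\<Sum>j<r. (s j) ^ 4)"
      by (intro sum.cong refl, subst sum_distrib_left[symmetric], subst ip_def[symmetric]) (simp add: on)
    finally show ?thesis .
  qed
  have pointwise: "2 * (\<alpha> * x\<^sup>2 - \<alpha> ^ 3 * x ^ 4) \<le> x" if "x \<ge> 0" for x
  proof -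
    define z where "z = \<alpha> * x"
    have "z \<ge> 0"
      using that \<open>\<alpha> > 0\<close> by (simp add: z_def)
    \<comment> \<open>A certificate for \<open>2 * (z - z ^ 3) \<le> 289 / 375 < 1\<close> on
      nonnegative \<open>z\<close>: 3/5 is close to the maximizer \<open>1 / sqrt 3\<close>, and the
      second square absorbs the remaining quadratic and linear terms.\<close>
    have "2 * z * (z - 3 / 5)\<^sup>2 + 12 / 5 * (z - 17 / 30)\<^sup>2 \<ge> 0"
      using \<open>z \<ge> 0\<close> by simp
    moreover have "2 * z * (z - 3 / 5)\<^sup>2 + 12 / 5 * (z - 17 / 30)\<^sup>2 = 2 * z ^ 3 - 2 * z + 289 / 375"
      by (simp add: power2_eq_square power3_eq_cube field_simps)
    ultimately have "0 \<le> 2 * z ^ 3 - 2 * z + 289 / 375"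
      by simp
    moreover have "2 * (z - z ^ 3) = 2 * z - 2 * z ^ 3"
      by (simp add: algebra_simps)
    ultimately have "2 * (z - z ^ 3) \<le> 1"
      by linarith
    then have "x * (2 * (z - z ^ 3)) \<le> x * 1"
      using that by (rule mult_left_mono)
    then show ?thesis
      by (simp add: z_def power2_eq_square power3_eq_cube power4_eq_xxxx algebra_simps)
  qed
  define y where "y j b = (if b < r then v j b else 0)" for j b
  have ip_y: "(\<Sum>b<n. f b * y j b) = (\<Sum>b<r. f b * v j b)" for f j
    unfolding y_def using \<open>r \<le> n\<close> by (intro sum.mono_neutral_cong_right) auto
  have "ip n (y i) (y j) = ip r (v i) (v j)" for i j
    unfolding ip_def ip_y by (intro sum.cong) (auto simp: y_def)
  then have y: "suborthonormal r n y"
    using v by (simp add: suborthonormal_def)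
  have "dual_pairing m n r u y D = (\<Sum>j<r. \<Sum>a<m. u j a * (\<Sum>b<n. D (a, b) * y j b))"
    unfolding dual_pairing_def by (simp add: sum_distrib_left mult.assoc)
  also have "\<dots> = (\<Sum>j<r. \<Sum>a<m. s j * (u j a * u j a))"
    unfolding ip_y by (intro sum.cong refl) (simp add: Dv)
  also have "\<dots> = (\<Sum>j<r. s j)"
    by (intro sum.cong refl, subst sum_distrib_left[symmetric], subst ip_def[symmetric]) (simp add: suu)
  finally have "dual_pairing m n r u y D = (\<Sum>j<r. s j)" .
  moreover have "2 * (\<alpha> * (\<Sum>j<r. (s j)\<^sup>2) - \<alpha> ^ 3 * (\<Sum>j<r. s j ^ 4)) \<le> (\<Sum>j<r. s j)"
  proof -
    have "2 * (\<alpha> * (\<Sum>j<r. (s j)\<^sup>2) - \<alpha> ^ 3 * (\<Sum>j<r. s j ^ 4)) =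
        (\<Sum>j<r. 2 * (\<alpha> * (s j)\<^sup>2 - \<alpha> ^ 3 * s j ^ 4))"
      by (simp add: sum_distrib_left sum_subtractf)
    also have "\<dots> \<le> (\<Sum>j<r. s j)"
      by (rule sum_mono, rule pointwise) (simp add: s0)
    finally show ?thesis .
  qed
  ultimately show ?thesis
    unfolding nuclear_ge_def F2 F4 using u y by (intro exI[of _ u] exI[of _ y]) simp
qed

text \<open>Rewrites the squared Frobenius norm of \<open>A\<^sup>T C\<close> as the inner product
  of \<open>A A\<^sup>T\<close> and \<open>C C\<^sup>T\<close>, where \<open>A\<close> and
  \<open>C\<close> sit in different factors and can be decoupled.\<close>

lemma Gram_square_swap:
  fixes A C :: "nat \<Rightarrow> nat \<Rightarrow> real"
  shows "(\<Sum>j<r. \<Sum>k<r. (\<Sum>i<p. A i j * C i k)\<^sup>2) =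
    (\<Sum>i<p. \<Sum>l<p. (\<Sum>j<r. A i j * A l j) * (\<Sum>k<r. C i k * C l k))"
proof -
  have "(\<Sum>j<r. \<Sum>k<r. (\<Sum>i<p. A i j * C i k)\<^sup>2) =
      (\<Sum>j<r. \<Sum>k<r. \<Sum>i<p. \<Sum>l<p. (A i j * A l j) * (C i k * C l k))"
    unfolding power2_eq_square sum_product by (simp add: mult_ac)
  also have "\<dots> = (\<Sum>j<r. \<Sum>i<p. \<Sum>k<r. \<Sum>l<p. (A i j * A l j) * (C i k * C l k))"
    by (intro sum.cong refl sum.swap)
  also have "\<dots> = (\<Sum>i<p. \<Sum>j<r. \<Sum>k<r. \<Sum>l<p. (A i j * A l j) * (C i k * C l k))"
    by (rule sum.swap)
  also have "\<dots> = (\<Sum>i<p. \<Sum>j<r. \<Sum>l<p. \<Sum>k<r. (A i j * A l j) * (C i k * C l k))"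
    by (intro sum.cong refl sum.swap)
  also have "\<dots> = (\<Sum>i<p. \<Sum>l<p. \<Sum>j<r. \<Sum>k<r. (A i j * A l j) * (C i k * C l k))"
    by (intro sum.cong refl sum.swap)
  also have "\<dots> = (\<Sum>i<p. \<Sum>l<p. (\<Sum>j<r. A i j * A l j) * (\<Sum>k<r. C i k * C l k))"
    unfolding sum_product ..
  finally show ?thesis .
qed

text \<open>The Gram matrix of \<open>A - C\<close> has four terms. \<open>Gram_square_swap\<close>
  and the inequality between arithmetic and geometric mean reduce the mixed ones to the pure ones.
  Squaring a sum of four terms costs a factor 4, and there are four of them, hence 16.\<close>

lemma fourth_moment_diff:
  fixes A C :: "nat \<Rightarrow> nat \<Rightarrow> real"
  assumes A: "(\<Sum>j<r. \<Sum>k<r. (\<Sum>i<p. A i j * A i k)\<^sup>2) \<le> Q"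
    and C: "(\<Sum>j<r. \<Sum>k<r. (\<Sum>i<p. C i j * C i k)\<^sup>2) \<le> Q"
  shows "(\<Sum>j<r. \<Sum>k<r. (\<Sum>i<p. (A i j - C i j) * (A i k - C i k))\<^sup>2) \<le> 16 * Q"
proof -
  have mixed: "(\<Sum>j<r. \<Sum>k<r. (\<Sum>i<p. A i j * C i k)\<^sup>2) \<le> Q"
  proof -
    have "(\<Sum>j<r. \<Sum>k<r. (\<Sum>i<p. A i j * C i k)\<^sup>2) \<le>
        (\<Sum>i<p. \<Sum>l<p. ((\<Sum>j<r. A i j * A l j)\<^sup>2 + (\<Sum>k<r. C i k * C l k)\<^sup>2) / 2)"
      unfolding Gram_square_swap
    proof (intro sum_mono)
      show "(\<Sum>j<r. A i j * A l j) * (\<Sum>k<r. C i k * C l k) \<le>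
          ((\<Sum>j<r. A i j * A l j)\<^sup>2 + (\<Sum>k<r. C i k * C l k)\<^sup>2) / 2" for i l
        using sum_squares_bound[of "\<Sum>j<r. A i j * A l j" "\<Sum>k<r. C i k * C l k"] by simp
    qed
    also have "\<dots> = ((\<Sum>j<r. \<Sum>k<r. (\<Sum>i<p. A i j * A i k)\<^sup>2) + (\<Sum>j<r. \<Sum>k<r. (\<Sum>i<p. C i j * C i k)\<^sup>2)) / 2"
    proof -
      have "(\<Sum>i<p. \<Sum>l<p. ((\<Sum>j<r. A i j * A l j)\<^sup>2 + (\<Sum>k<r. C i k * C l k)\<^sup>2) / 2) =
          ((\<Sum>i<p. \<Sum>l<p. (\<Sum>j<r. A i j * A l j) * (\<Sum>j<r. A i j * A l j)) +
           (\<Sum>i<p. \<Sum>l<p. (\<Sum>k<r. C i k * C l k) * (\<Sum>k<r. C i k * C l k))) / 2"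
        unfolding power2_eq_square by (simp only: sum.distrib[symmetric] sum_divide_distrib)
      then show ?thesis
        unfolding Gram_square_swap .
    qed
    finally show ?thesis
      using A C by simp
  qed
  have mixed': "(\<Sum>j<r. \<Sum>k<r. (\<Sum>i<p. C i j * A i k)\<^sup>2) \<le> Q"
  proof -
    have "(\<Sum>j<r. \<Sum>k<r. (\<Sum>i<p. C i j * A i k)\<^sup>2) = (\<Sum>j<r. \<Sum>k<r. (\<Sum>i<p. A i j * C i k)\<^sup>2)"
      by (subst sum.swap) (simp add: mult.commute)
    then show ?thesis
      using mixed by simp
  qed
  have four: "(x - y - z + w)\<^sup>2 \<le> 4 * x\<^sup>2 + 4 * y\<^sup>2 + 4 * z\<^sup>2 + 4 * w\<^sup>2" for x y z w :: real
  proof -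
    have "4 * x\<^sup>2 + 4 * y\<^sup>2 + 4 * z\<^sup>2 + 4 * w\<^sup>2 - (x - y - z + w)\<^sup>2 =
        (x + y)\<^sup>2 + (x + z)\<^sup>2 + (x - w)\<^sup>2 + (y - z)\<^sup>2 + (y + w)\<^sup>2 + (z + w)\<^sup>2"
      by (simp add: power2_eq_square algebra_simps)
    also have "\<dots> \<ge> 0"
      by simp
    finally show ?thesis
      by linarith
  qed
  have "(\<Sum>j<r. \<Sum>k<r. (\<Sum>i<p. (A i j - C i j) * (A i k - C i k))\<^sup>2) =
      (\<Sum>j<r. \<Sum>k<r. ((\<Sum>i<p. A i j * A i k) - (\<Sum>i<p. A i j * C i k) - (\<Sum>i<p. C i j * A i k)
        + (\<Sum>i<p. C i j * C i k))\<^sup>2)"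
    unfolding sum_subtractf[symmetric] sum.distrib[symmetric] by (simp add: algebra_simps)
  also have "\<dots> \<le> (\<Sum>j<r. \<Sum>k<r. 4 * (\<Sum>i<p. A i j * A i k)\<^sup>2 + 4 * (\<Sum>i<p. A i j * C i k)\<^sup>2
      + 4 * (\<Sum>i<p. C i j * A i k)\<^sup>2 + 4 * (\<Sum>i<p. C i j * C i k)\<^sup>2)"
    by (intro sum_mono four)
  also have "\<dots> = 4 * (\<Sum>j<r. \<Sum>k<r. (\<Sum>i<p. A i j * A i k)\<^sup>2) + 4 * (\<Sum>j<r. \<Sum>k<r. (\<Sum>i<p. A i j * C i k)\<^sup>2)
      + 4 * (\<Sum>j<r. \<Sum>k<r. (\<Sum>i<p. C i j * A i k)\<^sup>2) + 4 * (\<Sum>j<r. \<Sum>k<r. (\<Sum>i<p. C i j * C i k)\<^sup>2)"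
    by (simp only: sum.distrib sum_distrib_left)
  finally show ?thesis
    using A C mixed mixed' by linarith
qed

section \<open>Balanced sign matrices\<close>

definition sign_of :: "nat \<Rightarrow> real" where
  "sign_of a = (if a = 0 then -1 else 1)"

lemma sign_of_square [simp]: "sign_of a * sign_of a = 1" "(sign_of a)\<^sup>2 = 1"
  by (auto simp: sign_of_def)

text \<open>Flipping the letter at \<open>i0\<close> is an involution of the words that reverses the
  sign of every summand.\<close>

lemma sum_signs_cancel:
  fixes g :: "('j \<Rightarrow> nat) \<Rightarrow> real"
  assumes "i0 \<in> J" and g: "\<And>t z. g (t(i0 := z)) = g t"
  shows "(\<Sum>t\<in>words J 2. sign_of (t i0) * g t) = 0"
proof -
  define \<phi> where "\<phi> t = t(i0 := 1 - t i0)" for t :: "'j \<Rightarrow> nat"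
  have \<phi>: "\<phi> t \<in> words J 2" "\<phi> (\<phi> t) = t" "sign_of (\<phi> t i0) = - sign_of (t i0)" "g (\<phi> t) = g t"
    if "t \<in> words J 2" for t
  proof -
    have "t i0 < 2"
      using that \<open>i0 \<in> J\<close> by (auto simp: words_def)
    then show "\<phi> t \<in> words J 2" "\<phi> (\<phi> t) = t" "sign_of (\<phi> t i0) = - sign_of (t i0)"
      using that \<open>i0 \<in> J\<close> by (auto simp: \<phi>_def words_def PiE_iff extensional_def sign_of_def fun_eq_iff)
    show "g (\<phi> t) = g t"
      unfolding \<phi>_def by (rule g)
  qed
  have "(\<Sum>t\<in>words J 2. sign_of (t i0) * g t) = (\<Sum>t\<in>words J 2. sign_of (\<phi> t i0) * g (\<phi> t))"
    by (rule sum.reindex_bij_witness[of _ \<phi> \<phi>]) (auto simp: \<phi>)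
  also have "\<dots> = - (\<Sum>t\<in>words J 2. sign_of (t i0) * g t)"
    unfolding sum_negf[symmetric] by (intro sum.cong refl) (simp add: \<phi>)
  finally show ?thesis
    by simp
qed

text \<open>The squared Frobenius norm of the Gram matrix of a sign matrix, that is, the sum of the
  fourth powers of its singular values.\<close>

definition fourth_moment :: "nat \<Rightarrow> nat \<Rightarrow> (nat \<times> nat \<Rightarrow> nat) \<Rightarrow> real" where
  "fourth_moment p r t = (\<Sum>j<r. \<Sum>k<r. (\<Sum>i<p. sign_of (t (i, j)) * sign_of (t (i, k)))\<^sup>2)"

text \<open>The diagonal entries of the Gram matrix are \<open>p\<close> and contribute
  \<open>r * p\<^sup>2\<close>. Off the diagonal a product of four signs averages to 0 unless its
  two rows coincide, which leaves \<open>p\<close> per entry and at most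
  \<open>r\<^sup>2 * p \<le> r * p\<^sup>2\<close> in total.\<close>

lemma sum_fourth_moment:
  assumes "r \<le> p"
  shows "(\<Sum>t\<in>words ({..<p} \<times> {..<r}) 2. fourth_moment p r t) \<le> 2 * real p ^ 2 * real r * 2 ^ (p * r)"
proof -
  define W where "W = words ({..<p} \<times> {..<r}) 2"
  have cardW: "real (card W) = 2 ^ (p * r)"
    unfolding W_def by (subst card_words) auto
  have off: "(\<Sum>t\<in>W. (\<Sum>i<p. sign_of (t (i, j)) * sign_of (t (i, k)))\<^sup>2) = real p * 2 ^ (p * r)"
    if "j < r" "k < r" "j \<noteq> k" for j k
  proof -
    have "(\<Sum>t\<in>W. (\<Sum>i<p. sign_of (t (i, j)) * sign_of (t (i, k)))\<^sup>2) =
        (\<Sum>t\<in>W. \<Sum>i<p. \<Sum>l<p. sign_of (t (i, j)) * (sign_of (t (i, k)) * sign_of (t (l, j)) * sign_of (t (l, k))))"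
      unfolding power2_eq_square sum_product by (simp add: mult_ac)
    also have "\<dots> = (\<Sum>i<p. \<Sum>t\<in>W. \<Sum>l<p. sign_of (t (i, j)) * (sign_of (t (i, k)) * sign_of (t (l, j)) * sign_of (t (l, k))))"
      by (rule sum.swap)
    also have "\<dots> = (\<Sum>i<p. \<Sum>l<p. \<Sum>t\<in>W. sign_of (t (i, j)) * (sign_of (t (i, k)) * sign_of (t (l, j)) * sign_of (t (l, k))))"
      by (intro sum.cong refl sum.swap)
    also have "\<dots> = (\<Sum>i<p. \<Sum>l<p. if i = l then 2 ^ (p * r) else 0)"
    proof (intro sum.cong refl)
      fix i l assume "i \<in> {..<p}" "l \<in> {..<p}"
      show "(\<Sum>t\<in>W. sign_of (t (i, j)) * (sign_of (t (i, k)) * sign_of (t (l, j)) * sign_of (t (l, k)))) =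
          (if i = l then 2 ^ (p * r) else 0)"
      proof (cases "i = l")
        case True
        have "sign_of (t (l, j)) * (sign_of (t (l, k)) * sign_of (t (l, j)) * sign_of (t (l, k))) = 1" for t
          by (auto simp: sign_of_def)
        then show ?thesis
          using True cardW by simp
      next
        case False
        have "(\<Sum>t\<in>W. sign_of (t (i, j)) * (sign_of (t (i, k)) * sign_of (t (l, j)) * sign_of (t (l, k)))) = 0"
          unfolding W_def
          by (rule sum_signs_cancel) (use that False \<open>i \<in> {..<p}\<close> in auto)
        then show ?thesis
          using False by simp
      qed
    qed
    also have "\<dots> = real p * 2 ^ (p * r)"
      by simp
    finally show ?thesis .
  qed
  have "(\<Sum>t\<in>W. fourth_moment p r t) =
      (\<Sum>j<r. \<Sum>t\<in>W. \<Sum>k<r. (\<Sum>i<p. sign_of (t (i, j)) * sign_of (t (i, k)))\<^sup>2)"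
    unfolding fourth_moment_def by (rule sum.swap)
  also have "\<dots> = (\<Sum>j<r. \<Sum>k<r. \<Sum>t\<in>W. (\<Sum>i<p. sign_of (t (i, j)) * sign_of (t (i, k)))\<^sup>2)"
    by (intro sum.cong refl sum.swap)
  also have "\<dots> \<le> (\<Sum>j<r. \<Sum>k<r. (if j = k then real p ^ 2 * 2 ^ (p * r) else 0) + real p * 2 ^ (p * r))"
  proof (intro sum_mono)
    fix j k assume jk: "j \<in> {..<r}" "k \<in> {..<r}"
    show "(\<Sum>t\<in>W. (\<Sum>i<p. sign_of (t (i, j)) * sign_of (t (i, k)))\<^sup>2) \<le>
        (if j = k then real p ^ 2 * 2 ^ (p * r) else 0) + real p * 2 ^ (p * r)"
    proof (cases "j = k")
      case True
      then show ?thesis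
        using cardW by simp
    next
      case False
      then show ?thesis
        using off[of j k] jk by simp
    qed
  qed
  also have "\<dots> = real r * (real p ^ 2 * 2 ^ (p * r)) + real r * real r * (real p * 2 ^ (p * r))"
    by (simp add: sum.distrib distrib_left)
  also have "\<dots> \<le> real r * (real p ^ 2 * 2 ^ (p * r)) + real r * real p * (real p * 2 ^ (p * r))"
    using assms by (intro add_left_mono mult_right_mono mult_left_mono) auto
  also have "\<dots> = 2 * real p ^ 2 * real r * 2 ^ (p * r)"
    by (simp add: power2_eq_square algebra_simps)
  finally show ?thesis
    unfolding W_def .
qed

text \<open>Markov's inequality at four times the mean bound of \<open>sum_fourth_moment\<close>
  discards at most a quarter of the words.\<close>

lemma many_balanced_signs:
  assumes "r \<le> p" "r \<ge> 1"
  shows "3 * 2 ^ (p * r) \<le> 4 * card {t \<in> words ({..<p} \<times> {..<r}) 2. fourth_moment p r t \<le> 8 * real p ^ 2 * real r}"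
proof -
  define W where "W = words ({..<p} \<times> {..<r}) 2"
  define Q where "Q = 8 * real p ^ 2 * real r"
  define G where "G = {t \<in> W. fourth_moment p r t \<le> Q}"
  have "Q > 0"
    using assms by (simp add: Q_def)
  have fin: "finite W"
    unfolding W_def by (intro finite_words) auto
  have cardW: "real (card W) = 2 ^ (p * r)"
    unfolding W_def by (subst card_words) auto
  have "real (card (W - G)) * Q = (\<Sum>t\<in>W - G. Q)"
    by simp
  also have "\<dots> \<le> (\<Sum>t\<in>W - G. fourth_moment p r t)"
    by (intro sum_mono) (auto simp: G_def)
  also have "\<dots> \<le> (\<Sum>t\<in>W. fourth_moment p r t)"
    using fin by (intro sum_mono2) (auto simp: fourth_moment_def intro!: sum_nonneg)
  also have "\<dots> \<le> Q / 4 * 2 ^ (p * r)"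
    using sum_fourth_moment[OF \<open>r \<le> p\<close>] by (simp add: W_def Q_def mult_ac)
  finally have "real (card (W - G)) \<le> 2 ^ (p * r) / 4"
    using \<open>Q > 0\<close> by (simp add: field_simps)
  moreover have "real (card (W - G)) = 2 ^ (p * r) - real (card G)"
  proof -
    have "G \<subseteq> W"
      by (auto simp: G_def)
    then have "card (W - G) = card W - card G" "card G \<le> card W"
      using fin by (auto intro: card_Diff_subset finite_subset card_mono)
    then show ?thesis
      using cardW by (simp add: of_nat_diff)
  qed
  ultimately have "3 * 2 ^ (p * r) \<le> 4 * real (card G)"
    by simp
  then have "real (3 * 2 ^ (p * r)) \<le> real (4 * card G)"
    by simp
  then show ?thesis
    unfolding of_nat_le_iff G_def W_def Q_def .
qed

text \<open>A \<open>p\<close> by \<open>r\<close> sign matrix has squared Frobenius norm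
  \<open>p * r\<close>, so by the Cauchy-Schwarz inequality its fourth moment is at least
  \<open>p\<^sup>2 * r\<close>. Staying within a constant of this minimum keeps the mass from
  concentrating on few singular values. \<open>fourth_moment_diff\<close> hands this on to
  differences, whose Frobenius norm is governed by the Hamming distance.\<close>

lemma dense_packing:
  assumes "r \<ge> 1" "2 * r \<le> k" "k \<le> m" "r \<le> l" "r \<le> n" "d > 0" "\<kappa> > 0" "\<beta> > 0"
    and \<beta>: "\<beta>\<^sup>2 * real ((k - r) * r) \<le> (\<kappa>\<^sup>2 - 1) * d\<^sup>2"
  shows "\<exists>G \<theta>. packing m n r (sparse_svd_class m n k l r d \<kappa>) (\<beta> * real r * sqrt (k - r) / 128)
    (\<beta>\<^sup>2 * real ((k - r) * r)) ({..<k - r} \<times> {..<r}) 2 G \<theta>"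
proof -
  define p where "p = k - r"
  have p: "r \<le> p" "p \<ge> 1" "r + p = k" "r + p \<le> m"
    using assms by (auto simp: p_def)
  define J where "J = {..<p} \<times> {..<r}"
  have J: "finite J" "J \<noteq> {}" "card J = p * r"
    using p \<open>r \<ge> 1\<close> by (auto simp: J_def lessThan_empty_iff)
  define G where "G = {t \<in> words J 2. fourth_moment p r t \<le> 8 * real p ^ 2 * real r}"
  define B where "B t a b = (if a < r + p then \<beta> * sign_of (t (a - r, b)) else 0)" for t :: "nat \<times> nat \<Rightarrow> nat" and a b
  define \<theta> where "\<theta> t = stacked d r (B t)" for t
  note rows = sum_shifted_rows[OF p(4)]
  have frob: "(\<Sum>a=r..<m. \<Sum>b<r. (B t a b)\<^sup>2) = \<beta>\<^sup>2 * real (p * r)" for t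
    by (subst rows) (auto simp: B_def power_mult_distrib)
  have mat: "Matrix.mat m n (\<theta> t) \<in> sparse_svd_class m n k l r d \<kappa>" for t
    unfolding \<theta>_def
  proof (rule stacked_in_class)
    show "(\<Sum>a=r..<m. \<Sum>b<r. (B t a b)\<^sup>2) \<le> (\<kappa>\<^sup>2 - 1) * d\<^sup>2"
      using \<beta> by (simp add: frob p_def)
    have "card {a \<in> {r..<m}. \<exists>b<r. B t a b \<noteq> 0} \<le> card {r..<r + p}"
      by (intro card_mono) (auto simp: B_def split: if_splits)
    then show "card {a \<in> {r..<m}. \<exists>b<r. B t a b \<noteq> 0} \<le> k - r"
      by (simp add: p_def)
  qed (use assms p in auto)
  have radius: "(\<Sum>ij\<in>{..<m} \<times> {..<n}. (\<theta> t ij - stacked d r (\<lambda>_ _. 0) ij)\<^sup>2) = \<beta>\<^sup>2 * real (p * r)" for t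
    unfolding \<theta>_def stacked_radius[OF \<open>r \<le> n\<close>] by (rule frob)
  have sep: "nuclear_ge m n r (\<beta> * real r * sqrt p / 128) (\<lambda>i. \<theta> t i - \<theta> t' i)"
    if t: "t \<in> G" "t' \<in> G" and far: "card J < 16 * hamming J t t'" for t t'
  proof -
    define D where "D = (\<lambda>i. \<theta> t i - \<theta> t' i)"
    define e where "e i j = sign_of (t (i, j)) - sign_of (t' (i, j))" for i j
    have D_eq: "D (a, b) = (if b < r \<and> r \<le> a \<and> a < r + p then \<beta> * e (a - r) b else 0)" for a b
      by (auto simp: D_def \<theta>_def stacked_def B_def e_def algebra_simps)
    have Dsum: "(\<Sum>a<m. f (D (a, b)) (D (a, c))) = (\<Sum>i<p. f (\<beta> * e i b) (\<beta> * e i c))"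
      if "b < r" "c < r" "f 0 0 = 0" for f :: "real \<Rightarrow> real \<Rightarrow> real" and b c
    proof -
      have "(\<Sum>a<m. f (D (a, b)) (D (a, c))) = (\<Sum>a=r..<m. f (D (a, b)) (D (a, c)))"
        by (rule sum.mono_neutral_right) (auto simp: D_eq that)
      also have "\<dots> = (\<Sum>i<p. f (D (r + i, b)) (D (r + i, c)))"
        by (rule rows) (auto simp: D_eq that)
      also have "\<dots> = (\<Sum>i<p. f (\<beta> * e i b) (\<beta> * e i c))"
        using that by (intro sum.cong refl) (simp add: D_eq)
      finally show ?thesis .
    qed
    define ham where "ham = real (hamming J t t')"
    have F2: "(\<Sum>a<m. \<Sum>b<r. (D (a, b))\<^sup>2) = 4 * \<beta>\<^sup>2 * ham"
    proof -
      have "(\<Sum>a<m. \<Sum>b<r. (D (a, b))\<^sup>2) = (\<Sum>b<r. \<Sum>a<m. (D (a, b))\<^sup>2)"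
        by (rule sum.swap)
      also have "\<dots> = (\<Sum>b<r. \<Sum>i<p. (\<beta> * e i b)\<^sup>2)"
        by (intro sum.cong refl Dsum[of _ _ "\<lambda>x y. x\<^sup>2"]) auto
      also have "\<dots> = (\<Sum>i<p. \<Sum>b<r. (\<beta> * e i b)\<^sup>2)"
        by (rule sum.swap)
      also have "\<dots> = (\<Sum>ij\<in>J. if t ij \<noteq> t' ij then 4 * \<beta>\<^sup>2 else 0)"
        unfolding J_def sum.cartesian_product
      proof (rule sum.cong[OF refl])
        fix ij assume "ij \<in> {..<p} \<times> {..<r}"
        then obtain i j where ij: "ij = (i, j)" "i \<in> {..<p}" "j \<in> {..<r}"
          by blast
        have "t \<in> words J 2" "t' \<in> words J 2"
          using t by (auto simp: G_def)
        then have "t (i, j) < 2" "t' (i, j) < 2"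
          using ij by (auto simp: words_def J_def)
        then show "(case ij of (i, b) \<Rightarrow> (\<beta> * e i b)\<^sup>2) = (if t ij \<noteq> t' ij then 4 * \<beta>\<^sup>2 else 0)"
          unfolding ij by (auto simp: e_def sign_of_def power2_eq_square less_2_cases_iff)
      qed
      also have "\<dots> = 4 * \<beta>\<^sup>2 * ham"
        using J(1) by (simp add: sum.If_cases ham_def hamming_def Int_def)
      finally show ?thesis .
    qed
    have F4: "(\<Sum>b<r. \<Sum>c<r. (\<Sum>a<m. D (a, b) * D (a, c))\<^sup>2) \<le> \<beta> ^ 4 * (128 * real p ^ 2 * real r)"
    proof -
      have "(\<Sum>b<r. \<Sum>c<r. (\<Sum>a<m. D (a, b) * D (a, c))\<^sup>2) =
          (\<Sum>b<r. \<Sum>c<r. (\<Sum>i<p. (\<beta> * e i b) * (\<beta> * e i c))\<^sup>2)"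
        by (intro sum.cong refl arg_cong[of _ _ "\<lambda>x. x\<^sup>2"] Dsum[of _ _ "\<lambda>x y. x * y"]) auto
      also have "\<dots> = (\<Sum>b<r. \<Sum>c<r. \<beta> ^ 4 * (\<Sum>i<p. e i b * e i c)\<^sup>2)"
      proof (intro sum.cong refl)
        fix b c
        have "(\<Sum>i<p. (\<beta> * e i b) * (\<beta> * e i c)) = \<beta>\<^sup>2 * (\<Sum>i<p. e i b * e i c)"
          by (simp add: sum_distrib_left power2_eq_square mult_ac)
        then show "(\<Sum>i<p. (\<beta> * e i b) * (\<beta> * e i c))\<^sup>2 = \<beta> ^ 4 * (\<Sum>i<p. e i b * e i c)\<^sup>2"
          by (simp add: power_mult_distrib)
      qed
      also have "\<dots> = \<beta> ^ 4 * (\<Sum>b<r. \<Sum>c<r. (\<Sum>i<p. e i b * e i c)\<^sup>2)"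
        by (simp only: sum_distrib_left)
      also have "(\<Sum>b<r. \<Sum>c<r. (\<Sum>i<p. e i b * e i c)\<^sup>2) \<le> 16 * (8 * real p ^ 2 * real r)"
        unfolding e_def using t by (intro fourth_moment_diff) (auto simp: G_def fourth_moment_def)
      finally show ?thesis
        by (simp add: mult_left_mono)
    qed
    \<comment> \<open>Chosen so that the fourth moment term is at most half of the second moment
      term when the Hamming distance is \<open>p * r / 16\<close>. The remainder
      \<open>\<alpha> * \<beta>\<^sup>2 * p * r / 8\<close>, doubled, is the claimed
      separation.\<close>
    define \<alpha> where "\<alpha> = 1 / (32 * \<beta> * sqrt p)"
    have "\<alpha> > 0"
      using p \<open>\<beta> > 0\<close> by (simp add: \<alpha>_def)
    have zero: "D (a, b) = 0" if "b \<ge> r" for a b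
      using that by (simp add: D_eq)
    have "16 * ham \<ge> real (p * r)"
      using far J(3) unfolding ham_def by linarith
    then have ham: "ham \<ge> real p * real r / 16"
      by simp
    have \<alpha>2: "\<alpha>\<^sup>2 = 1 / (1024 * \<beta>\<^sup>2 * real p)"
      using p by (simp add: \<alpha>_def power_divide power_mult_distrib)
    have "\<alpha> ^ 3 * (\<Sum>b<r. \<Sum>c<r. (\<Sum>a<m. D (a, b) * D (a, c))\<^sup>2) \<le> \<alpha> ^ 3 * (\<beta> ^ 4 * (128 * real p ^ 2 * real r))"
      using F4 \<open>\<alpha> > 0\<close> by (intro mult_left_mono) auto
    also have "\<dots> = \<alpha> * (\<alpha>\<^sup>2 * (\<beta> ^ 4 * (128 * real p ^ 2 * real r)))"
      by (simp add: power2_eq_square power3_eq_cube)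
    also have "\<alpha>\<^sup>2 * (\<beta> ^ 4 * (128 * real p ^ 2 * real r)) = \<beta>\<^sup>2 * (real p * real r) / 8"
      using p \<open>\<beta> > 0\<close> unfolding \<alpha>2 by (simp add: field_simps power2_eq_square power4_eq_xxxx)
    finally have main: "\<alpha> * (4 * \<beta>\<^sup>2 * (real p * real r / 16)) - \<alpha> * (\<beta>\<^sup>2 * (real p * real r) / 8) \<le>
        \<alpha> * (4 * \<beta>\<^sup>2 * ham) - \<alpha> ^ 3 * (\<Sum>b<r. \<Sum>c<r. (\<Sum>a<m. D (a, b) * D (a, c))\<^sup>2)"
      using ham \<open>\<alpha> > 0\<close> by (intro diff_mono mult_left_mono) auto
    have const: "\<beta> * real r * sqrt p / 128 = 2 * (\<alpha> * (4 * \<beta>\<^sup>2 * (real p * real r / 16)) - \<alpha> * (\<beta>\<^sup>2 * (real p * real r) / 8))"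
    proof -
      have "real p = sqrt p * sqrt p"
        by simp
      then show ?thesis
        using p \<open>\<beta> > 0\<close> unfolding \<alpha>_def by (simp add: field_simps power2_eq_square)
    qed
    have "\<beta> * real r * sqrt p / 128 \<le> 2 * (\<alpha> * (\<Sum>a<m. \<Sum>b<r. (D (a, b))\<^sup>2) -
        \<alpha> ^ 3 * (\<Sum>b<r. \<Sum>c<r. (\<Sum>a<m. D (a, b) * D (a, c))\<^sup>2))"
      unfolding F2 const by (rule mult_left_mono[OF main]) simp
    with nuclear_ge_moments[where m = m and D = D, OF \<open>r \<le> n\<close> \<open>\<alpha> > 0\<close> zero] show ?thesis
      unfolding nuclear_ge_def D_def[symmetric] by (meson order_trans)
  qed
  have large: "3 * 2 ^ card J \<le> 4 * card G"
    using many_balanced_signs[OF \<open>r \<le> p\<close> \<open>r \<ge> 1\<close>] J(3) by (simp add: G_def J_def)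
  have "packing m n r (sparse_svd_class m n k l r d \<kappa>) (\<beta> * real r * sqrt p / 128) (\<beta>\<^sup>2 * real (p * r)) J 2 G \<theta>"
    unfolding packing_def
  proof (intro conjI ballI impI)
    show "\<exists>\<theta>0. \<forall>t\<in>G. (\<Sum>ij\<in>{..<m} \<times> {..<n}. (\<theta> t ij - \<theta>0 ij)\<^sup>2) \<le> \<beta>\<^sup>2 * real (p * r)"
      using radius by (intro exI[of _ "stacked d r (\<lambda>_ _. 0)"]) simp
  qed (use J large mat sep in \<open>auto simp: G_def\<close>)
  then show ?thesis
    unfolding p_def J_def by blast
qed

section \<open>Sparse columns\<close>

lemma sum_row_blocks:
  fixes f :: "nat \<Rightarrow> real"
  assumes "r + N * h \<le> m" "\<And>a. a \<ge> r + N * h \<Longrightarrow> f a = 0"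
  shows "(\<Sum>a=r..<m. f a) = (\<Sum>x<N. \<Sum>y<h. f (r + x * h + y))"
proof -
  have "(\<Sum>a=r..<m. f a) = (\<Sum>i<N * h. f (r + i))"
    using assms by (rule sum_shifted_rows)
  also have "\<dots> = (\<Sum>x<N. \<Sum>i=x * h..<x * h + h. f (r + i))"
    by (rule sum.nat_group[symmetric])
  also have "\<dots> = (\<Sum>x<N. \<Sum>y<h. f (r + x * h + y))"
  proof (rule sum.cong[OF refl])
    fix x
    show "(\<Sum>i=x * h..<x * h + h. f (r + i)) = (\<Sum>y<h. f (r + x * h + y))"
      using sum.shift_bounds_nat_ivl[of "\<lambda>i. f (r + i)" 0 "x * h" h]
      by (simp add: lessThan_atLeast0 add_ac)
  qed
  finally show ?thesis .
qed

text \<open>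
  Column \<open>b\<close> of the lower block consists of \<open>s\<close> row blocks of height \<open>h\<close>; in block \<open>x\<close> its only
  nonzero entry sits in position \<open>t x\<close>.
\<close>

lemma sparse_packing:
  assumes "r \<ge> 1" "s \<ge> 1" "h \<ge> 2" "r + r * s \<le> k" "r + r * s * h \<le> m" "r \<le> l" "r \<le> n"
    and "d > 0" "\<kappa> > 0" "\<beta> > 0" and \<beta>: "\<beta>\<^sup>2 * real (r * s) \<le> (\<kappa>\<^sup>2 - 1) * d\<^sup>2"
  shows "\<exists>G \<theta>. packing m n r (sparse_svd_class m n k l r d \<kappa>) (\<beta> * real r * sqrt s / 16)
    (\<beta>\<^sup>2 * real (r * s)) {..<r * s} h G \<theta>"
proof -
  define N where "N = r * s"
  have N: "N \<ge> 1" "r + N \<le> k" "r + N * h \<le> m"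
    using assms by (auto simp: N_def)
  have div_r: "x div s < r" if "x < N" for x
    using that \<open>s \<ge> 1\<close> by (simp add: N_def less_mult_imp_div_less)
  define G where "G = words {..<N} h"
  \<comment> \<open>Row \<open>r + x * h + y\<close> with \<open>y < h\<close> is position
    \<open>y\<close> of block \<open>x\<close>, and block \<open>x\<close> belongs to column
    \<open>x div s\<close>; different columns thus occupy disjoint rows.\<close>
  define B where "B t a b = (if a < r + N * h \<and> (a - r) div h div s = b \<and> t ((a - r) div h) = (a - r) mod h
    then \<beta> else 0)" for t :: "nat \<Rightarrow> nat" and a b
  have B_eq: "B t (r + x * h + y) b = (if x div s = b \<and> t x = y then \<beta> else 0)" if "x < N" "y < h" for t x y b
  proof -
    have "Suc x * h \<le> N * h"
      using that by (intro mult_right_mono) auto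
    then have "r + x * h + y < r + N * h"
      using that by simp
    then show ?thesis
      using that by (simp add: B_def add.assoc)
  qed
  define \<theta> where "\<theta> t = stacked d r (B t)" for t
  have tlt: "t x < h" if "t \<in> G" "x < N" for t x
    using that by (auto simp: G_def words_def)
  have frob: "(\<Sum>a=r..<m. \<Sum>b<r. (B t a b)\<^sup>2) = \<beta>\<^sup>2 * real N" if t: "t \<in> G" for t
  proof -
    have "(\<Sum>a=r..<m. \<Sum>b<r. (B t a b)\<^sup>2) = (\<Sum>x<N. \<Sum>y<h. \<Sum>b<r. (B t (r + x * h + y) b)\<^sup>2)"
      using N by (intro sum_row_blocks) (auto simp: B_def)
    also have "\<dots> = (\<Sum>x<N. \<Sum>y<h. if t x = y then \<beta>\<^sup>2 else 0)"
    proof (intro sum.cong refl)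
      fix x y assume "x \<in> {..<N}" "y \<in> {..<h}"
      then have "(\<Sum>b<r. (B t (r + x * h + y) b)\<^sup>2) = (\<Sum>b<r. if x div s = b then if t x = y then \<beta>\<^sup>2 else 0 else 0)"
        by (intro sum.cong refl) (simp add: B_eq)
      also have "\<dots> = (if t x = y then \<beta>\<^sup>2 else 0)"
        using div_r \<open>x \<in> {..<N}\<close> by simp
      finally show "(\<Sum>b<r. (B t (r + x * h + y) b)\<^sup>2) = (if t x = y then \<beta>\<^sup>2 else 0)" .
    qed
    also have "\<dots> = (\<Sum>x<N. \<beta>\<^sup>2)"
      by (intro sum.cong refl) (simp add: tlt[OF t])
    finally show ?thesis
      by simp
  qed
  have mat: "Matrix.mat m n (\<theta> t) \<in> sparse_svd_class m n k l r d \<kappa>" if t: "t \<in> G" for t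
    unfolding \<theta>_def
  proof (rule stacked_in_class)
    show "(\<Sum>a=r..<m. \<Sum>b<r. (B t a b)\<^sup>2) \<le> (\<kappa>\<^sup>2 - 1) * d\<^sup>2"
      using \<beta> by (simp add: frob[OF t] N_def)
    have "{a \<in> {r..<m}. \<exists>b<r. B t a b \<noteq> 0} \<subseteq> (\<lambda>x. r + x * h + t x) ` {..<N}"
    proof
      fix a assume "a \<in> {a \<in> {r..<m}. \<exists>b<r. B t a b \<noteq> 0}"
      then have a: "r \<le> a" "a < r + N * h" "t ((a - r) div h) = (a - r) mod h"
        by (auto simp: B_def split: if_splits)
      have "a - r < N * h"
        using a by linarith
      then have "(a - r) div h < N"
        by (rule less_mult_imp_div_less)
      moreover have "a = r + (a - r) div h * h + t ((a - r) div h)"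
        using a by simp
      ultimately show "a \<in> (\<lambda>x. r + x * h + t x) ` {..<N}"
        by blast
    qed
    then have "card {a \<in> {r..<m}. \<exists>b<r. B t a b \<noteq> 0} \<le> card {..<N}"
      by (rule surj_card_le[rotated]) simp
    then show "card {a \<in> {r..<m}. \<exists>b<r. B t a b \<noteq> 0} \<le> k - r"
      using N by simp
  qed (use assms N in auto)
  have sep: "nuclear_ge m n r (\<beta> * real r * sqrt s / 16) (\<lambda>i. \<theta> t i - \<theta> t' i)"
    if t: "t \<in> G" "t' \<in> G" and far: "card {..<N} < 16 * hamming {..<N} t t'" for t t'
  proof -
    define D where "D = (\<lambda>i. \<theta> t i - \<theta> t' i)"
    define e where "e x y = (if t x = y then 1 else 0) - (if t' x = y then 1 else (0::real))" for x y
    have D_block: "D (r + x * h + y, b) = (if x div s = b then \<beta> * e x y else 0)"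
      if "x < N" "y < h" "b < r" for x y b
      using that by (auto simp: D_def \<theta>_def stacked_def B_eq e_def)
    have D_zero: "D (a, b) = 0" if "a < r \<or> a \<ge> r + N * h" "b < r" for a b
      using that by (auto simp: D_def \<theta>_def stacked_def B_def)
    have e_sum: "(\<Sum>y<h. e x y * e x y) = (if t x \<noteq> t' x then 2 else 0)" if "x < N" for x
    proof (cases "t x = t' x")
      case False
      have "(\<Sum>y<h. e x y * e x y) = (\<Sum>y<h. (if t x = y then 1 else 0) + (if t' x = y then 1 else 0))"
        using False by (intro sum.cong refl) (auto simp: e_def)
      also have "\<dots> = 2"
        using tlt[OF t(1) that] tlt[OF t(2) that] by (simp add: sum.distrib)
      finally show ?thesis
        using False by simp
    qed (simp add: e_def)
    define c where "c j = (\<Sum>x<N. if x div s = j \<and> t x \<noteq> t' x then 1 else (0::real))" for j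
    \<comment> \<open>Columns of the difference are orthogonal since their blocks are disjoint. A
      letter on which the words disagree contributes one entry \<open>\<beta>\<close> and one entry
      \<open>- \<beta>\<close>, hence the factor 2.\<close>
    have DD: "ip m (\<lambda>a. D (a, i)) (\<lambda>a. D (a, j)) = (if i = j then 2 * \<beta>\<^sup>2 * c j else 0)"
      if "i < r" "j < r" for i j
    proof -
      have "ip m (\<lambda>a. D (a, i)) (\<lambda>a. D (a, j)) = (\<Sum>a=r..<m. D (a, i) * D (a, j))"
        unfolding ip_def using that by (intro sum.mono_neutral_right) (auto simp: D_zero)
      also have "\<dots> = (\<Sum>x<N. \<Sum>y<h. D (r + x * h + y, i) * D (r + x * h + y, j))"
        using N that by (intro sum_row_blocks) (auto simp: D_zero)
      also have "\<dots> = (\<Sum>x<N. \<Sum>y<h. (if x div s = i \<and> x div s = j then \<beta>\<^sup>2 else 0) * (e x y * e x y))"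
        using that by (intro sum.cong refl) (simp add: D_block power2_eq_square)
      also have "\<dots> = (\<Sum>x<N. (if x div s = i \<and> x div s = j then \<beta>\<^sup>2 else 0) * (if t x \<noteq> t' x then 2 else 0))"
        unfolding sum_distrib_left[symmetric] by (intro sum.cong refl) (simp add: e_sum)
      also have "\<dots> = (if i = j then 2 * \<beta>\<^sup>2 * c j else 0)"
        by (auto simp: c_def sum_distrib_left intro!: sum.cong sum.neutral)
      finally show ?thesis .
    qed
    have c_le: "c j \<le> s" for j
    proof -
      have "c j = real (card {x \<in> {..<N}. x div s = j \<and> t x \<noteq> t' x})"
        by (simp add: c_def sum.If_cases Int_def)
      also have "\<dots> \<le> real (card {j * s..<j * s + s})"
      proof -
        have "{x \<in> {..<N}. x div s = j \<and> t x \<noteq> t' x} \<subseteq> {j * s..<j * s + s}"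
          using \<open>s \<ge> 1\<close> dividend_less_div_times[of s] by (auto simp: div_times_less_eq_dividend add.commute)
        then show ?thesis
          by (intro of_nat_mono card_mono) auto
      qed
      finally show ?thesis
        by simp
    qed
    have c_sum: "(\<Sum>j<r. c j) = real (hamming {..<N} t t')"
    proof -
      have "(\<Sum>j<r. c j) = (\<Sum>x<N. \<Sum>j<r. if x div s = j \<and> t x \<noteq> t' x then 1 else 0)"
        unfolding c_def by (rule sum.swap)
      also have "\<dots> = (\<Sum>x<N. if t x \<noteq> t' x then 1 else 0)"
      proof (intro sum.cong refl)
        fix x assume "x \<in> {..<N}"
        have "(\<Sum>j<r. if x div s = j \<and> t x \<noteq> t' x then 1 else 0) =
            (\<Sum>j<r. if x div s = j then if t x \<noteq> t' x then 1 else 0 else (0::real))"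
          by (intro sum.cong) auto
        then show "(\<Sum>j<r. if x div s = j \<and> t x \<noteq> t' x then 1 else 0) = (if t x \<noteq> t' x then 1 else (0::real))"
          using div_r \<open>x \<in> {..<N}\<close> by simp
      qed
      also have "\<dots> = real (hamming {..<N} t t')"
        by (simp add: hamming_def sum.If_cases Int_def)
      finally show ?thesis .
    qed
    \<comment> \<open>All columns are divided by the same constant, not each by its own length. The
      pairing is then linear in \<open>c j\<close>, so that only the total Hamming distance enters,
      and columns without disagreement do no harm.\<close>
    define w where "w j a = D (a, j) / (2 * \<beta> * sqrt s)" for j a
    define y where "y j b = (if b = j then 1 else (0::real))" for j b :: nat
    have ww: "ip m (w i) (w j) = ip m (\<lambda>a. D (a, i)) (\<lambda>a. D (a, j)) / (4 * \<beta>\<^sup>2 * s)" for i j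
    proof -
      have "(2 * \<beta> * sqrt s)\<^sup>2 = 4 * \<beta>\<^sup>2 * s"
        by (simp add: power_mult_distrib)
      then show ?thesis
        unfolding ip_def w_def times_divide_times_eq power2_eq_square[of "2 * \<beta> * sqrt s", symmetric]
        by (simp add: sum_divide_distrib)
    qed
    have w: "suborthonormal r m w"
      unfolding suborthonormal_def
    proof (intro conjI allI impI)
      fix i assume "i < r"
      then have "ip m (w i) (w i) = c i / (2 * s)"
        using \<open>\<beta> > 0\<close> by (simp add: ww DD)
      also have "\<dots> \<le> 1"
        using c_le[of i] \<open>s \<ge> 1\<close> by (simp add: divide_le_eq)
      finally show "ip m (w i) (w i) \<le> 1" .
    qed (simp add: ww DD)
    have y: "suborthonormal r n y"
      using \<open>r \<le> n\<close> by (auto simp: suborthonormal_def ip_def y_def if_distrib[of "\<lambda>x. x * _"] cong: if_cong)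
    have "dual_pairing m n r w y D = (\<Sum>j<r. \<Sum>a<m. w j a * D (a, j))"
      unfolding dual_pairing_def using \<open>r \<le> n\<close>
      by (intro sum.cong refl) (simp add: y_def if_distrib[of "\<lambda>x. _ * x"] cong: if_cong)
    also have "\<dots> = (\<Sum>j<r. ip m (\<lambda>a. D (a, j)) (\<lambda>a. D (a, j)) / (2 * \<beta> * sqrt s))"
      unfolding ip_def w_def by (simp add: sum_divide_distrib)
    also have "\<dots> = (\<Sum>j<r. \<beta> / sqrt s * c j)"
      using \<open>\<beta> > 0\<close> by (intro sum.cong refl) (simp add: DD power2_eq_square)
    also have "\<dots> = \<beta> / sqrt s * real (hamming {..<N} t t')"
      unfolding sum_distrib_left[symmetric] c_sum ..
    finally have pairing: "dual_pairing m n r w y D = \<beta> / sqrt s * real (hamming {..<N} t t')" .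
    have "real N / 16 \<le> real (hamming {..<N} t t')"
      using far by simp
    then have "\<beta> / sqrt s * (real N / 16) \<le> \<beta> / sqrt s * real (hamming {..<N} t t')"
      using \<open>\<beta> > 0\<close> by (intro mult_left_mono) auto
    moreover have "\<beta> / sqrt s * (real N / 16) = \<beta> * real r * sqrt s / 16"
    proof -
      have "real s / sqrt s = sqrt s"
        by (rule real_div_sqrt) simp
      moreover have "\<beta> / sqrt s * (real N / 16) = \<beta> * real r * (real s / sqrt s) / 16"
        by (simp add: N_def)
      ultimately show ?thesis
        by simp
    qed
    ultimately have "\<beta> * real r * sqrt s / 16 \<le> dual_pairing m n r w y D"
      by (simp only: pairing)
    then show ?thesis
      unfolding nuclear_ge_def D_def[symmetric] using w y by blast
  qed
  have "packing m n r (sparse_svd_class m n k l r d \<kappa>) (\<beta> * real r * sqrt s / 16) (\<beta>\<^sup>2 * real N) {..<N} h G \<theta>"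
    unfolding packing_def
  proof (intro conjI ballI impI)
    show "\<exists>\<theta>0. \<forall>t\<in>G. (\<Sum>ij\<in>{..<m} \<times> {..<n}. (\<theta> t ij - \<theta>0 ij)\<^sup>2) \<le> \<beta>\<^sup>2 * real N"
      unfolding \<theta>_def
      by (intro exI[of _ "stacked d r (\<lambda>_ _. 0)"]) (simp add: stacked_radius[OF \<open>r \<le> n\<close>] frob)
    show "3 * h ^ card {..<N} \<le> 4 * card G"
      by (simp add: G_def card_words)
    show "{..<N} \<noteq> {}"
      using N by (simp add: lessThan_empty_iff)
  qed (use \<open>h \<ge> 2\<close> mat sep in \<open>auto simp: G_def\<close>)
  then show ?thesis
    unfolding N_def by blast
qed

section \<open>The minimax bound\<close>

text \<open>The separation is of order \<open>sqrt r\<close> times the Frobenius radius, which turns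
  Hoelder's factor \<open>r powr (2 / q - 2)\<close> into \<open>r powr (2 / q - 1)\<close>: up to a
  constant, the risk is this factor times the squared radius.\<close>

lemma risk_of_packing:
  assumes "n \<le> m" "1 \<le> q" "r \<ge> 1" "\<sigma> > 0" "p \<ge> 1" "C > 0" "\<beta> \<ge> 0"
    and packing: "packing m n r F (\<beta> * real r * sqrt p / C) (\<beta>\<^sup>2 * real (r * p)) J h G \<theta>"
    and J: "card J = r * p" and \<beta>: "\<beta>\<^sup>2 \<le> \<sigma>\<^sup>2 * ln (real h) / 40"
  shows "minimax_risk m n \<sigma> q F \<ge> ennreal (real r powr (2 / q - 1) * (\<beta>\<^sup>2 * real (r * p)) / (20 * C\<^sup>2))"
proof -
  have "(\<beta> * real r * sqrt p / C)\<^sup>2 * real r powr (2 / q - 2) / 20 =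
      \<beta>\<^sup>2 * real p * (real r * real r * real r powr (2 / q - 2)) / (20 * C\<^sup>2)"
  proof -
    have "(\<beta> * real r * sqrt p / C)\<^sup>2 = \<beta>\<^sup>2 * (real r * real r) * real p / C\<^sup>2"
      by (simp add: power_mult_distrib power_divide power2_eq_square[of "real r"])
    then show ?thesis
      by (simp add: mult_ac)
  qed
  also have "real r * real r * real r powr (2 / q - 2) = real r * real r powr (2 / q - 1)"
  proof -
    have "real r * real r powr (2 / q - 2) = real r powr (2 / q - 1)"
      using \<open>r \<ge> 1\<close> by (simp add: powr_mult_base)
    then show ?thesis
      by simp
  qed
  also have "\<beta>\<^sup>2 * real p * (real r * real r powr (2 / q - 1)) = real r powr (2 / q - 1) * (\<beta>\<^sup>2 * real (r * p))"
    by simp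
  finally have eq: "(\<beta> * real r * sqrt p / C)\<^sup>2 * real r powr (2 / q - 2) / 20 =
      real r powr (2 / q - 1) * (\<beta>\<^sup>2 * real (r * p)) / (20 * C\<^sup>2)" .
  have "\<beta>\<^sup>2 * real (r * p) \<le> \<sigma>\<^sup>2 * ln (real h) / 40 * real (r * p)"
    using \<beta> by (intro mult_right_mono) auto
  then have "\<beta>\<^sup>2 * real (r * p) \<le> \<sigma>\<^sup>2 * (real (card J) * ln (real h) / 40)"
    by (simp add: J mult_ac)
  from minimax_risk_packing[OF assms(1,2) _ \<open>\<sigma> > 0\<close> _ packing this] show ?thesis
    unfolding eq using assms by simp
qed

text \<open>Each of the \<open>r\<close> columns gets as many blocks as the row support leaves after
  the identity block, and the blocks get the height that the other \<open>m - r\<close> rows allow.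
  As \<open>2 * r \<le> k\<close>, rounding costs at most a factor 4 in \<open>r * s\<close>, and
  \<open>h + 1\<close> is at least \<open>m / k\<close>, so \<open>ln h\<close> can stand in for the
  logarithm of the rate up to an additive constant.\<close>

lemma sparse_parameters:
  fixes r k m :: nat
  assumes "r \<ge> 1" "2 * r \<le> k" "k \<le> m"
  obtains s h where "s \<ge> 1" "h \<ge> 1" "r + r * s \<le> k" "r + r * s * h \<le> m" "k \<le> 4 * (r * s)" "m \<le> (h + 1) * k"
proof -
  define s where "s = (k - r) div r"
  define h where "h = (m - r) div (r * s)"
  have s: "s \<ge> 1"
    using assms unfolding s_def by (simp add: div_greater_zero_iff Suc_le_eq)
  have rs: "r * s \<le> k - r"
    unfolding s_def by simp
  have "k - r < r * s + r"
    using dividend_less_times_div[of r "k - r"] assms by (simp add: s_def)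
  moreover have "r * 1 \<le> r * s"
    using s by (intro mult_left_mono) auto
  ultimately have k: "k \<le> 4 * (r * s)"
    using assms by linarith
  have pos: "r * s > 0"
    using assms s by simp
  have h: "h \<ge> 1"
    using rs assms pos unfolding h_def by (simp add: div_greater_zero_iff Suc_le_eq)
  have rsh: "r * s * h \<le> m - r"
    unfolding h_def by simp
  have "m - r < r * s + r * s * h"
    using dividend_less_times_div[OF pos, of "m - r"] by (simp add: h_def)
  then have "m \<le> r * s + r * s * h + r"
    by linarith
  also have "\<dots> \<le> (h + 1) * (r * s + r)"
    by (simp add: algebra_simps)
  also have "\<dots> \<le> (h + 1) * k"
    using rs assms by (intro mult_left_mono) auto
  finally have "m \<le> (h + 1) * k" .
  then show ?thesis
    using that[OF s h] rs rsh k assms by linarith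
qed

text \<open>The 2 collects the factor \<open>e\<close> and the step from \<open>h + 1\<close> to
  \<open>2 * h\<close>.\<close>

lemma ln_ratio_le:
  fixes k m h :: nat
  assumes "k \<ge> 1" "m \<ge> 1" "h \<ge> 1" "m \<le> (h + 1) * k"
  shows "ln (exp 1 * real m / real k) \<le> 2 + ln (real h)"
proof -
  have "real m \<le> real ((h + 1) * k)"
    using assms(4) by (rule of_nat_mono)
  then have "real m / real k \<le> real (h + 1)"
    using assms(1) by (simp add: divide_le_eq algebra_simps)
  also have "\<dots> \<le> 2 * real h"
    using assms(3) by simp
  finally have "ln (real m / real k) \<le> ln (2 * real h)"
    using assms by (subst ln_le_cancel_iff) auto
  also have "\<dots> = ln 2 + ln (real h)"
    using assms by (simp add: ln_mult)
  also have "ln 2 \<le> (1::real)"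
    using ln_le_minus_one[of "2::real"] by simp
  finally have "ln (real m / real k) \<le> 1 + ln (real h)"
    by simp
  moreover have "ln (exp 1 * real m / real k) = 1 + ln (real m / real k)"
    using assms by (simp add: ln_mult[of "exp 1" "real m / real k", simplified])
  ultimately show ?thesis
    by simp
qed

text \<open>1280 is 40 times 32: 40 from the admissible radius of a packing, 32 from comparing each
  term with the logarithm of the number of words. \<open>\<kappa>\<^sup>2 - 1\<close> is the
  Frobenius budget of the class, and \<open>20 * 128\<^sup>2\<close> comes from
  \<open>risk_of_packing\<close> with the weaker of the two separations.\<close>

definition rate_const :: "real \<Rightarrow> real" where
  "rate_const \<kappa> = min (1 / 1280) (\<kappa>\<^sup>2 - 1) / (20 * 128\<^sup>2)"

lemma rate_const_pos: "\<kappa> > 1 \<Longrightarrow> rate_const \<kappa> > 0"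
  using power_strict_mono[of 1 \<kappa> 2] by (simp add: rate_const_def)

text \<open>
  The transfer hypotheses \<open>dense\<close> and \<open>sparse\<close> are instantiated with the identity for the
  row terms and with transposition for the column terms.
\<close>

lemma row_terms:
  fixes M N m n k l r :: nat
  assumes "N \<le> M" "1 \<le> q" "r \<ge> 1" "2 * r \<le> k" "k \<le> m" "r \<le> l" "r \<le> n" "d > 0" "\<kappa> > 1" "\<sigma> > 0"
    and dense: "\<And>(J :: (nat \<times> nat) set) h G \<theta> \<gamma> \<rho>. packing m n r (sparse_svd_class m n k l r d \<kappa>) \<gamma> \<rho> J h G \<theta> \<Longrightarrow>
      \<exists>\<theta>. packing M N r F \<gamma> \<rho> J h G \<theta>"
    and sparse: "\<And>(J :: nat set) h G \<theta> \<gamma> \<rho>. packing m n r (sparse_svd_class m n k l r d \<kappa>) \<gamma> \<rho> J h G \<theta> \<Longrightarrow>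
      \<exists>\<theta>. packing M N r F \<gamma> \<rho> J h G \<theta>"
  shows "minimax_risk M N \<sigma> q F \<ge>
      ennreal (rate_const \<kappa> * real r powr (2 / q - 1) * min (d\<^sup>2) (\<sigma>\<^sup>2 * (real r * real k)))"
    and "minimax_risk M N \<sigma> q F \<ge>
      ennreal (rate_const \<kappa> * real r powr (2 / q - 1) * min (d\<^sup>2) (\<sigma>\<^sup>2 * (real k * ln (exp 1 * real m / real k))))"
proof -
  define X where "X = real r powr (2 / q - 1)"
  have "X \<ge> 0"
    by (simp add: X_def)
  have \<kappa>: "\<kappa>\<^sup>2 - 1 > 0"
    using power_strict_mono[of 1 \<kappa> 2] \<open>\<kappa> > 1\<close> by simp
  \<comment> \<open>The squared Frobenius radius, limited by what testing allows when
    \<open>A\<close> is the logarithm of the number of words and by what the class allows.\<close>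
  define rate where "rate A = min (\<sigma>\<^sup>2 * A / 40) ((\<kappa>\<^sup>2 - 1) * d\<^sup>2)" for A
  have rate: "rate_const \<kappa> * X * min (d\<^sup>2) (\<sigma>\<^sup>2 * T) \<le> X * rate A / (20 * C\<^sup>2)"
    if "0 \<le> T" "T \<le> 32 * A" "0 < C" "C \<le> 128" for T A C
  proof -
    define a where "a = min (1 / 1280) (\<kappa>\<^sup>2 - 1)"
    have a: "a > 0" "a \<le> 1 / 1280" "a \<le> \<kappa>\<^sup>2 - 1"
      using \<kappa> unfolding a_def by (auto simp only: min_less_iff_conj min.cobounded1 min.cobounded2)
    have "a * min (d\<^sup>2) (\<sigma>\<^sup>2 * T) \<le> (\<kappa>\<^sup>2 - 1) * d\<^sup>2"
      using a that by (intro mult_mono) auto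
    moreover have "a * min (d\<^sup>2) (\<sigma>\<^sup>2 * T) \<le> \<sigma>\<^sup>2 * A / 40"
    proof -
      have "a * min (d\<^sup>2) (\<sigma>\<^sup>2 * T) \<le> 1 / 1280 * (\<sigma>\<^sup>2 * T)"
        using a that by (intro mult_mono) auto
      also have "\<dots> \<le> 1 / 1280 * (\<sigma>\<^sup>2 * (32 * A))"
        using that by (intro mult_left_mono) auto
      finally show ?thesis
        by (simp add: mult.commute)
    qed
    ultimately have "a * min (d\<^sup>2) (\<sigma>\<^sup>2 * T) \<le> rate A"
      by (simp add: rate_def)
    then have "X * (a * min (d\<^sup>2) (\<sigma>\<^sup>2 * T)) \<le> X * rate A"
      using \<open>X \<ge> 0\<close> by (rule mult_left_mono)
    moreover have "0 \<le> X * (a * min (d\<^sup>2) (\<sigma>\<^sup>2 * T))"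
      using a that \<open>X \<ge> 0\<close> by auto
    moreover have "20 * C\<^sup>2 \<le> 20 * 128\<^sup>2"
      using that by (intro mult_left_mono power_mono) auto
    ultimately have "X * (a * min (d\<^sup>2) (\<sigma>\<^sup>2 * T)) / (20 * 128\<^sup>2) \<le> X * rate A / (20 * C\<^sup>2)"
      using that by (intro frac_le) auto
    then show ?thesis
      by (simp add: rate_const_def a_def[symmetric] mult_ac)
  qed
  \<comment> \<open>The entry size that spends the squared radius \<open>rate\<close> evenly on the
    \<open>w\<close> nonzero entries of the lower block.\<close>
  have \<beta>: "\<exists>\<beta>>0. \<beta>\<^sup>2 * real w = rate (real w * ln (real h)) \<and> \<beta>\<^sup>2 \<le> \<sigma>\<^sup>2 * ln (real h) / 40 \<and>
      \<beta>\<^sup>2 * real w \<le> (\<kappa>\<^sup>2 - 1) * d\<^sup>2" if "w \<ge> 1" "h \<ge> 2" for w h :: nat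
  proof -
    have "ln (real h) > 0"
      using that by simp
    then have pos: "rate (real w * ln (real h)) > 0"
      using \<kappa> that \<open>d > 0\<close> \<open>\<sigma> > 0\<close> by (simp add: rate_def)
    define \<beta> where "\<beta> = sqrt (rate (real w * ln (real h)) / real w)"
    have b: "\<beta>\<^sup>2 * real w = rate (real w * ln (real h))"
      using pos that by (simp add: \<beta>_def)
    have "\<beta>\<^sup>2 * real w \<le> \<sigma>\<^sup>2 * ln (real h) / 40 * real w"
      unfolding b by (simp add: rate_def mult_ac min.coboundedI1)
    then have "\<beta>\<^sup>2 \<le> \<sigma>\<^sup>2 * ln (real h) / 40"
      using that by (subst (asm) mult_le_cancel_right_pos) auto
    moreover have "\<beta> > 0"
      using pos that by (simp add: \<beta>_def)
    ultimately show ?thesis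
      using b by (intro exI[of _ \<beta>]) (simp add: rate_def)
  qed
  have ln2: "ln (2::real) \<ge> 1 / 2"
    using ln_one_minus_pos_upper_bound[of "1 / 2 :: real"] by (simp add: ln_div)
  \<comment> \<open>Stated for every \<open>T\<close> up to \<open>2 * r * k\<close> because it also
    serves the logarithmic term when the blocks have height 1.\<close>
  have dense_bound: "minimax_risk M N \<sigma> q F \<ge>
      ennreal (rate_const \<kappa> * X * min (d\<^sup>2) (\<sigma>\<^sup>2 * T))"
    if T: "0 \<le> T" "T \<le> 2 * (real r * real k)" for T
  proof -
    have kr: "k - r \<ge> 1" "2 * (k - r) \<ge> k"
      using assms by auto
    have "(k - r) * r \<ge> 1"
      using kr \<open>r \<ge> 1\<close> by (simp add: Suc_le_eq)
    then obtain \<beta> where \<beta>: "\<beta> > 0" "\<beta>\<^sup>2 * real ((k - r) * r) = rate (real ((k - r) * r) * ln (real 2))"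
      "\<beta>\<^sup>2 \<le> \<sigma>\<^sup>2 * ln (real 2) / 40" "\<beta>\<^sup>2 * real ((k - r) * r) \<le> (\<kappa>\<^sup>2 - 1) * d\<^sup>2"
      using \<beta>[of "(k - r) * r" 2] by auto
    obtain G \<theta> where "packing m n r (sparse_svd_class m n k l r d \<kappa>) (\<beta> * real r * sqrt (k - r) / 128)
        (\<beta>\<^sup>2 * real ((k - r) * r)) ({..<k - r} \<times> {..<r}) 2 G \<theta>"
      using dense_packing[OF \<open>r \<ge> 1\<close> \<open>2 * r \<le> k\<close> \<open>k \<le> m\<close> \<open>r \<le> l\<close> \<open>r \<le> n\<close> \<open>d > 0\<close> _ \<beta>(1,4)] \<open>\<kappa> > 1\<close> by auto
    then obtain \<theta>' where "packing M N r F (\<beta> * real r * sqrt (k - r) / 128)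
        (\<beta>\<^sup>2 * real (r * (k - r))) ({..<k - r} \<times> {..<r}) 2 G \<theta>'"
      using dense by (metis mult.commute)
    from risk_of_packing[OF \<open>N \<le> M\<close> \<open>1 \<le> q\<close> \<open>r \<ge> 1\<close> \<open>\<sigma> > 0\<close> kr(1) _ _ this] \<beta>
    have "minimax_risk M N \<sigma> q F \<ge> ennreal (X * rate (real ((k - r) * r) * ln (real 2)) / (20 * 128\<^sup>2))"
      by (simp add: X_def mult.commute[of r])
    moreover have "rate_const \<kappa> * X * min (d\<^sup>2) (\<sigma>\<^sup>2 * T) \<le>
        X * rate (real ((k - r) * r) * ln (real 2)) / (20 * 128\<^sup>2)"
    proof (rule rate)
      have "real k \<le> 2 * real (k - r)"
        using kr(2) by linarith
      then have "real r * real k \<le> real r * (2 * real (k - r))"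
        by (intro mult_left_mono) auto
      then have "T \<le> 4 * real ((k - r) * r) * 1"
        using T(2) by (simp add: mult_ac)
      also have "\<dots> \<le> 4 * real ((k - r) * r) * (8 * ln 2)"
        using ln2 by (intro mult_left_mono) auto
      finally show "T \<le> 32 * (real ((k - r) * r) * ln (real 2))"
        by simp
    qed (use T in auto)
    ultimately show ?thesis
      by (meson ennreal_leI order_trans)
  qed
  show "minimax_risk M N \<sigma> q F \<ge>
      ennreal (rate_const \<kappa> * real r powr (2 / q - 1) * min (d\<^sup>2) (\<sigma>\<^sup>2 * (real r * real k)))"
    using dense_bound[of "real r * real k"] by (simp add: X_def)
  have km: "k \<ge> 1" "m \<ge> 1"
    using assms by auto
  have "exp 1 * 1 \<le> exp 1 * (real m / real k)"
    using km \<open>k \<le> m\<close> by (intro mult_left_mono) auto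
  then have "ln (exp 1) \<le> ln (exp 1 * real m / real k)"
    using km by (subst ln_le_cancel_iff) auto
  then have lnT: "ln (exp 1 * real m / real k) \<ge> 0"
    by simp
  define T where "T = real k * ln (exp 1 * real m / real k)"
  have T0: "T \<ge> 0"
    using lnT by (simp add: T_def)
  obtain s h where sh: "s \<ge> 1" "h \<ge> 1" "r + r * s \<le> k" "r + r * s * h \<le> m" "k \<le> 4 * (r * s)" "m \<le> (h + 1) * k"
    using sparse_parameters[OF \<open>r \<ge> 1\<close> \<open>2 * r \<le> k\<close> \<open>k \<le> m\<close>] by blast
  note ln_le = ln_ratio_le[OF km sh(2,6)]
  \<comment> \<open>Blocks of height 1 leave no choice of position, hence no sparse packing; the
    logarithm is then at most 2 and \<open>T\<close> falls within the range of
    \<open>dense_bound\<close>. From height 2 on, \<open>ln h\<close> is at least 1/2 and absorbs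
    the additive 2 of \<open>ln_ratio_le\<close>.\<close>
  have "minimax_risk M N \<sigma> q F \<ge> ennreal (rate_const \<kappa> * X * min (d\<^sup>2) (\<sigma>\<^sup>2 * T))"
  proof (cases "h = 1")
    case True
    have "T \<le> real k * 2"
      unfolding T_def using ln_le True by (intro mult_left_mono) auto
    also have "\<dots> = 2 * (1 * real k)"
      by simp
    also have "\<dots> \<le> 2 * (real r * real k)"
      using \<open>r \<ge> 1\<close> by (intro mult_left_mono mult_right_mono) auto
    finally show ?thesis
      using T0 by (intro dense_bound)
  next
    case False
    then have h: "h \<ge> 2"
      using sh(2) by simp
    have "r * s \<ge> 1"
      using sh(1) \<open>r \<ge> 1\<close> by (simp add: Suc_le_eq)
    then obtain \<beta> where \<beta>: "\<beta> > 0" "\<beta>\<^sup>2 * real (r * s) = rate (real (r * s) * ln (real h))"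
      "\<beta>\<^sup>2 \<le> \<sigma>\<^sup>2 * ln (real h) / 40" "\<beta>\<^sup>2 * real (r * s) \<le> (\<kappa>\<^sup>2 - 1) * d\<^sup>2"
      using \<beta>[of "r * s" h] h by auto
    obtain G \<theta> where "packing m n r (sparse_svd_class m n k l r d \<kappa>) (\<beta> * real r * sqrt s / 16)
        (\<beta>\<^sup>2 * real (r * s)) {..<r * s} h G \<theta>"
      using sparse_packing[OF \<open>r \<ge> 1\<close> sh(1) h sh(3,4) \<open>r \<le> l\<close> \<open>r \<le> n\<close> \<open>d > 0\<close> _ \<beta>(1,4)] \<open>\<kappa> > 1\<close> by auto
    then obtain \<theta>' where "packing M N r F (\<beta> * real r * sqrt s / 16) (\<beta>\<^sup>2 * real (r * s)) {..<r * s} h G \<theta>'"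
      using sparse by blast
    from risk_of_packing[OF \<open>N \<le> M\<close> \<open>1 \<le> q\<close> \<open>r \<ge> 1\<close> \<open>\<sigma> > 0\<close> sh(1) _ _ this] \<beta>
    have "minimax_risk M N \<sigma> q F \<ge> ennreal (X * rate (real (r * s) * ln (real h)) / (20 * 16\<^sup>2))"
      by (simp add: X_def)
    moreover have "rate_const \<kappa> * X * min (d\<^sup>2) (\<sigma>\<^sup>2 * T) \<le>
        X * rate (real (r * s) * ln (real h)) / (20 * 16\<^sup>2)"
    proof (rule rate)
      have lnh: "ln (real h) \<ge> 1 / 2"
        using ln2 h by (meson ln_mono numeral_le_real_of_nat_iff order_trans of_nat_0_less_iff zero_less_numeral less_le_trans)
      have "real k \<le> real (4 * (r * s))"
        using sh(5) by (rule of_nat_mono)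
      then have "T \<le> real (4 * (r * s)) * (8 * ln (real h))"
        unfolding T_def using ln_le lnh lnT by (intro mult_mono) auto
      then show "T \<le> 32 * (real (r * s) * ln (real h))"
        by simp
    qed (use T0 in auto)
    ultimately show ?thesis
      by (meson ennreal_leI order_trans)
  qed
  then show "minimax_risk M N \<sigma> q F \<ge>
      ennreal (rate_const \<kappa> * real r powr (2 / q - 1) * min (d\<^sup>2) (\<sigma>\<^sup>2 * (real k * ln (exp 1 * real m / real k))))"
    by (simp add: X_def T_def)
qed

text \<open>The largest of the four terms is at least a quarter of their sum, so separate bounds for
  the four terms combine at the price of a factor 4.\<close>

lemma min_sum_le:
  fixes D s :: real
  assumes "D \<ge> 0" "s \<ge> 0" "a1 \<ge> 0" "a2 \<ge> 0" "a3 \<ge> 0" "a4 \<ge> 0"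
  shows "\<exists>a\<in>{a1, a2, a3, a4}. min D (s * (a1 + a2 + a3 + a4)) / 4 \<le> min D (s * a)"
proof -
  define a where "a = Max {a1, a2, a3, a4}"
  have a: "a \<in> {a1, a2, a3, a4}"
    unfolding a_def by (rule Max_in) auto
  have "a1 \<le> a" "a2 \<le> a" "a3 \<le> a" "a4 \<le> a"
    unfolding a_def by auto
  then have "s * (a1 + a2 + a3 + a4) \<le> s * (4 * a)"
    using \<open>s \<ge> 0\<close> by (intro mult_left_mono) auto
  then have "min D (s * (a1 + a2 + a3 + a4)) / 4 \<le> min D (s * a)"
    using \<open>D \<ge> 0\<close> by (auto simp: min_def)
  then show ?thesis
    using a by blast
qed

theorem theorem1:
  fixes \<kappa> :: real
  assumes "\<kappa> > 1"
  shows "\<exists>c>0. \<forall>(m::nat) (n::nat) (k::nat) (l::nat) (r::nat) (d::real) (\<sigma>::real) (q::real).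
    m \<ge> n \<and> m \<ge> k \<and> k \<ge> r \<and> r \<ge> 1 \<and> n \<ge> l \<and> l \<ge> r \<and> min k l \<ge> 2 * r \<and>
    d > 0 \<and> \<sigma> > 0 \<and> 1 \<le> q \<and> q \<le> 2 \<longrightarrow>
      minimax_risk m n \<sigma> q (sparse_svd_class m n k l r d \<kappa>) \<ge>
        ennreal (c * \<sigma>\<^sup>2 * min (real r powr (2 / q - 1) * (d\<^sup>2 / \<sigma>\<^sup>2)) (Psi q m n k l r))"
proof (intro exI[of _ "rate_const \<kappa> / 4"] conjI allI impI)
  show "0 < rate_const \<kappa> / 4"
    using rate_const_pos[OF assms] by simp
next
  fix m n k l r :: nat and d \<sigma> q :: real
  assume "m \<ge> n \<and> m \<ge> k \<and> k \<ge> r \<and> r \<ge> 1 \<and> n \<ge> l \<and> l \<ge> r \<and> min k l \<ge> 2 * r \<and>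
    d > 0 \<and> \<sigma> > 0 \<and> 1 \<le> q \<and> q \<le> 2"
  then have mn: "n \<le> m" "k \<le> m" "l \<le> n" "r \<ge> 1" "2 * r \<le> k" "2 * r \<le> l" "d > 0" "\<sigma> > 0" "1 \<le> q"
    by auto
  then have r: "r \<le> k" "r \<le> l" "r \<le> n" "r \<le> m"
    by auto
  define F where "F = sparse_svd_class m n k l r d \<kappa>"
  define X where "X = real r powr (2 / q - 1)"
  define R where "R = minimax_risk m n \<sigma> q F"
  define a1 a2 a3 a4 where "a1 = real r * real k" and "a2 = real r * real l"
    and "a3 = real k * ln (exp 1 * real m / real k)" and "a4 = real l * ln (exp 1 * real n / real l)"
  note rows = row_terms[where F = F, OF mn(1,9,4,5,2) r(2,3) mn(7) assms mn(8), folded X_def R_def a1_def a3_def]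
  \<comment> \<open>The families are built in the transposed class, with \<open>m\<close>,
    \<open>k\<close> and \<open>n\<close>, \<open>l\<close> exchanged, while the risk stays that of
    \<open>m\<close> by \<open>n\<close> matrices, as the duality bound for Schatten norms is for
    \<open>n \<le> m\<close>.\<close>
  note cols = row_terms[where F = F, OF mn(1,9,4,6,3) r(1,4) mn(7) assms mn(8), folded X_def R_def a2_def a4_def]
  have swap: "\<exists>\<theta>. packing m n r F \<gamma> \<rho> J h G \<theta>"
    if "packing n m r (sparse_svd_class n m l k r d \<kappa>) \<gamma> \<rho> J h G \<theta>" for \<gamma> \<rho> h \<theta> and J :: "'j set" and G
    using packing_transpose[OF that mn(7)] unfolding F_def by blast
  have bound: "R \<ge> ennreal (rate_const \<kappa> * X * min (d\<^sup>2) (\<sigma>\<^sup>2 * a))" if "a \<in> {a1, a2, a3, a4}" for a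
  proof -
    have "R \<ge> ennreal (rate_const \<kappa> * X * min (d\<^sup>2) (\<sigma>\<^sup>2 * a1))"
      by (rule rows(1)) (auto simp: F_def)
    moreover have "R \<ge> ennreal (rate_const \<kappa> * X * min (d\<^sup>2) (\<sigma>\<^sup>2 * a3))"
      by (rule rows(2)) (auto simp: F_def)
    moreover have "R \<ge> ennreal (rate_const \<kappa> * X * min (d\<^sup>2) (\<sigma>\<^sup>2 * a2))"
      by (rule cols(1)) (erule swap)+
    moreover have "R \<ge> ennreal (rate_const \<kappa> * X * min (d\<^sup>2) (\<sigma>\<^sup>2 * a4))"
      by (rule cols(2)) (erule swap)+
    ultimately show ?thesis
      using that by blast
  qed
  have ln_nonneg: "ln (exp 1 * real M / real K) \<ge> 0" if "K \<le> M" "K \<ge> 1" for K M :: nat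
  proof -
    have "exp 1 * 1 \<le> exp 1 * (real M / real K)"
      using that by (intro mult_left_mono) auto
    moreover have "1 \<le> exp (1::real)"
      by simp
    ultimately have "1 \<le> exp 1 * (real M / real K)"
      by linarith
    then show ?thesis
      by (intro ln_ge_zero) simp
  qed
  have nonneg: "a1 \<ge> 0" "a2 \<ge> 0" "a3 \<ge> 0" "a4 \<ge> 0"
    unfolding a1_def a2_def a3_def a4_def using mn by (auto intro!: mult_nonneg_nonneg ln_nonneg)
  obtain a where a: "a \<in> {a1, a2, a3, a4}"
    "min (d\<^sup>2) (\<sigma>\<^sup>2 * (a1 + a2 + a3 + a4)) / 4 \<le> min (d\<^sup>2) (\<sigma>\<^sup>2 * a)"
    using min_sum_le[OF _ _ nonneg, of "d\<^sup>2" "\<sigma>\<^sup>2"] by auto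
  have Psi: "Psi q m n k l r = X * (a1 + a2 + a3 + a4)"
  proof -
    have "real r powr (2 / q) = X * real r"
      using mn by (simp add: X_def powr_diff)
    then show ?thesis
      by (simp add: Psi_def X_def a1_def a2_def a3_def a4_def algebra_simps)
  qed
  have "\<sigma>\<^sup>2 * min (X * (d\<^sup>2 / \<sigma>\<^sup>2)) (Psi q m n k l r) = X * min (d\<^sup>2) (\<sigma>\<^sup>2 * (a1 + a2 + a3 + a4))"
  proof -
    have "\<sigma>\<^sup>2 * min (X * (d\<^sup>2 / \<sigma>\<^sup>2)) (Psi q m n k l r) =
        min (\<sigma>\<^sup>2 * (X * (d\<^sup>2 / \<sigma>\<^sup>2))) (\<sigma>\<^sup>2 * (X * (a1 + a2 + a3 + a4)))"
      unfolding Psi by (rule min_mult_distrib_left[THEN trans]) simp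
    also have "\<dots> = min (X * d\<^sup>2) (X * (\<sigma>\<^sup>2 * (a1 + a2 + a3 + a4)))"
      using mn by (simp add: mult_ac)
    also have "\<dots> = X * min (d\<^sup>2) (\<sigma>\<^sup>2 * (a1 + a2 + a3 + a4))"
      by (simp add: min_mult_distrib_left X_def)
    finally show ?thesis .
  qed
  then have "rate_const \<kappa> / 4 * \<sigma>\<^sup>2 * min (X * (d\<^sup>2 / \<sigma>\<^sup>2)) (Psi q m n k l r) =
      rate_const \<kappa> * X * (min (d\<^sup>2) (\<sigma>\<^sup>2 * (a1 + a2 + a3 + a4)) / 4)"
    by simp
  also have "\<dots> \<le> rate_const \<kappa> * X * min (d\<^sup>2) (\<sigma>\<^sup>2 * a)"
    using rate_const_pos[OF assms] a(2) by (intro mult_left_mono) (auto simp: X_def)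
  finally have "ennreal (rate_const \<kappa> / 4 * \<sigma>\<^sup>2 * min (X * (d\<^sup>2 / \<sigma>\<^sup>2)) (Psi q m n k l r)) \<le> R"
    using bound[OF a(1)] by (meson ennreal_leI order_trans)
  then show "minimax_risk m n \<sigma> q (sparse_svd_class m n k l r d \<kappa>) \<ge>
      ennreal (rate_const \<kappa> / 4 * \<sigma>\<^sup>2 * min (real r powr (2 / q - 1) * (d\<^sup>2 / \<sigma>\<^sup>2)) (Psi q m n k l r))"
    by (simp add: R_def F_def X_def)
qed

end
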